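(* Let $\mathbf{A}(x,\lambda)$ be a $4\times4$ matrix-valued function of $x\in\mathbb{R}$ and $\lambda\in\mathbb{C}$, $T$-periodic in $x$ for some $T>0$, satisfying (A1) and (A2) (stated in the context), with $\operatorname{tr}(\mathbf{A}(x,\lambda))=0$ for all $x\in\mathbb{R}$ and $\lambda\in\mathbb{C}$. Let $\mathbf{M}(\lambda)$ be the monodromy matrix of $\mathbf{v}_x=\mathbf{A}(x,\lambda)\mathbf{v}$. Then for $\lambda\in i\mathbb{R}$, $\mathbf{M}(\lambda)$ has zero, two, or four eigenvalues on the unit circle, counted by algebraic multiplicity. For $\lambda\in i\mathbb{R}$ define the real-valued functions $f_1,f_2,f_3$ by $$f_1(\lambda)+if_2(\lambda)=\operatorname{tr}(\mathbf{M}(\lambda)),\qquad f_3(\lambda)=\tfrac12\big(\operatorname{tr}(\mathbf{M}(\lambda))^2-\operatorname{tr}(\mathbf{M}^2(\lambda))\big),$$ and let (with all functions evaluated at $\lambda$) $$\begin{aligned}\Delta_4=&-4(f_1^6+f_2^6)-12f_1^2f_2^2(f_1^2+f_2^2)+(f_1^2+f_2^2)^2f_3^2+36(f_1^4-f_2^4)f_3-8(f_1^2-f_2^2)f_3^3\\&-60(f_1^4+f_2^4)+312f_1^2f_2^2+16f_3^4-80(f_1^2+f_2^2)f_3^2+288(f_1^2-f_2^2)f_3-192(f_1^2+f_2^2)-128f_3^2+256,\end{aligned}$$ $$P_4=8(2f_1+f_3+2)(2f_3-12)-48f_2^2,$$ $$\begin{aligned}D_4=-256\big(&4f_1^4+3f_2^4+f_1^2(4f_2^2+(-6+f_3)^2)+f_2^2(28+12f_3-f_3^2)+4f_1^3(2+f_3)\\&-4(-2+f_3)(2+f_3)^2+16f_1(4+2f_2^2-f_3^2)\big).\end{aligned}$$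 Suppose that $\lambda\in i\mathbb{R}$ and $\Delta_4(\lambda),P_4(\lambda),D_4(\lambda)\neq0$. Then $\lambda$ belongs to the $L^2(\mathbb{R})$ essential spectrum of $\lambda v=\mathcal{J}\mathcal{L}v$ with: (1) multiplicity $4$ if $\Delta_4(\lambda)>0$ and $P_4(\lambda),D_4(\lambda)<0$; (2) multiplicity $2$ if $\Delta_4(\lambda)<0$; (3) multiplicity $0$ if $\Delta_4(\lambda)>0$ while $P_4(\lambda)>0$ or $D_4(\lambda)>0$.
   Context: Assumptions. (A1) $\mathbf{A}(x,\lambda)$ is real for $\lambda\in\mathbb{R}$. (A2) $\mathbf{A}^\top(x,\lambda)\mathbf{B}(\lambda)=-\mathbf{B}(\lambda)\mathbf{A}(x,-\lambda)$ for some matrix $\mathbf{B}(\lambda)$, independent of $x$, and nonsingular for all $\lambda\in\mathbb{C}$ except at most finitely many values of $\lambda$ ($\top$ is the non-conjugated transpose). Regularity: $\mathbf{A}$ is continuous in $(x,\lambda)$ and, for each $x$, entire in $\lambda$. Monodromy matrix: $\mathbf{M}(\lambda)=\mathbf{V}(T,\lambda)$, where $\mathbf{V}_x=\mathbf{A}(x,\lambda)\mathbf{V}$ and $\mathbf{V}(0,\lambda)=\mathbf{I}$, the identity matrix. Under the hypotheses, $f_3(\lambda)$ is real for $\lambda\in i\mathbb{R}$. Spectral problem: $\mathbf{v}_x=\mathbf{A}(x,\lambda)\mathbf{v}$ is the first-order reformulation of a spectral problem $\lambda v=\mathcal{J}\mathcal{L}v$, $\lambda\in\mathbb{C}$, where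 $\mathcal{J}$ represents a symplectic form, $\mathcal{L}$ is a linear self-adjoint operator, and $\mathcal{J}\mathcal{L}$ has $T$-periodic coefficients in $x$. By Floquet theory $\lambda$ belongs to the $L^2(\mathbb{R})$ essential spectrum iff $\mathbf{M}(\lambda)$ has an eigenvalue on the unit circle; when $\mathbf{M}(\lambda)$ has exactly $m$ eigenvalues on the unit circle, all simple, $\lambda$ is said to belong to the essential spectrum with (algebraic) multiplicity $m$; multiplicity $0$ means that $\lambda$ is not in the spectrum. *)

theory Defs
  imports "HOL-Complex_Analysis.Complex_Analysis" "HOL-Computational_Algebra.Polynomial"
begin

definition A1_real :: "(real \<Rightarrow> complex \<Rightarrow> complex^4^4) \<Rightarrow> bool" where
  "A1_real A \<longleftrightarrow> (\<forall>x r i j. A x (complex_of_real r) $ i $ j \<in> \<real>)"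

definition A2_symmetric :: "(real \<Rightarrow> complex \<Rightarrow> complex^4^4) \<Rightarrow> bool" where
  "A2_symmetric A \<longleftrightarrow>
     (\<exists>B :: complex \<Rightarrow> complex^4^4.
        finite {l. \<not> invertible (B l)} \<and>
        (\<forall>x l. transpose (A x l) ** B l = - (B l ** A x (- l))))"

definition regular_coefficient :: "(real \<Rightarrow> complex \<Rightarrow> complex^4^4) \<Rightarrow> bool" where
  "regular_coefficient A \<longleftrightarrow>
     continuous_on UNIV (\<lambda>(x, l). A x l) \<and>
     (\<forall>x i j. (\<lambda>l. A x l $ i $ j) holomorphic_on UNIV)"

text \<open>The fundamental solution, normalised at \<open>x = 0\<close>. It exists and is unique for every continuous
  \<open>A\<close>; the monodromy matrix of a \<open>T\<close>-periodic system is \<open>V T l\<close>.\<close>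

definition fundamental_solution ::
    "(real \<Rightarrow> complex \<Rightarrow> complex^4^4) \<Rightarrow> (real \<Rightarrow> complex \<Rightarrow> complex^4^4) \<Rightarrow> bool" where
  "fundamental_solution A V \<longleftrightarrow>
     (\<forall>l. V 0 l = mat 1 \<and>
        (\<forall>x. ((\<lambda>y. V y l) has_vector_derivative (A x l ** V x l)) (at x)))"

definition eigenvalue_of :: "complex^4^4 \<Rightarrow> complex \<Rightarrow> bool" where
  "eigenvalue_of M \<mu> \<longleftrightarrow> (\<exists>v. v \<noteq> 0 \<and> M *v v = \<mu> *s v)"

definition charpoly :: "complex^4^4 \<Rightarrow> complex poly" where
  "charpoly M = det (mat [:0, 1:] - (\<chi> i j. [:M $ i $ j:]))"

definition alg_mult :: "complex^4^4 \<Rightarrow> complex \<Rightarrow> nat" where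
  "alg_mult M \<mu> = order \<mu> (charpoly M)"

definition circle_eigenvalues :: "complex^4^4 \<Rightarrow> complex set" where
  "circle_eigenvalues M = {\<mu>. eigenvalue_of M \<mu> \<and> cmod \<mu> = 1}"

definition circle_count :: "complex^4^4 \<Rightarrow> nat" where
  "circle_count M = (\<Sum>\<mu>\<in>circle_eigenvalues M. alg_mult M \<mu>)"

text \<open>Square-integrable functions are represented by Borel functions, not by classes modulo null
  sets. \<open>H1_deriv v w\<close> says that \<open>v\<close> is the (unique) continuous representative of an element of
  \<open>H\<^sup>1(\<real>)\<close> with weak derivative \<open>w\<close>; hence solutions \<open>v\<close> below are compared pointwise.\<close>

definition L2_fun :: "(real \<Rightarrow> complex^4) set" where
  "L2_fun = {f. f \<in> borel_measurable lborel \<and> integrable lborel (\<lambda>x. (norm (f x))\<^sup>2)}"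

definition L2_norm :: "(real \<Rightarrow> complex^4) \<Rightarrow> real" where
  "L2_norm f = sqrt (LINT x|lborel. (norm (f x))\<^sup>2)"

definition H1_deriv :: "(real \<Rightarrow> complex^4) \<Rightarrow> (real \<Rightarrow> complex^4) \<Rightarrow> bool" where
  "H1_deriv v w \<longleftrightarrow> v \<in> L2_fun \<and> w \<in> L2_fun \<and>
     (\<forall>a b. a \<le> b \<longrightarrow> (LINT x:{a..b}|lborel. w x) = v b - v a)"

text \<open>The spectral problem is represented by its first-order reformulation, i.e. by the operators
  \<open>\<T>(l) = d/dx - A(\<cdot>, l)\<close> on \<open>L\<^sup>2(\<real>)\<close> with domain \<open>H\<^sup>1(\<real>)\<close>; \<open>first_order_op A l v g\<close> is the graph
  relation \<open>\<T>(l) v = g\<close>. The point \<open>l\<close> is in the spectrum iff \<open>\<T>(l)\<close> has no bounded inverse, and in the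
  essential spectrum iff \<open>\<T>(l)\<close> is not Fredholm. (Closedness of the range is automatic for a
  closed operator whose range has finite codimension.)\<close>

definition first_order_op ::
    "(real \<Rightarrow> complex \<Rightarrow> complex^4^4) \<Rightarrow> complex \<Rightarrow> (real \<Rightarrow> complex^4) \<Rightarrow> (real \<Rightarrow> complex^4) \<Rightarrow> bool" where
  "first_order_op A l v g \<longleftrightarrow> g \<in> L2_fun \<and>
     (\<exists>w. H1_deriv v w \<and> (AE x in lborel. g x = w x - A x l *v v x))"

definition L2_spectrum :: "(real \<Rightarrow> complex \<Rightarrow> complex^4^4) \<Rightarrow> complex set" where
  "L2_spectrum A = {l. \<not> (\<exists>C. \<forall>g\<in>L2_fun. \<exists>v. first_order_op A l v g \<and>
      (\<forall>u. first_order_op A l u g \<longrightarrow> u = v) \<and> L2_norm v \<le> C * L2_norm g)}"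

definition fredholm_at :: "(real \<Rightarrow> complex \<Rightarrow> complex^4^4) \<Rightarrow> complex \<Rightarrow> bool" where
  "fredholm_at A l \<longleftrightarrow>
     (\<exists>K. finite K \<and> K \<subseteq> L2_fun \<and>
        (\<forall>v. first_order_op A l v (\<lambda>x. 0) \<longrightarrow> (\<exists>c. v = (\<lambda>x. \<Sum>k\<in>K. c k *s k x)))) \<and>
     (\<exists>F. finite F \<and> F \<subseteq> L2_fun \<and>
        (\<forall>g\<in>L2_fun. \<exists>c v. first_order_op A l v (\<lambda>x. g x - (\<Sum>f\<in>F. c f *s f x))))"

definition L2_ess_spectrum :: "(real \<Rightarrow> complex \<Rightarrow> complex^4^4) \<Rightarrow> complex set" where
  "L2_ess_spectrum A = {l. \<not> fredholm_at A l}"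

definition ess_spectrum_with_mult ::
    "(real \<Rightarrow> complex \<Rightarrow> complex^4^4) \<Rightarrow> complex^4^4 \<Rightarrow> complex \<Rightarrow> nat \<Rightarrow> bool" where
  "ess_spectrum_with_mult A M l m \<longleftrightarrow>
     (if m = 0 then l \<notin> L2_spectrum A else l \<in> L2_ess_spectrum A) \<and>
     card (circle_eigenvalues M) = m \<and> (\<forall>\<mu>\<in>circle_eigenvalues M. alg_mult M \<mu> = 1)"

text \<open>Real parts are taken only to obtain real-valued functions: \<open>f3_complex M\<close> is real for the
  monodromy matrices at hand, which is part of the theorem.\<close>

definition f1 :: "complex^4^4 \<Rightarrow> real" where
  "f1 M = Re (trace M)"

definition f2 :: "complex^4^4 \<Rightarrow> real" where
  "f2 M = Im (trace M)"

definition f3_complex :: "complex^4^4 \<Rightarrow> complex" where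
  "f3_complex M = 1/2 * ((trace M)\<^sup>2 - trace (M ** M))"

definition f3 :: "complex^4^4 \<Rightarrow> real" where
  "f3 M = Re (f3_complex M)"

definition Delta4 :: "complex^4^4 \<Rightarrow> real" where
  "Delta4 M = (let f1 = f1 M; f2 = f2 M; f3 = f3 M in
     - 4 * (f1^6 + f2^6) - 12 * f1^2 * f2^2 * (f1^2 + f2^2) + (f1^2 + f2^2)^2 * f3^2
     + 36 * (f1^4 - f2^4) * f3 - 8 * (f1^2 - f2^2) * f3^3
     - 60 * (f1^4 + f2^4) + 312 * f1^2 * f2^2 + 16 * f3^4 - 80 * (f1^2 + f2^2) * f3^2
     + 288 * (f1^2 - f2^2) * f3 - 192 * (f1^2 + f2^2) - 128 * f3^2 + 256)"

definition P4 :: "complex^4^4 \<Rightarrow> real" where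
  "P4 M = (let f1 = f1 M; f2 = f2 M; f3 = f3 M in
     8 * (2 * f1 + f3 + 2) * (2 * f3 - 12) - 48 * f2^2)"

definition D4 :: "complex^4^4 \<Rightarrow> real" where
  "D4 M = (let f1 = f1 M; f2 = f2 M; f3 = f3 M in
     - 256 * (4 * f1^4 + 3 * f2^4 + f1^2 * (4 * f2^2 + (- 6 + f3)^2)
       + f2^2 * (28 + 12 * f3 - f3^2) + 4 * f1^3 * (2 + f3)
       - 4 * (- 2 + f3) * (2 + f3)^2 + 16 * f1 * (4 + 2 * f2^2 - f3^2)))"

end

theory Submission
  imports Defs "HOL-Computational_Algebra.Fundamental_Theorem_Algebra" "HOL-Real_Asymp.Real_Asymp"
begin

text \<open>Write \<open>M\<close> for the monodromy matrix at a point \<open>\<lambda>\<close> of the imaginary axis.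

  \<^bold>\<open>Symmetry.\<close> Liouville's formula gives \<open>det M = 1\<close>. By (A1) the monodromy matrix at \<open>-\<lambda>\<close> is the
  complex conjugate of \<open>M\<close>, and by (A2) the product \<open>V(x, \<lambda>)\<^sup>T B(\<lambda>) V(x, -\<lambda>)\<close> does not depend on \<open>x\<close>.
  So wherever \<open>B\<close> is invertible the conjugate of \<open>M\<close> is similar to the inverse transpose of \<open>M\<close>; the
  resulting identities between coefficients of characteristic polynomials extend to the finitely
  many other points because \<open>V(T, \<lambda>)\<close> is continuous in \<open>\<lambda>\<close>. The characteristic polynomial is therefore
  \<open>z\<^sup>4 - a z\<^sup>3 + c z\<^sup>2 - a\<^sup>* z + 1\<close>, where \<open>c\<close> is the real number \<open>f\<^sub>3\<close> and \<open>a\<^sup>*\<close> is the conjugate of \<open>a\<close>.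
  Reflection in the unit circle, \<open>z \<mapsto> 1/z\<^sup>*\<close>, permutes its roots, so the roots form two pairs, each
  of them either on the circle or exchanged by the reflection (\<open>reciprocal_quartic_roots\<close>). Hence zero, two
  or four of them are on the circle.

  \<^bold>\<open>Counting.\<close> A pair has product \<open>\<kappa>\<^sup>2\<close> and sum \<open>\<sigma> \<kappa>\<close> with \<open>\<kappa>\<close> unimodular and \<open>\<sigma>\<close> real, and it is on the circle
  exactly if \<open>\<sigma>\<^sup>2 \<le> 4\<close> (up to the case of equality). The Cayley substitution \<open>z = -(t + i)/(t - i)\<close>, which
  maps the real projective line to the circle, turns the polynomial into a real quartic and the two pairs into real
  quadratic factors with discriminants \<open>4 (4 - \<sigma>\<^sup>2)\<close> and \<open>4 (4 - \<tau>\<^sup>2)\<close>. Up to a positive factor \<open>\<Delta>\<^sub>4\<close> is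
  the discriminant of this quartic, while \<open>P\<^sub>4\<close> and \<open>D\<^sub>4\<close> are the two classical quantities that
  tell four real roots from none. All three are explicit expressions in the two quadratic
  discriminants (\<open>quartic_disc_prod\<close>, \<open>quartic_P_prod\<close>, \<open>quartic_D_prod\<close>), from which
  the signs can be read off (\<open>circle_count_criterion\<close>).

  \<^bold>\<open>Spectrum.\<close> If \<open>M\<close> has an eigenvalue on the circle, the adjoint equation \<open>z' = -A\<^sup>T z\<close> has a solution that is
  bounded and bounded away from zero. For \<open>v' = A v + g\<close> one has \<open>(z \<sqdot> v)' = z \<sqdot> g\<close>, so \<open>g\<close> lies in the
  range only if some primitive of \<open>z \<sqdot> g\<close> is square integrable. Unbounded primitives with square integrable
  derivative form a space of infinite dimension, so the range has infinite codimension
  (\<open>not_fredholm\<close>). If no eigenvalue is on the circle and all of them are simple, the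
  Floquet solutions split into decaying and growing ones, and integrating the components of \<open>g\<close>
  from the side on which the kernel decays gives a solution operator
  with an exponentially decaying kernel, bounded on \<open>L\<^sup>2\<close> by Young's inequality
  (\<open>bounded_inverse\<close>). Simplicity comes from \<open>\<Delta>\<^sub>4 \<noteq> 0\<close>.\<close>

(* The dollar sign is kept for matrix entries alone: with its second reading as a coefficient of a
   power series, an expanded 4x4 determinant has exponentially many parses. *)
no_notation fps_nth (infixl \<open>$\<close> 75)

section \<open>Characteristic polynomials of 4x4 matrices\<close>

text \<open>Every permutation of four points is a product of at most three transpositions, and
  these products enumerate the terms of the determinant; the sign is read off factor by factor.\<close>

lemma sum_permutations_4:
  fixes f :: "(4 \<Rightarrow> 4) \<Rightarrow> 'a::comm_ring_1"
  shows "sum f {p. p permutes UNIV} = (\<Sum>b\<in>{1,2,3,4}. \<Sum>c\<in>{2,3,4}. \<Sum>d\<in>{3,4}.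
     f (Transposition.transpose 1 b \<circ> (Transposition.transpose 2 c \<circ> Transposition.transpose 3 d)))"
proof -
  have f1234: "finite {2::4, 3, 4}" "1 \<notin> {2::4, 3, 4}" by auto
  have f234: "finite {3::4, 4}" "2 \<notin> {3::4, 4}" by auto
  have f34: "finite {4::4}" "3 \<notin> {4::4}" by auto
  show ?thesis
    unfolding UNIV_4
    unfolding sum_over_permutations_insert[OF f1234]
    unfolding sum_over_permutations_insert[OF f234]
    unfolding sum_over_permutations_insert[OF f34]
    unfolding permutes_sing by simp
qed

lemma sign_3_transpositions:
  "sign (Transposition.transpose a b \<circ> (Transposition.transpose c d \<circ> Transposition.transpose e (f::'a::finite)))
   = (if a = b then 1 else - 1) * ((if c = d then 1 else - 1) * (if e = f then 1 else - 1))"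
  by (simp add: sign_compose permutation_compose permutation_swap_id sign_swap_id)

lemma det_4:
  "det (A::'a::comm_ring_1^4^4) =
    A$1$1 * (A$2$2 * (A$3$3 * A$4$4 - A$3$4 * A$4$3) - A$2$3 * (A$3$2 * A$4$4 - A$3$4 * A$4$2) + A$2$4 * (A$3$2 * A$4$3 - A$3$3 * A$4$2))
  - A$1$2 * (A$2$1 * (A$3$3 * A$4$4 - A$3$4 * A$4$3) - A$2$3 * (A$3$1 * A$4$4 - A$3$4 * A$4$1) + A$2$4 * (A$3$1 * A$4$3 - A$3$3 * A$4$1))
  + A$1$3 * (A$2$1 * (A$3$2 * A$4$4 - A$3$4 * A$4$2) - A$2$2 * (A$3$1 * A$4$4 - A$3$4 * A$4$1) + A$2$4 * (A$3$1 * A$4$2 - A$3$2 * A$4$1))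
  - A$1$4 * (A$2$1 * (A$3$2 * A$4$3 - A$3$3 * A$4$2) - A$2$2 * (A$3$1 * A$4$3 - A$3$3 * A$4$1) + A$2$3 * (A$3$1 * A$4$2 - A$3$2 * A$4$1))"
proof -
  have prod_4: "prod g (UNIV::4 set) = g 1 * (g 2 * (g 3 * g 4))" for g :: "4 \<Rightarrow> 'a"
    unfolding UNIV_4 by simp
  have sums: "sum g {1,2,3,4::4} = g 1 + g 2 + g 3 + g 4" "sum g {2,3,4::4} = g 2 + g 3 + g 4"
     "sum g {3,4::4} = g 3 + g 4" for g :: "4 \<Rightarrow> 'a" by (simp_all add: add.assoc)
  show ?thesis
    unfolding det_def sum_permutations_4 sign_3_transpositions prod_4 sums
    by (simp add: Transposition.transpose_def algebra_simps)
qed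
text \<open>The third elementary symmetric function of the eigenvalues, as the sum of the principal
  3x3 minors: row \<open>k\<close> is replaced by a unit vector. The second one is \<open>f3_complex\<close>.\<close>

definition minor_sum3 :: "complex^4^4 \<Rightarrow> complex" where
  "minor_sum3 M = (\<Sum>k\<in>UNIV. det (\<chi> i j. if i = k then (if j = k then 1 else 0) else M $ i $ j))"

text \<open>Newton's identity for the second elementary symmetric function.\<close>

lemma f3_complex_eq_minors:
  fixes M :: "complex^4^4"
  shows "f3_complex M =
    M$1$1 * M$2$2 - M$1$2 * M$2$1 + M$1$1 * M$3$3 - M$1$3 * M$3$1 + M$1$1 * M$4$4 - M$1$4 * M$4$1
    + M$2$2 * M$3$3 - M$2$3 * M$3$2 + M$2$2 * M$4$4 - M$2$4 * M$4$2 + M$3$3 * M$4$4 - M$3$4 * M$4$3"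
  unfolding f3_complex_def trace_def sum_4 matrix_matrix_mult_def
  by (simp add: power2_eq_square algebra_simps)

text \<open>The homogeneous form, with two scalars, serves for the characteristic polynomials of both \<open>M\<close> (with \<open>z = 1\<close>)
  and of its inverse (with \<open>w = 1\<close>).\<close>

lemma det_pencil:
  fixes M :: "complex^4^4"
  shows "det (\<chi> i j. (if i = j then w else 0) - z * M $ i $ j) =
    w^4 - trace M * w^3 * z + f3_complex M * w^2 * z^2 - minor_sum3 M * w * z^3 + det M * z^4"
proof -
  have "det (\<chi> i j. (if i = j then w else 0) - z * M $ i $ j) =
    w^4 - (M$1$1 + M$2$2 + M$3$3 + M$4$4) * w^3 * z + f3_complex M * w^2 * z^2
     - minor_sum3 M * w * z^3 + det M * z^4"
    unfolding f3_complex_eq_minors minor_sum3_def sum_4 det_4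
    by simp (simp add: algebra_simps power2_eq_square power3_eq_cube power4_eq_xxxx)
  then show ?thesis by (simp add: trace_def sum_4)
qed

lemma poly_charpoly: "poly (charpoly M) z = det (\<chi> i j. (if i = j then z else 0) - M $ i $ j)"
  unfolding charpoly_def det_4 by (simp add: mat_def algebra_simps)

lemma charpoly_eq:
  "charpoly M = [:det M, - minor_sum3 M, f3_complex M, - trace M, 1:]"
proof (rule poly_eq_poly_eq_iff[THEN iffD1], rule ext)
  fix z
  show "poly (charpoly M) z = poly [:det M, - minor_sum3 M, f3_complex M, - trace M, 1:] z"
    using det_pencil[of z 1 M] unfolding poly_charpoly
    by (simp add: algebra_simps power2_eq_square power3_eq_cube power4_eq_xxxx)
qed

lemma eigenvalue_iff_root: "eigenvalue_of M \<mu> \<longleftrightarrow> poly (charpoly M) \<mu> = 0"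
proof -
  let ?N = "(\<chi> i j. (if i = j then \<mu> else 0) - M $ i $ j) :: complex^4^4"
  have N: "?N *v v = \<mu> *s v - M *v v" for v
    by (simp add: vec_eq_iff matrix_vector_mult_def sum_subtractf left_diff_distrib if_distrib[of "\<lambda>x. x * _"] cong: if_cong)
  have "eigenvalue_of M \<mu> \<longleftrightarrow> (\<exists>v. v \<noteq> 0 \<and> ?N *v v = 0)"
    unfolding eigenvalue_of_def N by (metis eq_iff_diff_eq_0)
  also have "\<dots> \<longleftrightarrow> det ?N = 0"
    using matrix_left_invertible_ker[of ?N] invertible_left_inverse[of ?N] invertible_det_nz[of ?N] by blast
  finally show ?thesis by (simp add: poly_charpoly)
qed

lemma charpoly_transpose: "charpoly (transpose M) = charpoly M"
proof -
  have "charpoly M = det (transpose (mat [:0, 1:] - (\<chi> i j. [:M $ i $ j:])))"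
    by (simp add: charpoly_def det_transpose)
  also have "transpose (mat [:0, 1:] - (\<chi> i j. [:M $ i $ j:])) = mat [:0, 1:] - (\<chi> i j. [:transpose M $ i $ j:])"
    by (simp add: transpose_def vec_eq_iff mat_def)
  finally show ?thesis by (simp add: charpoly_def)
qed

text \<open>If \<open>B\<close> is invertible then \<open>N\<close> is similar to the inverse transpose of \<open>M\<close>, so the characteristic polynomial of \<open>N\<close> is
  that of \<open>M\<close> with the coefficients in reverse order.\<close>

lemma symmetric_coefficients:
  fixes M N B :: "complex^4^4"
  assumes MBN: "transpose M ** B ** N = B" and B: "invertible B" and M: "det M = 1" and N: "det N = 1"
  shows "minor_sum3 M = trace N" "f3_complex M = f3_complex N"
proof -
  have key: "1 - trace M * z + f3_complex M * z^2 - minor_sum3 M * z^3 + z^4 =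
        z^4 - trace N * z^3 + f3_complex N * z^2 - minor_sum3 N * z + 1" for z :: complex
  proof -
    define X where "X = (\<chi> i j. (if i = j then z else 0) - N $ i $ j :: complex^4^4)"
    define Y where "Y = (\<chi> i j. (if i = j then 1 else 0) - z * M $ i $ j :: complex^4^4)"
    have X: "X = mat z - N" by (simp add: X_def vec_eq_iff mat_def)
    have Y: "transpose Y = mat 1 - mat z ** transpose M"
      by (simp add: Y_def vec_eq_iff mat_def transpose_def matrix_matrix_mult_def if_distrib[of "\<lambda>x. x * _"] cong: if_cong)
    have comm: "C ** mat z = mat z ** C" for C :: "complex^4^4"
      by (simp add: vec_eq_iff mat_def matrix_matrix_mult_def if_distrib[of "\<lambda>x. x * _"]
         if_distrib[of "\<lambda>x. _ * x"] mult.commute cong: if_cong)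
    have diff: "C ** (D - E) = C ** D - C ** E" "(D - E) ** C = D ** C - E ** C" for C D E :: "complex^4^4"
      by (simp_all add: vec_eq_iff matrix_matrix_mult_def sum_subtractf algebra_simps)
    have "transpose M ** B ** X = - (transpose Y ** B)"
      unfolding X Y diff MBN comm by (simp add: matrix_mul_assoc)
    also have "\<dots> = (\<chi> i. (-1) *s (transpose Y ** B) $ i)" by (simp add: vec_eq_iff)
    finally have "det M * det B * det X = det (\<chi> i. (-1) *s (transpose Y ** B) $ i)"
      by (metis det_mul det_transpose)
    also have "\<dots> = det Y * det B"
      by (subst det_rows_mul) (simp add: det_mul det_transpose)
    finally have "det X = det Y"
      using B M by (simp add: invertible_det_nz)
    then show ?thesis
      unfolding X_def Y_def using det_pencil[of z 1 N] det_pencil[of 1 z M] M N by simp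
  qed
  \<comment> \<open>Three values of \<open>z\<close> separate the three unknown coefficients.\<close>
  have k1: "f3_complex M - (trace M + minor_sum3 M) = f3_complex N - (trace N + minor_sum3 N)"
    using key[of 1] by (simp add: algebra_simps)
  have k2: "f3_complex M + (trace M + minor_sum3 M) = f3_complex N + (trace N + minor_sum3 N)"
    using key[of "-1"] by (simp add: algebra_simps)
  have "2 * f3_complex M = 2 * f3_complex N"
    using arg_cong2[OF k1 k2, of "(+)"] by simp
  then show f: "f3_complex M = f3_complex N" by simp
  have k4: "trace M + minor_sum3 M = trace N + minor_sum3 N"
    using k2 f by simp
  have k3: "4 * f3_complex N + - 2 * (trace M + 4 * minor_sum3 M) = 4 * f3_complex N + - 2 * (4 * trace N + minor_sum3 N)"
    using key[of 2] unfolding f by (simp add: algebra_simps)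
  have "trace M + 4 * minor_sum3 M = 4 * trace N + minor_sum3 N"
    by (rule iffD1[OF mult_left_cancel, OF _ add_left_imp_eq[OF k3]]) simp
  from arg_cong2[OF this k4, of "(-)"] have "3 * minor_sum3 M = 3 * trace N"
    by (simp add: algebra_simps)
  then show "minor_sum3 M = trace N" by simp
qed

lemma matrix_vector_mult_lincomb:
  fixes M :: "complex^'n^'m"
  shows "M *v (\<Sum>j\<in>I. c j *s f j) = (\<Sum>j\<in>I. c j *s (M *v f j))"
  by (induction I rule: infinite_finite_induct) (auto simp: matrix_vector_right_distrib vector_scalar_commute)

lemma eigenvectors_independent:
  fixes M :: "complex^4^4"
  assumes "finite S" and "\<And>\<mu>. \<mu> \<in> S \<Longrightarrow> e \<mu> \<noteq> 0 \<and> M *v e \<mu> = \<mu> *s e \<mu>"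
    and "(\<Sum>\<mu>\<in>S. c \<mu> *s e \<mu>) = 0"
  shows "\<forall>\<mu>\<in>S. c \<mu> = 0"
  using assms
proof (induction S arbitrary: c rule: finite_induct)
  case empty
  then show ?case by simp
next
  case (insert a S)
  have "M *v (\<Sum>\<mu>\<in>insert a S. c \<mu> *s e \<mu>) = (\<Sum>\<mu>\<in>insert a S. c \<mu> *s (\<mu> *s e \<mu>))"
    unfolding matrix_vector_mult_lincomb using insert.prems(1) by (intro sum.cong) auto
  then have "(\<Sum>\<mu>\<in>insert a S. c \<mu> *s (\<mu> *s e \<mu>)) - a *s (\<Sum>\<mu>\<in>insert a S. c \<mu> *s e \<mu>) = 0"
    unfolding insert.prems by simp
  also have "(\<Sum>\<mu>\<in>insert a S. c \<mu> *s (\<mu> *s e \<mu>)) - a *s (\<Sum>\<mu>\<in>insert a S. c \<mu> *s e \<mu>)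
      = (\<Sum>\<mu>\<in>insert a S. (c \<mu> * (\<mu> - a)) *s e \<mu>)"
    by (simp add: vec_eq_iff sum_distrib_left sum_subtractf[symmetric] algebra_simps)
  also have "\<dots> = (\<Sum>\<mu>\<in>S. (c \<mu> * (\<mu> - a)) *s e \<mu>)"
    using insert by simp
  finally have "\<forall>\<mu>\<in>S. c \<mu> * (\<mu> - a) = 0"
    using insert.IH[of "\<lambda>\<mu>. c \<mu> * (\<mu> - a)"] insert.prems by blast
  then have S: "\<forall>\<mu>\<in>S. c \<mu> = 0"
    using insert.hyps by auto
  then have "c a *s e a = 0"
    using insert by simp
  then show ?case using S insert.prems(1)[of a] by (simp add: vec.scale_eq_0_iff)
qed

text \<open>Columns of \<open>Q\<close> are eigenvectors, rows of its inverse \<open>R\<close> are the dual left eigenvectors. The index type \<open>4\<close>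
  of the matrix also enumerates the eigenvalues.\<close>

lemma diagonalization:
  fixes M :: "complex^4^4"
  assumes card: "card {\<mu>. eigenvalue_of M \<mu>} = 4"
  obtains m Q R where "\<And>j::4. eigenvalue_of M (m j)" "Q ** R = mat 1" "R ** Q = mat 1"
    "\<And>j. M *v column j Q = m j *s column j Q" "\<And>i. transpose M *v row i R = m i *s row i R"
proof -
  let ?S = "{\<mu>. eigenvalue_of M \<mu>}"
  have finS: "finite ?S" using card by (metis card.infinite zero_neq_numeral)
  obtain m where m: "bij_betw m (UNIV :: 4 set) ?S"
    using finite_same_card_bij[of "UNIV :: 4 set" ?S] card finS by auto
  obtain e where e: "\<And>\<mu>. \<mu> \<in> ?S \<Longrightarrow> e \<mu> \<noteq> 0 \<and> M *v e \<mu> = \<mu> *s e \<mu>"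
  proof
    show "(SOME v. v \<noteq> 0 \<and> M *v v = \<mu> *s v) \<noteq> 0 \<and>
        M *v (SOME v. v \<noteq> 0 \<and> M *v v = \<mu> *s v) = \<mu> *s (SOME v. v \<noteq> 0 \<and> M *v v = \<mu> *s v)"
      if "\<mu> \<in> ?S" for \<mu>
      using that someI_ex[of "\<lambda>v. v \<noteq> 0 \<and> M *v v = \<mu> *s v"] by (simp add: eigenvalue_of_def)
  qed
  have mS: "m j \<in> ?S" for j using m by (auto simp: bij_betw_def)
  define Q where "Q = (\<chi> i j. e (m j) $ i)"
  have col: "column j Q = e (m j)" for j by (simp add: Q_def column_def vec_eq_iff)
  have "c = 0" if "Q *v c = 0" for c
  proof -
    have "(\<Sum>\<mu>\<in>?S. c $ (the_inv m \<mu>) *s e \<mu>) = (\<Sum>j\<in>UNIV. c $ (the_inv m (m j)) *s e (m j))"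
      by (rule sum.reindex_bij_betw[OF m, symmetric])
    also have "\<dots> = Q *v c"
      using m by (simp add: bij_betw_def the_inv_f_f vec_eq_iff matrix_vector_mult_def Q_def mult.commute)
    finally have "\<forall>\<mu>\<in>?S. c $ (the_inv m \<mu>) = 0"
      using eigenvectors_independent[OF finS e] that by metis
    then have "c $ j = 0" for j
      using mS[of j] m by (metis bij_betw_def the_inv_f_f)
    then show ?thesis by (simp add: vec_eq_iff)
  qed
  then obtain R where RQ: "R ** Q = mat 1"
    using matrix_left_invertible_ker[of Q] by auto
  then have QR: "Q ** R = mat 1" using matrix_left_right_inverse by blast
  have MQ: "M ** Q = (\<chi> i j. m j * Q $ i $ j)"
  proof -
    have "(M ** Q) $ i $ j = (M *v column j Q) $ i" for i j
      by (simp add: matrix_matrix_mult_def matrix_vector_mult_def column_def)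
    then have "(M ** Q) $ i $ j = m j * Q $ i $ j" for i j
      unfolding col using e[OF mS[of j]] by (simp add: Q_def)
    then show ?thesis by (simp add: vec_eq_iff)
  qed
  have RM: "R ** M = (\<chi> i j. m i * R $ i $ j)"
  proof -
    have "R ** M = R ** (M ** Q) ** R" using QR by (metis matrix_mul_assoc matrix_mul_rid)
    also have "R ** (M ** Q) = (\<chi> i j. m j * (R ** Q) $ i $ j)"
      unfolding MQ by (simp add: vec_eq_iff matrix_matrix_mult_def sum_distrib_left algebra_simps)
    also have "\<dots> ** R = (\<chi> i j. m i * R $ i $ j)"
      unfolding RQ by (simp add: vec_eq_iff matrix_matrix_mult_def mat_def if_distrib[of "\<lambda>x. _ * x"]
        if_distrib[of "\<lambda>x. x * _"] cong: if_cong)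
    finally show ?thesis .
  qed
  have "transpose M *v row i R = m i *s row i R" for i
  proof -
    have "(transpose M *v row i R) $ k = (R ** M) $ i $ k" for k
      by (simp add: matrix_matrix_mult_def matrix_vector_mult_def row_def transpose_def mult.commute)
    then show ?thesis by (simp add: vec_eq_iff RM row_def)
  qed
  then show ?thesis
    using that[of m Q R] mS RQ QR e[OF mS] by (simp add: col)
qed

section \<open>Real quartics with two real quadratic factors\<close>

definition quadratic_disc :: "'a::comm_ring_1 \<Rightarrow> 'a \<Rightarrow> 'a \<Rightarrow> 'a" where
  "quadratic_disc a b c = b^2 - 4 * a * c"

text \<open>The resultant of the quadratics \<open>(a, b, c)\<close> and \<open>(a', b', c')\<close>, which vanishes at a common root.\<close>

definition quadratic_res :: "'a::comm_ring_1 \<Rightarrow> 'a \<Rightarrow> 'a \<Rightarrow> 'a \<Rightarrow> 'a \<Rightarrow> 'a \<Rightarrow> 'a" where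
  "quadratic_res a b c a' b' c' = (a * c' - a' * c)^2 - (a * b' - a' * b) * (b * c' - b' * c)"

definition quartic_disc :: "real \<Rightarrow> real \<Rightarrow> real \<Rightarrow> real \<Rightarrow> real \<Rightarrow> real" where
  "quartic_disc a b c d e =
     256*a^3*e^3 - 192*a^2*b*d*e^2 - 128*a^2*c^2*e^2 + 144*a^2*c*d^2*e - 27*a^2*d^4
     + 144*a*b^2*c*e^2 - 6*a*b^2*d^2*e - 80*a*b*c^2*d*e + 18*a*b*c*d^3 + 16*a*c^4*e
     - 4*a*c^3*d^2 - 27*b^4*e^2 + 18*b^3*c*d*e - 4*b^3*d^3 - 4*b^2*c^3*e + b^2*c^2*d^2"

text \<open>For a quartic with coefficients \<open>a, b, c, d, e\<close> from the leading one down these are, up to positive factors and after division by powers of \<open>a\<close>, the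
  coefficient \<open>p\<close> and the expression \<open>4 s - p\<^sup>2\<close> of the depressed quartic \<open>y\<^sup>4 + p y\<^sup>2 + r y + s\<close>.\<close>

definition quartic_P :: "real \<Rightarrow> real \<Rightarrow> real \<Rightarrow> real" where
  "quartic_P a b c = 8*a*c - 3*b^2"

definition quartic_D :: "real \<Rightarrow> real \<Rightarrow> real \<Rightarrow> real \<Rightarrow> real \<Rightarrow> real" where
  "quartic_D a b c d e = 64*a^3*e - 16*a^2*c^2 + 16*a*b^2*c - 16*a^2*b*d - 3*b^4"

text \<open>In terms of the two quadratic factors, the discriminant is the product of their discriminants with the square of
  their resultant, and \<open>quartic_P\<close> and \<open>quartic_D\<close> become sums whose signs are controlled by the two discriminants.
  The identities hold without division by the leading coefficient, so they cover a root at infinity,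
  which corresponds to the eigenvalue \<open>-1\<close>.\<close>

lemma quartic_disc_prod:
  "quartic_disc (a*a') (a*b' + a'*b) (a*c' + a'*c + b*b') (b*c' + b'*c) (c*c')
    = quadratic_disc a b c * quadratic_disc a' b' c' * (quadratic_res a b c a' b' c')^2"
  unfolding quartic_disc_def quadratic_disc_def quadratic_res_def by algebra

lemma quartic_P_prod:
  "quartic_P (a*a') (a*b' + a'*b) (a*c' + a'*c + b*b')
    = - 2 * (a^2 * quadratic_disc a' b' c' + a'^2 * quadratic_disc a b c) - (a*b' - a'*b)^2"
  unfolding quartic_P_def quadratic_disc_def by algebra

lemma quartic_D_prod:
  "quartic_D (a*a') (a*b' + a'*b) (a*c' + a'*c + b*b') (b*c' + b'*c) (c*c')
    = - 2 * (a*b' - a'*b)^2 * (a^2 * quadratic_disc a' b' c' + a'^2 * quadratic_disc a b c)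
      - (a^2 * quadratic_disc a' b' c' - a'^2 * quadratic_disc a b c)^2"
  unfolding quartic_D_def quadratic_disc_def by algebra

text \<open>The coefficients are those of \<open>(t - i)\<^sup>4 p(-(t + i)/(t - i))\<close> for the characteristic polynomial \<open>p\<close>. The
  factor \<open>4096\<close> is the twelfth power of the determinant \<open>2 i\<close> (up to sign) of the Cayley map.\<close>

lemma Delta4_cayley:
  "quartic_disc (2 + 2 * f1 M + f3 M) (- 4 * f2 M) (2 * f3 M - 12) (- 4 * f2 M) (2 - 2 * f1 M + f3 M)
    = 4096 * Delta4 M"
  unfolding quartic_disc_def Delta4_def Let_def by algebra

lemma P4_cayley:
  "quartic_P (2 + 2 * f1 M + f3 M) (- 4 * f2 M) (2 * f3 M - 12) = P4 M"
  unfolding quartic_P_def P4_def Let_def by algebra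

lemma D4_cayley:
  "quartic_D (2 + 2 * f1 M + f3 M) (- 4 * f2 M) (2 * f3 M - 12) (- 4 * f2 M) (2 - 2 * f1 M + f3 M)
    = D4 M"
  unfolding quartic_D_def D4_def Let_def by algebra

section \<open>Roots of self-reciprocal quartics\<close>

definition reciprocal_pair :: "complex \<Rightarrow> complex \<Rightarrow> bool" where
  "reciprocal_pair \<mu> \<nu> \<longleftrightarrow> (cmod \<mu> = 1 \<and> cmod \<nu> = 1) \<or> (\<mu> \<noteq> 0 \<and> cmod \<mu> < 1 \<and> \<nu> = 1 / cnj \<mu>)"

lemma size_2_mset: "size A = 2 \<Longrightarrow> \<exists>x y. A = {#x, y#}"
proof -
  assume "size A = 2"
  then obtain x B where "A = add_mset x B" using size_eq_Suc_imp_eq_union[of A 1] by auto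
  moreover from this obtain y where "B = {#y#}" using \<open>size A = 2\<close> size_1_singleton_mset[of B] by auto
  ultimately show ?thesis by auto
qed

text \<open>The reflection \<open>x \<mapsto> 1/x\<^sup>*\<close> carries the elements inside the circle to those outside, with multiplicities, so
  these are equally many and can be paired; an even number is left on the circle.\<close>

lemma reciprocal_multiset_pairs:
  assumes size: "size R = 4" and nz: "0 \<notin># R"
    and inv: "image_mset (\<lambda>x. 1 / cnj x) R = R"
  obtains \<mu> \<nu> \<mu>' \<nu>' where "R = {#\<mu>, \<nu>, \<mu>', \<nu>'#}" "reciprocal_pair \<mu> \<nu>" "reciprocal_pair \<mu>' \<nu>'"
proof -
  define I where "I = filter_mset (\<lambda>x. cmod x < 1) R"
  define C where "C = filter_mset (\<lambda>x. cmod x = 1) R"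
  have "filter_mset (\<lambda>x. cmod x > 1) R = filter_mset (\<lambda>x. cmod x > 1) (image_mset (\<lambda>x. 1 / cnj x) R)"
    by (simp add: inv)
  also have "\<dots> = image_mset (\<lambda>x. 1 / cnj x) (filter_mset (\<lambda>x. cmod (1 / cnj x) > 1) R)"
    by (simp add: filter_mset_image_mset)
  also have "filter_mset (\<lambda>x. cmod (1 / cnj x) > 1) R = I"
    unfolding I_def using nz by (intro filter_mset_cong) (auto simp: norm_divide less_divide_eq)
  finally have O: "filter_mset (\<lambda>x. cmod x > 1) R = image_mset (\<lambda>x. 1 / cnj x) I" .
  have "R = I + filter_mset (\<lambda>x. \<not> cmod x < 1) R"
    unfolding I_def by (simp add: multiset_partition[symmetric])
  also have "filter_mset (\<lambda>x. \<not> cmod x < 1) R = filter_mset (\<lambda>x. cmod x > 1) R + C"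
    unfolding C_def by (rule multiset_eqI) auto
  finally have R: "R = I + (image_mset (\<lambda>x. 1 / cnj x) I + C)" unfolding O .
  then have sz: "4 = 2 * size I + size C" using size
    by (metis add.assoc mult_2 size_image_mset size_union)
  have I: "x \<in># I \<Longrightarrow> x \<noteq> 0 \<and> cmod x < 1" for x using nz by (auto simp: I_def)
  have C: "x \<in># C \<Longrightarrow> cmod x = 1" for x by (auto simp: C_def)
  have *: "size I = 0 \<and> size C = 4 \<or> size I = 1 \<and> size C = 2 \<or> size I = 2 \<and> size C = 0"
    using sz by presburger
  consider "size I = 0" "size C = 4" | "size I = 1" "size C = 2" | "size I = 2" "size C = 0"
    using * by blast
  then show ?thesis
  proof cases
    case 1
    obtain x C' where C': "C = add_mset x C'" using size_eq_Suc_imp_eq_union[of C 3] 1 by auto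
    obtain y C'' where C'': "C' = add_mset y C''" using size_eq_Suc_imp_eq_union[of C' 2] 1 C' by auto
    obtain u v where "C'' = {#u, v#}" using size_2_mset[of C''] 1 C' C'' by auto
    then have xyuv: "C = {#x, y, u, v#}" using C' C'' by simp
    have RC: "R = {#x, y, u, v#}" using R 1 xyuv by simp
    show ?thesis using C xyuv by (intro that[OF RC]) (auto simp: reciprocal_pair_def)
  next
    case 2
    then obtain x where x: "I = {#x#}" using size_1_singleton_mset by blast
    obtain u v where D: "C = {#u, v#}" using size_2_mset[OF 2(2)] by blast
    have RC: "R = {#x, 1 / cnj x, u, v#}" using R x D by simp
    show ?thesis using C D I x by (intro that[OF RC]) (auto simp: reciprocal_pair_def)
  next
    case 3
    obtain u v where D: "I = {#u, v#}" using size_2_mset[OF 3(1)] by blast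
    have RC: "R = {#u, 1 / cnj u, v, 1 / cnj v#}" using R 3 D by simp
    show ?thesis using D I by (intro that[OF RC]) (auto simp: reciprocal_pair_def)
  qed
qed

text \<open>The coefficients say that \<open>p(z) = z\<^sup>4 p(1/z\<^sup>*)\<^sup>*\<close>, so the multiset of roots is invariant under the reflection.\<close>

lemma reciprocal_quartic_roots:
  assumes p: "p = [:1, - cnj a, complex_of_real c, - a, 1:]"
  obtains \<mu> \<nu> \<mu>' \<nu>' where "proots p = {#\<mu>, \<nu>, \<mu>', \<nu>'#}" "\<mu> * \<nu> * \<mu>' * \<nu>' = 1"
    "reciprocal_pair \<mu> \<nu>" "reciprocal_pair \<mu>' \<nu>'"
proof -
  define R where "R = proots p"
  have deg: "degree p = 4" and lead: "lead_coeff p = 1" using p by simp_all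
  have size: "size R = 4" unfolding R_def size_proots_complex deg ..
  have pR: "p = (\<Prod>x\<in>#R. [:- x, 1:])"
    using complex_poly_decompose_multiset[of p] unfolding lead R_def by simp
  have ppoly: "poly p z = (\<Prod>x\<in>#R. z - x)" for z
    by (subst pR) (simp add: poly_prod_mset image_mset.compositionality o_def)
  have prod: "(\<Prod>x\<in>#R. - x) = 1" using ppoly[of 0] p by simp
  have nz: "0 \<notin># R"
    using prod by (metis image_eqI minus_zero prod_mset_zero_iff set_image_mset zero_neq_one)
  define q where "q = (\<Prod>x\<in>#image_mset (\<lambda>x. 1 / cnj x) R. [:- x, 1:])"
  have qpoly: "poly q z = (\<Prod>x\<in>#R. z - 1 / cnj x)" for z
    unfolding q_def by (simp add: poly_prod_mset image_mset.compositionality o_def)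
  have "poly p z = poly q z" if z: "z \<noteq> 0" for z
  proof -
    have "poly p z = z ^ 4 * cnj (poly p (1 / cnj z))"
      using z unfolding p by (simp add: field_simps power4_eq_xxxx)
    also have "cnj (poly p (1 / cnj z)) = (\<Prod>x\<in>#R. 1 / z - cnj x)"
      unfolding ppoly by (induction R) simp_all
    also have "z ^ 4 * \<dots> = (\<Prod>x\<in>#R. z * (1 / z - cnj x))"
      unfolding prod_mset.distrib by (simp add: size)
    also have "\<dots> = (\<Prod>x\<in>#R. cnj (- x) * (z - 1 / cnj x))"
      using nz z by (intro arg_cong[of _ _ prod_mset] image_mset_cong) (auto simp: field_simps)
    also have "\<dots> = cnj (\<Prod>x\<in>#R. - x) * (\<Prod>x\<in>#R. z - 1 / cnj x)"
    proof -
      have "(\<Prod>x\<in>#R. cnj (- x)) = cnj (\<Prod>x\<in>#R. - x)" by (induction R) simp_all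
      then show ?thesis by (simp only: prod_mset.distrib)
    qed
    finally show ?thesis unfolding prod qpoly by simp
  qed
  then have "poly ([:0, 1:] * p) z = poly ([:0, 1:] * q) z" for z by (cases "z = 0") simp_all
  then have "[:0, 1:] * p = [:0, 1:] * q"
    using poly_eq_poly_eq_iff by blast
  then have pq: "p = q" by (simp only: mult_cancel_left) simp
  have "image_mset (\<lambda>x. 1 / cnj x) R = proots q"
  proof -
    have "proots (\<Prod>x\<in>#B. [:- x, 1:]) = B" for B :: "complex multiset"
    proof (induction B)
      case (add x B)
      have "(\<Prod>x\<in>#B. [:- x, 1:]) \<noteq> 0" by (induction B) (simp_all del: mult_pCons_left)
      then show ?case using add by (simp add: proots_mult del: mult_pCons_left)
    qed simp
    then show ?thesis unfolding q_def by simp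
  qed
  then have inv: "image_mset (\<lambda>x. 1 / cnj x) R = R" using pq R_def by simp
  obtain \<mu> \<nu> \<mu>' \<nu>' where *: "R = {#\<mu>, \<nu>, \<mu>', \<nu>'#}" "reciprocal_pair \<mu> \<nu>" "reciprocal_pair \<mu>' \<nu>'"
    using reciprocal_multiset_pairs[OF size nz inv] by blast
  show ?thesis using prod by (intro that[OF _ _ *(2,3)]) (simp_all add: R_def[symmetric] * mult.assoc)
qed

text \<open>In both kinds of pairs the conjugates of \<open>\<mu>, \<nu>\<close> are their reciprocals in some order; hence
  \<open>(\<mu> + \<nu>)\<^sup>* \<mu> \<nu> = \<mu> + \<nu>\<close>, which makes the quotient \<open>(\<mu> + \<nu>)/\<kappa>\<close> real.\<close>

lemma reciprocal_pair_sum: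
  fixes \<mu> \<nu> \<kappa> :: complex
  assumes pair: "reciprocal_pair \<mu> \<nu>" and k: "\<kappa>^2 = \<mu> * \<nu>"
  obtains \<sigma> :: real where "cmod \<kappa> = 1" "\<mu> + \<nu> = \<sigma> * \<kappa>" "cmod \<mu> = 1 \<Longrightarrow> cmod \<nu> = 1 \<and> \<sigma>^2 \<le> 4"
    "cmod \<mu> \<noteq> 1 \<Longrightarrow> cmod \<nu> \<noteq> 1 \<and> \<sigma>^2 \<ge> 4"
proof -
  have nz: "\<mu> \<noteq> 0" "\<nu> \<noteq> 0" using pair by (auto simp: reciprocal_pair_def)
  have "cmod (\<mu> * \<nu>) = 1" using pair nz by (auto simp: reciprocal_pair_def norm_mult norm_divide)
  then have "(cmod \<kappa>)^2 = 1" unfolding k[symmetric] by (simp add: norm_power)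
  then have kn: "cmod \<kappa> = 1" using power2_eq_imp_eq[of "cmod \<kappa>" 1] by simp
  then have kk: "cnj \<kappa> * \<kappa> = 1"
    by (metis complex_norm_square mult.commute of_real_1 power_one)
  have unit: "cnj z * z = 1" if "cmod z = 1" for z
    by (metis complex_norm_square mult.commute of_real_1 power_one that)
  have cn: "cnj (\<mu> + \<nu>) * (\<mu> * \<nu>) = \<mu> + \<nu>"
  proof (cases "cmod \<mu> = 1")
    case True
    then have 1: "cnj \<mu> * \<mu> = 1" "cnj \<nu> * \<nu> = 1" using pair unit by (auto simp: reciprocal_pair_def)
    have "cnj (\<mu> + \<nu>) * (\<mu> * \<nu>) = (cnj \<mu> * \<mu>) * \<nu> + (cnj \<nu> * \<nu>) * \<mu>" by (simp add: algebra_simps)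
    then show ?thesis unfolding 1 by simp
  next
    case False
    then have \<nu>: "\<nu> = 1 / cnj \<mu>" using pair by (auto simp: reciprocal_pair_def)
    show ?thesis unfolding \<nu> using nz(1) by (simp add: field_simps)
  qed
  define s where "s = (\<mu> + \<nu>) * cnj \<kappa>"
  have "cnj s = cnj (\<mu> + \<nu>) * \<kappa> * (cnj \<kappa> * \<kappa>)" unfolding s_def kk by simp
  also have "\<dots> = cnj (\<mu> + \<nu>) * \<kappa>^2 * cnj \<kappa>" by (simp add: power2_eq_square mult_ac)
  also have "\<dots> = s" unfolding k cn s_def ..
  finally have "s \<in> \<real>" by (simp add: Reals_cnj_iff)
  then obtain \<sigma> where \<sigma>: "s = complex_of_real \<sigma>" by (auto elim: Reals_cases)
  have sum: "\<mu> + \<nu> = \<sigma> * \<kappa>" unfolding \<sigma>[symmetric] s_def using kk by (simp add: mult.assoc)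
  have abs: "\<bar>\<sigma>\<bar> = cmod (\<mu> + \<nu>)" unfolding sum norm_mult kn by simp
  show ?thesis
  proof (rule that[OF kn sum])
    assume 1: "cmod \<mu> = 1"
    then have 2: "cmod \<nu> = 1" using pair by (auto simp: reciprocal_pair_def)
    have "\<bar>\<sigma>\<bar> \<le> 2" unfolding abs using norm_triangle_ineq[of \<mu> \<nu>] 1 2 by simp
    then show "cmod \<nu> = 1 \<and> \<sigma>^2 \<le> 4" using 2 power_mono[of "\<bar>\<sigma>\<bar>" 2 2] by simp
  next
    assume "cmod \<mu> \<noteq> 1"
    then have \<nu>: "\<nu> = 1 / cnj \<mu>" using pair by (auto simp: reciprocal_pair_def)
    define r where "r = cmod \<mu>"
    have r: "r > 0" "r \<noteq> 1" using nz \<open>cmod \<mu> \<noteq> 1\<close> by (auto simp: r_def)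
    have "\<mu> + \<nu> = \<nu> * (\<mu> * cnj \<mu> + 1)"
      unfolding \<nu> using nz(1) by (simp add: field_simps)
    also have "\<mu> * cnj \<mu> = complex_of_real (r^2)"
      unfolding r_def by (rule complex_norm_square[symmetric])
    finally have "\<mu> + \<nu> = \<nu> * complex_of_real (r^2 + 1)" by simp
    then have "cmod (\<mu> + \<nu>) = cmod \<nu> * \<bar>r^2 + 1\<bar>"
      by (simp only: norm_mult norm_of_real)
    also have "cmod \<nu> = 1 / r" by (simp add: \<nu> norm_divide r_def)
    also have "\<bar>r^2 + 1\<bar> = r^2 + 1" by simp
    finally have "\<bar>\<sigma>\<bar> * r = r^2 + 1" using abs r by simp
    moreover have "2 * r \<le> r^2 + 1" using zero_le_power2[of "r - 1"] by (simp add: power2_diff)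
    ultimately have "2 * r \<le> \<bar>\<sigma>\<bar> * r" by simp
    then have "\<bar>\<sigma>\<bar> \<ge> 2" using r by simp
    moreover have "cmod \<nu> \<noteq> 1" unfolding \<nu> using r by (simp add: norm_divide r_def)
    ultimately show "cmod \<nu> \<noteq> 1 \<and> \<sigma>^2 \<ge> 4" using power_mono[of 2 "\<bar>\<sigma>\<bar>" 2] by simp
  qed
qed

section \<open>The counting criterion\<close>

lemma quadratic_res_common_root:
  fixes a :: "'a::field_char_0"
  assumes "a * z^2 + b * z + c = 0" "a' * z^2 + b' * z + c' = 0"
  shows "quadratic_res a b c a' b' c' = 0"
  using assms unfolding quadratic_res_def by algebra

text \<open>The resultant of two real factors equals, up to a factor, that of the factors of the characteristic polynomial
  which they come from. So a nonzero resultant means that the pairs have no common root.\<close>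

lemma quadratic_res_cayley:
  fixes \<sigma> \<tau> x y :: complex
  assumes "x^2 + y^2 = 1"
  shows "quadratic_res (\<sigma> + 2*x) (4*y) (\<sigma> - 2*x) (\<tau> + 2*x) (- 4*y) (\<tau> - 2*x)
    = 16 * quadratic_res 1 (- \<sigma> * (x + \<i> * y)) ((x + \<i> * y)^2) 1 (- \<tau> * (x - \<i> * y)) ((x - \<i> * y)^2)"
  using assms i_squared unfolding quadratic_res_def by algebra

text \<open>Here \<open>\<kappa> = x + i y\<close> belongs to the pair with parameter \<open>\<sigma>\<close>, and the conjugate of \<open>\<kappa>\<close> to the pair with parameter \<open>\<tau>\<close>.
  If both discriminants are nonpositive, \<open>P\<^sub>4 \<le> 0\<close> forces the square \<open>n\<close> in the formula for \<open>D\<^sub>4\<close> to be so large that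
  \<open>D\<^sub>4 \<ge> 0\<close>.\<close>

lemma criterion_of_factors:
  fixes \<sigma> \<tau> x y :: real
  assumes xy: "x^2 + y^2 = 1"
    and f: "f1 M = (\<sigma> + \<tau>) * x" "f2 M = (\<sigma> - \<tau>) * y" "f3 M = 4 * x^2 - 2 + \<sigma> * \<tau>"
  defines "R \<equiv> quadratic_res (\<sigma> + 2*x) (4*y) (\<sigma> - 2*x) (\<tau> + 2*x) (- 4*y) (\<tau> - 2*x)"
  shows "256 * Delta4 M = (4 - \<sigma>^2) * (4 - \<tau>^2) * R^2"
    and "\<lbrakk>\<sigma>^2 \<le> 4; \<tau>^2 \<le> 4\<rbrakk> \<Longrightarrow> P4 M \<le> 0 \<and> D4 M \<le> 0"
    and "\<lbrakk>\<sigma>^2 \<ge> 4; \<tau>^2 \<ge> 4; P4 M \<le> 0\<rbrakk> \<Longrightarrow> D4 M \<ge> 0"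
proof -
  let ?a = "\<sigma> + 2*x" and ?b = "4*y" and ?c = "\<sigma> - 2*x" and ?a' = "\<tau> + 2*x" and ?b' = "- 4*y" and ?c' = "\<tau> - 2*x"
  have A: "2 + 2 * f1 M + f3 M = ?a * ?a'" unfolding f by algebra
  have B: "- 4 * f2 M = ?a * ?b' + ?a' * ?b" unfolding f by algebra
  have B': "- 4 * f2 M = ?b * ?c' + ?b' * ?c" unfolding f by algebra
  have C: "2 * f3 M - 12 = ?a * ?c' + ?a' * ?c + ?b * ?b'" unfolding f using xy by algebra
  have E: "2 - 2 * f1 M + f3 M = ?c * ?c'" unfolding f by algebra
  have d: "quadratic_disc ?a ?b ?c = 4 * (4 - \<sigma>^2)" "quadratic_disc ?a' ?b' ?c' = 4 * (4 - \<tau>^2)"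
    unfolding quadratic_disc_def using xy by algebra+
  define u where "u = ?a'^2 * quadratic_disc ?a ?b ?c"
  define v where "v = ?a^2 * quadratic_disc ?a' ?b' ?c'"
  define n where "n = (?a * ?b' - ?a' * ?b)^2"
  have "4096 * Delta4 M = quadratic_disc ?a ?b ?c * quadratic_disc ?a' ?b' ?c' * R^2"
    unfolding Delta4_cayley[symmetric] R_def quartic_disc_prod[symmetric] A C E B[symmetric] B'[symmetric] ..
  then show "256 * Delta4 M = (4 - \<sigma>^2) * (4 - \<tau>^2) * R^2" unfolding d by algebra
  have P: "P4 M = - 2 * (v + u) - n"
    unfolding P4_cayley[symmetric] A B C quartic_P_prod u_def v_def n_def ..
  have "D4 M = quartic_D (?a * ?a') (?a * ?b' + ?a' * ?b) (?a * ?c' + ?a' * ?c + ?b * ?b') (?b * ?c' + ?b' * ?c) (?c * ?c')"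
    unfolding D4_cayley[symmetric] A C E B[symmetric] B'[symmetric] ..
  then have "D4 M = - 2 * n * (v + u) - (v - u)^2"
    unfolding quartic_D_prod u_def v_def n_def .
  then have D: "D4 M = - 2 * (n * (v + u)) - (v - u)^2" by (simp only: mult.assoc)
  have n: "n \<ge> 0" unfolding n_def by (rule zero_le_power2)
  show "P4 M \<le> 0 \<and> D4 M \<le> 0" if "\<sigma>^2 \<le> 4" "\<tau>^2 \<le> 4"
  proof -
    have uv: "u \<ge> 0" "v \<ge> 0" using that unfolding u_def v_def d
      by (intro mult_nonneg_nonneg zero_le_power2; simp)+
    then have "n * (v + u) \<ge> 0" using n by simp
    moreover have "(v - u)^2 \<ge> 0" by simp
    ultimately have "D4 M \<le> 0" unfolding D by linarith
    moreover have "P4 M \<le> 0" unfolding P using n uv by simp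
    ultimately show ?thesis by blast
  qed
  show "D4 M \<ge> 0" if "\<sigma>^2 \<ge> 4" "\<tau>^2 \<ge> 4" "P4 M \<le> 0"
  proof -
    define u' v' where "u' = - u" and "v' = - v"
    have uv: "u' \<ge> 0" "v' \<ge> 0" using that unfolding u'_def v'_def u_def v_def d neg_0_le_iff_le
      by (intro mult_nonneg_nonpos zero_le_power2; simp)+
    have "n \<ge> 2 * (u' + v')" using that(3) unfolding P u'_def v'_def by simp
    then have "n * (u' + v') \<ge> 2 * (u' + v') * (u' + v')" using uv by (intro mult_right_mono) auto
    moreover have "D4 M = 2 * (n * (u' + v')) - (v' - u')^2" unfolding D u'_def v'_def by algebra
    moreover have "4 * ((u' + v') * (u' + v')) - (v' - u')^2 = 3 * u'^2 + 3 * v'^2 + 10 * (u' * v')" by algebra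
    moreover have "3 * u'^2 + 3 * v'^2 + 10 * (u' * v') \<ge> 0" using uv by simp
    ultimately show ?thesis by linarith
  qed
qed

lemma circle_count_eq: "circle_count M = size (filter_mset (\<lambda>z. cmod z = 1) (proots (charpoly M)))"
proof -
  have nz: "charpoly M \<noteq> 0" unfolding charpoly_eq by simp
  have "circle_eigenvalues M = set_mset (filter_mset (\<lambda>z. cmod z = 1) (proots (charpoly M)))"
    unfolding circle_eigenvalues_def eigenvalue_iff_root using nz by auto
  then show ?thesis
    unfolding circle_count_def alg_mult_def size_multiset_overloaded_eq using nz
    by (intro sum.cong) (auto simp: circle_eigenvalues_def)
qed

text \<open>The assumptions say that the characteristic polynomial is self-reciprocal. The inequalities are weak: they exclude the wrong
  counts as soon as \<open>\<Delta>\<^sub>4\<close>, \<open>P\<^sub>4\<close> and \<open>D\<^sub>4\<close> are nonzero.\<close>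

lemma circle_count_criterion:
  assumes det: "det M = 1" and minor: "minor_sum3 M = cnj (trace M)" and real: "f3_complex M \<in> \<real>"
  shows "circle_count M \<in> {0, 2, 4}"
    and "Delta4 M \<noteq> 0 \<Longrightarrow> card {\<mu>. eigenvalue_of M \<mu>} = 4 \<and> (\<forall>\<mu>. eigenvalue_of M \<mu> \<longrightarrow> alg_mult M \<mu> = 1)"
    and "circle_count M = 0 \<Longrightarrow> P4 M \<le> 0 \<Longrightarrow> D4 M \<ge> 0"
    and "circle_count M = 0 \<Longrightarrow> Delta4 M \<ge> 0"
    and "circle_count M = 2 \<Longrightarrow> Delta4 M \<le> 0"
    and "circle_count M = 4 \<Longrightarrow> P4 M \<le> 0 \<and> D4 M \<le> 0 \<and> Delta4 M \<ge> 0"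
proof -
  have f3: "f3_complex M = complex_of_real (f3 M)" using real by (simp add: f3_def)
  have chp: "charpoly M = [:1, - cnj (trace M), complex_of_real (f3 M), - trace M, 1:]"
    unfolding charpoly_eq det minor f3 ..
  obtain \<mu> \<nu> \<mu>' \<nu>' where roots: "proots (charpoly M) = {#\<mu>, \<nu>, \<mu>', \<nu>'#}"
    and prod1: "\<mu> * \<nu> * \<mu>' * \<nu>' = 1" and pairs: "reciprocal_pair \<mu> \<nu>" "reciprocal_pair \<mu>' \<nu>'"
    using reciprocal_quartic_roots[OF chp] by blast
  have "charpoly M = [:- \<mu>, 1:] * [:- \<nu>, 1:] * [:- \<mu>', 1:] * [:- \<nu>', 1:]"
  proof -
    have "lead_coeff (charpoly M) = 1" unfolding chp by simp
    then have "charpoly M = (\<Prod>x\<in>#{#\<mu>, \<nu>, \<mu>', \<nu>'#}. [:- x, 1:])"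
      using complex_poly_decompose_multiset[of "charpoly M"] roots by simp
    then show ?thesis by (simp only: image_mset_add_mset prod_mset.add_mset image_mset_empty prod_mset_empty mult.assoc mult_1_right)
  qed
  then have e1: "trace M = \<mu> + \<nu> + (\<mu>' + \<nu>')"
    and e2: "complex_of_real (f3 M) = \<mu> * \<nu> + \<mu>' * \<nu>' + (\<mu> + \<nu>) * (\<mu>' + \<nu>')"
    unfolding chp by (simp_all add: algebra_simps add_eq_0_iff)
  define \<kappa> where "\<kappa> = csqrt (\<mu> * \<nu>)"
  have k2: "\<kappa>^2 = \<mu> * \<nu>" by (simp add: \<kappa>_def)
  obtain \<sigma> where kn: "cmod \<kappa> = 1" and s: "\<mu> + \<nu> = complex_of_real \<sigma> * \<kappa>"
    and c1: "cmod \<mu> = 1 \<Longrightarrow> cmod \<nu> = 1 \<and> \<sigma>^2 \<le> 4" "cmod \<mu> \<noteq> 1 \<Longrightarrow> cmod \<nu> \<noteq> 1 \<and> \<sigma>^2 \<ge> 4"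
    using reciprocal_pair_sum[OF pairs(1) k2] by metis
  have kk: "\<kappa> * cnj \<kappa> = 1" by (metis complex_norm_square kn of_real_1 power_one)
  \<comment> \<open>The product of all roots is \<open>1\<close>, so the conjugate of \<open>\<kappa>\<close> can serve as square root for the second pair.\<close>
  have k2': "(cnj \<kappa>)^2 = \<mu>' * \<nu>'"
  proof -
    have "(\<mu> * \<nu>) * (cnj \<kappa>)^2 = (\<kappa> * cnj \<kappa>)^2"
      unfolding k2[symmetric] power_mult_distrib ..
    also have "\<dots> = (\<mu> * \<nu>) * (\<mu>' * \<nu>')"
      unfolding kk using prod1 by (simp add: mult.assoc)
    finally have "(\<mu> * \<nu>) * (cnj \<kappa>)^2 = (\<mu> * \<nu>) * (\<mu>' * \<nu>')" .
    moreover have "\<mu> * \<nu> \<noteq> 0" using prod1 by auto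
    ultimately show ?thesis by (metis mult_left_cancel)
  qed
  obtain \<tau> where t: "\<mu>' + \<nu>' = complex_of_real \<tau> * cnj \<kappa>"
    and c2: "cmod \<mu>' = 1 \<Longrightarrow> cmod \<nu>' = 1 \<and> \<tau>^2 \<le> 4" "cmod \<mu>' \<noteq> 1 \<Longrightarrow> cmod \<nu>' \<noteq> 1 \<and> \<tau>^2 \<ge> 4"
    using reciprocal_pair_sum[OF pairs(2) k2'] by metis
  define x y where "x = Re \<kappa>" and "y = Im \<kappa>"
  have xy: "x^2 + y^2 = 1" using kn by (simp add: x_def y_def cmod_def)
  have kxy: "\<kappa> = complex_of_real x + \<i> * complex_of_real y" "cnj \<kappa> = complex_of_real x - \<i> * complex_of_real y"
    by (simp_all add: x_def y_def complex_eq_iff)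
  have F1: "f1 M = (\<sigma> + \<tau>) * x" and F2: "f2 M = (\<sigma> - \<tau>) * y"
    unfolding f1_def f2_def e1 s t by (simp_all add: x_def y_def algebra_simps)
  have "complex_of_real (f3 M) = \<kappa>^2 + (cnj \<kappa>)^2 + \<sigma> * \<tau> * (\<kappa> * cnj \<kappa>)"
    unfolding e2 k2[symmetric] k2'[symmetric] s t by (simp add: algebra_simps)
  also have "\<dots> = complex_of_real (4 * x^2 - 2 + \<sigma> * \<tau>)"
  proof -
    have "\<kappa>^2 + (cnj \<kappa>)^2 = complex_of_real (2 * x^2 - 2 * y^2)"
      unfolding kxy by (simp add: power2_eq_square algebra_simps)
    also have "2 * x^2 - 2 * y^2 = 4 * x^2 - 2" using xy by simp
    finally show ?thesis unfolding kk by simp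
  qed
  finally have F3: "f3 M = 4 * x^2 - 2 + \<sigma> * \<tau>" unfolding of_real_eq_iff .
  note crit = criterion_of_factors[OF xy F1 F2 F3]
  have count: "circle_count M = (if cmod \<mu> = 1 then 2 else 0) + (if cmod \<mu>' = 1 then 2 else 0)"
    unfolding circle_count_eq roots using c1 c2 by auto
  show "circle_count M \<in> {0, 2, 4}" unfolding count by auto
  show "circle_count M = 0 \<Longrightarrow> P4 M \<le> 0 \<Longrightarrow> D4 M \<ge> 0"
    using count c1 c2 crit(3) by (auto split: if_splits)
  define R where "R = quadratic_res (\<sigma> + 2*x) (4*y) (\<sigma> - 2*x) (\<tau> + 2*x) (- 4*y) (\<tau> - 2*x)"
  define K where "K = (4 - \<sigma>^2) * (4 - \<tau>^2)"
  have Delta: "256 * Delta4 M = K * R^2"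
    unfolding R_def K_def by (rule crit(1))
  have pos: "Delta4 M \<ge> 0" if "K \<ge> 0"
    using mult_nonneg_nonneg[OF that zero_le_power2[of R]] Delta by linarith
  have neg: "Delta4 M \<le> 0" if "K \<le> 0"
    using mult_nonpos_nonneg[OF that zero_le_power2[of R]] Delta by linarith
  have "0 \<le> K" if "circle_count M = 0"
    using that count c1 c2 unfolding K_def by (auto split: if_splits intro: mult_nonpos_nonpos)
  then show "circle_count M = 0 \<Longrightarrow> Delta4 M \<ge> 0" using pos by blast
  have "0 \<ge> K" if "circle_count M = 2"
    using that count c1 c2 unfolding K_def by (auto split: if_splits intro: mult_nonpos_nonneg mult_nonneg_nonpos)
  then show "circle_count M = 2 \<Longrightarrow> Delta4 M \<le> 0" using neg by blast
  have 4: "\<sigma>^2 \<le> 4 \<and> \<tau>^2 \<le> 4" if "circle_count M = 4"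
    using that count c1 c2 by (auto split: if_splits)
  then have "0 \<le> K" if "circle_count M = 4" using that unfolding K_def by simp
  then show "circle_count M = 4 \<Longrightarrow> P4 M \<le> 0 \<and> D4 M \<le> 0 \<and> Delta4 M \<ge> 0"
    using crit(2) 4 pos by blast
  assume nonzero: "Delta4 M \<noteq> 0"
  then have nz: "\<sigma>^2 \<noteq> 4" "\<tau>^2 \<noteq> 4" "R \<noteq> 0" using Delta unfolding K_def by auto
  have k0: "\<kappa> \<noteq> 0" using kn by auto
  have double_root: "r^2 = 4" if "u + v = complex_of_real r * k" "k^2 = u * v" "u = v" "k \<noteq> 0" for r u v k
  proof -
    have "complex_of_real (r^2) * k^2 = (u + v)^2" unfolding that(1) by (simp add: power_mult_distrib)
    also have "\<dots> = complex_of_real 4 * k^2" unfolding that(2,3) by (simp add: power2_eq_square)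
    finally have "complex_of_real (r^2) = complex_of_real 4" using that(4) by simp
    then show ?thesis unfolding of_real_eq_iff .
  qed
  have dist: "\<mu> \<noteq> \<nu>" "\<mu>' \<noteq> \<nu>'"
    using double_root[OF s k2] double_root[OF t k2'] nz k0 by auto
  have cross: "z \<noteq> z'" if "z \<in> {\<mu>, \<nu>}" "z' \<in> {\<mu>', \<nu>'}" for z z'
  proof
    assume [symmetric, simp]: "z = z'"
    have "z^2 - (\<mu> + \<nu>) * z + \<mu> * \<nu> = 0"
      using that(1) by (auto simp: power2_eq_square algebra_simps)
    then have "1 * z^2 + (- complex_of_real \<sigma> * \<kappa>) * z + \<kappa>^2 = 0"
      unfolding s k2[symmetric] by simp
    moreover have "z^2 - (\<mu>' + \<nu>') * z + \<mu>' * \<nu>' = 0"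
      using that(2) by (auto simp: power2_eq_square algebra_simps)
    then have "1 * z^2 + (- complex_of_real \<tau> * cnj \<kappa>) * z + (cnj \<kappa>)^2 = 0"
      unfolding t k2'[symmetric] by simp
    ultimately have "quadratic_res 1 (- complex_of_real \<sigma> * \<kappa>) (\<kappa>^2) 1 (- complex_of_real \<tau> * cnj \<kappa>) ((cnj \<kappa>)^2) = 0"
      by (rule quadratic_res_common_root)
    then have res0: "quadratic_res 1 (- complex_of_real \<sigma> * (complex_of_real x + \<i> * complex_of_real y))
        ((complex_of_real x + \<i> * complex_of_real y)^2) 1
        (- complex_of_real \<tau> * (complex_of_real x - \<i> * complex_of_real y))
        ((complex_of_real x - \<i> * complex_of_real y)^2) = 0"
      unfolding kxy(2) unfolding kxy(1) .
    have cxy: "(complex_of_real x)^2 + (complex_of_real y)^2 = 1"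
      by (metis of_real_1 of_real_add of_real_power xy)
    have "complex_of_real R = quadratic_res (\<sigma> + 2 * complex_of_real x) (4 * complex_of_real y)
        (\<sigma> - 2 * complex_of_real x) (\<tau> + 2 * complex_of_real x) (- 4 * complex_of_real y) (\<tau> - 2 * complex_of_real x)"
      unfolding R_def quadratic_res_def by simp
    also have "\<dots> = 0" unfolding quadratic_res_cayley[OF cxy] res0 by simp
    finally have "complex_of_real R = 0" .
    then show False using nz(3) by simp
  qed
  have ne: "\<mu> \<noteq> \<mu>'" "\<mu> \<noteq> \<nu>'" "\<nu> \<noteq> \<mu>'" "\<nu> \<noteq> \<nu>'" using cross by blast+
  have nzp: "charpoly M \<noteq> 0" unfolding chp by simp
  have "{z. eigenvalue_of M z} = {\<mu>, \<nu>, \<mu>', \<nu>'}"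
    unfolding eigenvalue_iff_root set_count_proots[OF nzp, symmetric] roots by simp
  moreover have "card {\<mu>, \<nu>, \<mu>', \<nu>'} = 4" using dist ne by simp
  moreover have "alg_mult M z = 1" if "z \<in> {\<mu>, \<nu>, \<mu>', \<nu>'}" for z
    unfolding alg_mult_def count_proots[OF nzp, symmetric] roots using that dist ne by auto
  ultimately show "card {\<mu>. eigenvalue_of M \<mu>} = 4 \<and> (\<forall>\<mu>. eigenvalue_of M \<mu> \<longrightarrow> alg_mult M \<mu> = 1)"
    by auto
qed

section \<open>Linear differential equations with matrix coefficients\<close>

lemma has_vector_derivative_nth:
  "(f has_vector_derivative f') F \<Longrightarrow> ((\<lambda>x. f x $ i) has_vector_derivative f' $ i) F"
  by (rule bounded_linear.has_vector_derivative[OF bounded_linear_vec_nth])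

lemma has_vector_derivative_vec:
  fixes f :: "real \<Rightarrow> 'a::real_normed_vector^'n"
  assumes "\<And>i. ((\<lambda>x. f x $ i) has_vector_derivative f' $ i) (at x)"
  shows "(f has_vector_derivative f') (at x)"
  unfolding has_vector_derivative_def has_derivative_def
proof (intro conjI)
  show "bounded_linear (\<lambda>h. h *\<^sub>R f')" by (rule bounded_linear_scaleR_left)
  show "((\<lambda>y. (f y - f (Lim (at x) (\<lambda>x. x)) - (y - Lim (at x) (\<lambda>x. x)) *\<^sub>R f') /\<^sub>R norm (y - Lim (at x) (\<lambda>x. x))) \<longlongrightarrow> 0) (at x)"
    using assms unfolding has_vector_derivative_def has_derivative_def by (intro vec_tendstoI) simp
qed

lemma bounded_bilinear_matrix_mult:
  "bounded_bilinear ((**) :: complex^'n^'m \<Rightarrow> complex^'p^'n \<Rightarrow> complex^'p^'m)"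
  by (rule iffD1[OF bilinear_conv_bounded_bilinear])
     (auto simp: bilinear_def vec_eq_iff matrix_matrix_mult_def sum.distrib scaleR_right.sum algebra_simps intro!: linearI)

lemma bounded_bilinear_matrix_vector_mult:
  "bounded_bilinear ((*v) :: complex^'n^'m \<Rightarrow> complex^'n \<Rightarrow> complex^'m)"
  by (rule iffD1[OF bilinear_conv_bounded_bilinear])
     (auto simp: bilinear_def vec_eq_iff matrix_vector_mult_def sum.distrib scaleR_right.sum algebra_simps intro!: linearI)

lemmas has_vector_derivative_matrix_mult = bounded_bilinear.has_vector_derivative[OF bounded_bilinear_matrix_mult]
lemmas continuous_on_matrix_vector_mult = bounded_bilinear.continuous_on[OF bounded_bilinear_matrix_vector_mult]

text \<open>The determinant is multilinear in the rows, so its derivative is a sum over the rows.\<close>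

lemma has_vector_derivative_det:
  fixes V :: "real \<Rightarrow> complex^'n^'n"
  assumes V: "(V has_vector_derivative V') (at x)"
  shows "((\<lambda>y. det (V y)) has_vector_derivative (\<Sum>i\<in>UNIV. det (\<chi> r. if r = i then V' $ i else V x $ r))) (at x)"
proof -
  have c: "((\<lambda>y. V y $ i $ j) has_derivative (\<lambda>h. h *\<^sub>R V' $ i $ j)) (at x)" for i j
    using has_vector_derivative_nth[OF has_vector_derivative_nth[OF V]] by (simp add: has_vector_derivative_def)
  have "((\<lambda>y. det (V y)) has_derivative
      (\<lambda>h. \<Sum>p | p permutes UNIV. of_int (sign p) * (\<Sum>i\<in>UNIV. (h *\<^sub>R V' $ i $ p i) * (\<Prod>j\<in>UNIV - {i}. V x $ j $ p j)))) (at x)"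
    unfolding det_def by (intro has_derivative_sum has_derivative_mult_right has_derivative_prod c)
  also have "(\<lambda>h. \<Sum>p | p permutes (UNIV::'n set). of_int (sign p) * (\<Sum>i\<in>UNIV. (h *\<^sub>R V' $ i $ p i) * (\<Prod>j\<in>UNIV - {i}. V x $ j $ p j)))
    = (\<lambda>h. h *\<^sub>R (\<Sum>i\<in>UNIV. det (\<chi> r. if r = i then V' $ i else V x $ r)))"
  proof (rule ext)
    fix h
    have d: "det (\<chi> r. if r = i then V' $ i else V x $ r)
        = (\<Sum>p | p permutes UNIV. of_int (sign p) * (V' $ i $ p i * (\<Prod>j\<in>UNIV - {i}. V x $ j $ p j)))" for i
      unfolding det_def by (intro sum.cong refl arg_cong2[of _ _ _ _ "(*)"]) (simp add: prod.remove[of UNIV i])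
    show "(\<Sum>p | p permutes (UNIV::'n set). of_int (sign p) * (\<Sum>i\<in>UNIV. (h *\<^sub>R V' $ i $ p i) * (\<Prod>j\<in>UNIV - {i}. V x $ j $ p j)))
       = h *\<^sub>R (\<Sum>i\<in>UNIV. det (\<chi> r. if r = i then V' $ i else V x $ r))"
      unfolding d by (subst sum.swap) (simp add: scaleR_right.sum sum_distrib_left)
  qed
  finally show ?thesis by (simp add: has_vector_derivative_def)
qed

text \<open>Row \<open>i\<close> of \<open>A V\<close> is a combination of the rows of \<open>V\<close>, of which only the \<open>i\<close>-th contributes to the determinant; so
  \<open>(det V)' = tr A det V = 0\<close>.\<close>

lemma liouville:
  fixes V :: "real \<Rightarrow> complex^'n^'n"
  assumes V: "\<And>x. (V has_vector_derivative A x ** V x) (at x)" and tr: "\<And>x. trace (A x) = 0"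
  shows "det (V x) = det (V 0)"
proof -
  have "((\<lambda>y. det (V y)) has_vector_derivative 0) (at x)" for x
  proof -
    have "det (\<chi> r. if r = i then (A x ** V x) $ i else V x $ r) = A x $ i $ i * det (V x)" for i
    proof -
      have "det (\<chi> r. if r = i then (A x ** V x) $ i else V x $ r)
        = det (\<chi> r. if r = i then (\<Sum>k\<in>UNIV. A x $ i $ k *s V x $ k) else V x $ r)"
        by (rule arg_cong[of _ _ det]) (auto simp: vec_eq_iff matrix_matrix_mult_def)
      also have "\<dots> = (\<Sum>k\<in>UNIV. A x $ i $ k * det (\<chi> r. if r = i then V x $ k else V x $ r))"
        by (simp add: det_linear_row_sum det_row_mul)
      also have "\<dots> = (\<Sum>k\<in>UNIV. if k = i then A x $ i $ i * det (V x) else 0)"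
      proof (rule sum.cong[OF refl])
        fix k
        have "(\<chi> r. if r = i then V x $ i else V x $ r) = V x" by (simp add: vec_eq_iff)
        moreover have "det (\<chi> r. if r = i then V x $ k else V x $ r) = 0" if "k \<noteq> i"
          by (rule det_identical_rows[OF that]) (use that in \<open>simp add: row_def vec_eq_iff\<close>)
        ultimately show "A x $ i $ k * det (\<chi> r. if r = i then V x $ k else V x $ r) = (if k = i then A x $ i $ i * det (V x) else 0)"
          by auto
      qed
      finally show ?thesis by simp
    qed
    then have "(\<Sum>i\<in>UNIV. det (\<chi> r. if r = i then (A x ** V x) $ i else V x $ r)) = trace (A x) * det (V x)"
      by (simp add: trace_def sum_distrib_right)
    then show ?thesis using has_vector_derivative_det[OF V[of x]] tr by simp
  qed
  then obtain c where "\<And>y. det (V y) = c"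
    using has_vector_derivative_zero_constant[of UNIV "\<lambda>y. det (V y)"] by auto
  then show ?thesis by simp
qed

text \<open>Cramer's rule expresses the entries of the inverse as determinants, hence as differentiable functions; differentiating
  \<open>W V = 1\<close> then identifies the derivative.\<close>

lemma inverse_fundamental_matrix:
  fixes V :: "real \<Rightarrow> complex^'n^'n"
  assumes V: "\<And>x. (V has_vector_derivative A x ** V x) (at x)" and det: "\<And>x. det (V x) = 1"
  obtains W where "\<And>x. V x ** W x = mat 1" "\<And>x. W x ** V x = mat 1"
    "\<And>x. (W has_vector_derivative - (W x ** A x)) (at x)"
proof -
  define W where "W x = (\<chi> k m. det (\<chi> i j. if j = k then (if i = m then 1 else 0) else V x $ i $ j))" for x
  have VW: "V x ** W x = mat 1" for x
  proof -
    have "V x *v (column m (W x)) = axis m 1" for m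
    proof -
      have "axis m (1::complex) $ i = (if i = m then 1 else 0)" for i :: 'n by (simp add: axis_def)
      with cramer[of "V x" "column m (W x)" "axis m 1"] det[of x] show ?thesis
        unfolding W_def column_def by (simp cong del: if_weak_cong)
    qed
    then show ?thesis
      by (simp add: vec_eq_iff matrix_matrix_mult_def matrix_vector_mult_def column_def mat_def axis_def)
  qed
  then have WV: "W x ** V x = mat 1" for x using matrix_left_right_inverse by blast
  have "\<exists>D. (W has_vector_derivative D) (at x)" for x
  proof -
    have "\<exists>d. ((\<lambda>x. W x $ k $ m) has_vector_derivative d) (at x)" for k m
    proof -
      let ?U = "\<lambda>x. (\<chi> i j. if j = k then (if i = m then 1 else 0) else V x $ i $ j) :: complex^'n^'n"
      have "((\<lambda>x. ?U x $ i $ j) has_vector_derivative ((\<chi> i j. if j = k then 0 else (A x ** V x) $ i $ j) :: complex^'n^'n) $ i $ j) (at x)" for i j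
        using has_vector_derivative_nth[OF has_vector_derivative_nth[OF V[of x]]] by (cases "j = k") auto
      then have "(?U has_vector_derivative (\<chi> i j. if j = k then 0 else (A x ** V x) $ i $ j)) (at x)"
        by (intro has_vector_derivative_vec)
      from has_vector_derivative_det[OF this] show ?thesis by (auto simp: W_def)
    qed
    then obtain d where "\<And>k m. ((\<lambda>x. W x $ k $ m) has_vector_derivative d k m) (at x)" by metis
    then have "(W has_vector_derivative (\<chi> k m. d k m)) (at x)"
      by (intro has_vector_derivative_vec) simp
    then show ?thesis ..
  qed
  moreover have "D = - (W x ** A x)" if D: "(W has_vector_derivative D) (at x)" for D x
  proof -
    have "((\<lambda>x. W x ** V x) has_vector_derivative (W x ** (A x ** V x) + D ** V x)) (at x)"
      by (rule has_vector_derivative_matrix_mult[OF D V])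
    moreover have "((\<lambda>x. W x ** V x) has_vector_derivative 0) (at x)" unfolding WV by simp
    ultimately have "W x ** (A x ** V x) + D ** V x = 0" using vector_derivative_unique_at by blast
    then have "(W x ** (A x ** V x) + D ** V x) ** W x = 0" by (simp add: vec_eq_iff matrix_matrix_mult_def)
    then have "W x ** A x ** (V x ** W x) + D ** (V x ** W x) = 0"
      by (simp add: bounded_bilinear.add_left[OF bounded_bilinear_matrix_mult] matrix_mul_assoc)
    then show ?thesis unfolding VW matrix_mul_rid eq_neg_iff_add_eq_0 by (subst add.commute)
  qed
  ultimately have "(W has_vector_derivative - (W x ** A x)) (at x)" for x by metis
  then show ?thesis using VW WV that by blast
qed

text \<open>\<open>W U\<close> has derivative zero for the inverse \<open>W\<close> of the fundamental matrix.\<close>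

lemma linear_ode_unique:
  fixes V :: "real \<Rightarrow> complex^'n^'n" and U :: "real \<Rightarrow> complex^'m^'n"
  assumes V: "\<And>x. (V has_vector_derivative A x ** V x) (at x)" and det: "\<And>x. det (V x) = 1" and V0: "V 0 = mat 1"
    and U: "\<And>x. (U has_vector_derivative A x ** U x) (at x)"
  shows "U x = V x ** U 0"
proof -
  obtain W where W: "\<And>x. V x ** W x = mat 1" "\<And>x. W x ** V x = mat 1"
    "\<And>x. (W has_vector_derivative - (W x ** A x)) (at x)"
    using inverse_fundamental_matrix[OF V det] by blast
  have neg: "- P ** Q = - (P ** Q)" for P :: "complex^'n^'n" and Q :: "complex^'m^'n"
    by (simp add: vec_eq_iff matrix_matrix_mult_def sum_negf)
  have "((\<lambda>x. W x ** U x) has_vector_derivative 0) (at x)" for x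
    using has_vector_derivative_matrix_mult[OF W(3) U, of x] by (simp add: neg matrix_mul_assoc)
  then obtain c where c: "\<And>y. W y ** U y = c"
    using has_vector_derivative_zero_constant[of UNIV "\<lambda>y. W y ** U y"] by auto
  have "W 0 = mat 1" using W(1)[of 0] unfolding V0 by simp
  then have "W x ** U x = U 0" using c[of 0] c[of x] by simp
  then show ?thesis using W(1)[of x] by (metis matrix_mul_assoc matrix_mul_lid)
qed

section \<open>Symmetries of the monodromy matrix\<close>

definition cnj_matrix :: "complex^'n^'m \<Rightarrow> complex^'n^'m" where
  "cnj_matrix M = (\<chi> i j. cnj (M $ i $ j))"

lemma cnj_matrix_mult: "cnj_matrix (M ** N) = cnj_matrix M ** cnj_matrix N"
  by (simp add: cnj_matrix_def vec_eq_iff matrix_matrix_mult_def cnj_sum)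

lemma f3_complex_cnj: "f3_complex (cnj_matrix M) = cnj (f3_complex M)"
  by (simp add: f3_complex_eq_minors cnj_matrix_def)

lemma trace_cnj: "trace (cnj_matrix M) = cnj (trace M)"
  by (simp add: trace_def cnj_matrix_def cnj_sum)

text \<open>Both \<open>f(\<lambda>)\<close> and \<open>f(\<lambda>\<^sup>*)\<^sup>*\<close> are entire and they agree on the real axis.\<close>

lemma reflected_coefficient:
  assumes reg: "regular_coefficient A" and real: "A1_real A"
  shows "A x (cnj l) = cnj_matrix (A x l)"
proof -
  have "A x (cnj l) $ i $ j = cnj (A x l $ i $ j)" for i j
  proof -
    define f where "f = (\<lambda>l. A x l $ i $ j)"
    have f: "f holomorphic_on UNIV" using reg by (auto simp: regular_coefficient_def f_def)
    have fc: "(cnj \<circ> f \<circ> cnj) holomorphic_on UNIV"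
      using holomorphic_on_compose_cnj_cnj[of f UNIV] f by (simp add: holomorphic_on_subset)
    have "f (cnj l) - (cnj \<circ> f \<circ> cnj) (cnj l) = 0"
    proof (rule analytic_continuation[of "\<lambda>z. f z - (cnj \<circ> f \<circ> cnj) z" UNIV "\<real>" 0])
      show "(\<lambda>z. f z - (cnj \<circ> f \<circ> cnj) z) holomorphic_on UNIV" using f fc by (rule holomorphic_on_diff)
      show "(0::complex) islimpt \<real>"
      proof (rule islimpt_subset)
        show "(complex_of_real ` UNIV) \<subseteq> \<real>" by auto
        have "(\<lambda>n. complex_of_real (1 / real (Suc n))) \<longlonglongrightarrow> complex_of_real 0"
          by (intro tendsto_of_real LIMSEQ_Suc lim_1_over_n)
        then show "(0::complex) islimpt (range complex_of_real)"
          unfolding islimpt_sequential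
        proof (intro exI[of _ "\<lambda>n. complex_of_real (1 / real (Suc n))"] conjI allI DiffI rangeI)
          show "complex_of_real (1 / real (Suc n)) \<notin> {0}" for n
            unfolding singleton_iff of_real_eq_0_iff by simp
        qed simp
      qed
      show "f z - (cnj \<circ> f \<circ> cnj) z = 0" if zr: "z \<in> \<real>" for z
      proof -
        obtain r where z: "z = complex_of_real r" using zr unfolding Reals_def by blast
        then have "f z \<in> \<real>" using real unfolding A1_real_def f_def by blast
        then show ?thesis unfolding z by (simp add: Reals_cnj_iff)
      qed
    qed auto
    then show ?thesis by (simp add: f_def)
  qed
  then show ?thesis by (simp add: vec_eq_iff cnj_matrix_def)
qed

lemma has_vector_derivative_cnj_matrix:
  assumes "(V has_vector_derivative V') (at x)"
  shows "((\<lambda>y. cnj_matrix (V y)) has_vector_derivative cnj_matrix V') (at x)"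
proof (intro has_vector_derivative_vec)
  fix i j
  have "((\<lambda>y. cnj (V y $ i $ j)) has_vector_derivative cnj (V' $ i $ j)) (at x)"
    by (intro bounded_linear.has_vector_derivative[OF bounded_linear_cnj] has_vector_derivative_nth assms)
  then show "((\<lambda>x. cnj_matrix (V x) $ i $ j) has_vector_derivative cnj_matrix V' $ i $ j) (at x)"
    by (simp add: cnj_matrix_def)
qed

lemma has_vector_derivative_transpose:
  fixes V :: "real \<Rightarrow> complex^'n^'m"
  assumes "(V has_vector_derivative V') (at x)"
  shows "((\<lambda>y. transpose (V y)) has_vector_derivative transpose V') (at x)"
  using has_vector_derivative_nth[OF has_vector_derivative_nth[OF assms]]
  by (intro has_vector_derivative_vec) (simp add: transpose_def)

lemma has_vector_derivative_continuous_on: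
  assumes "\<And>x. (f has_vector_derivative f' x) (at x)"
  shows "continuous_on S f"
  by (intro continuous_at_imp_continuous_on ballI has_vector_derivative_continuous[OF assms])

lemma continuous_on_det:
  fixes M :: "'a::topological_space \<Rightarrow> complex^'n^'n"
  assumes "continuous_on S M"
  shows "continuous_on S (\<lambda>x. det (M x))"
  unfolding det_def using assms by (intro continuous_intros)

lemma continuous_on_trace:
  fixes M :: "'a::topological_space \<Rightarrow> complex^'n^'n"
  assumes "continuous_on S M"
  shows "continuous_on S (\<lambda>x. trace (M x))"
  unfolding trace_def using assms by (intro continuous_intros)

lemma continuous_on_f3_complex:
  assumes "continuous_on S M"
  shows "continuous_on S (\<lambda>x. f3_complex (M x))"
  unfolding f3_complex_eq_minors using assms by (intro continuous_intros)

lemma continuous_on_minor_sum3: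
  assumes "continuous_on S M"
  shows "continuous_on S (\<lambda>x. minor_sum3 (M x))"
  unfolding minor_sum3_def
proof (intro continuous_on_sum continuous_on_det continuous_on_vec_lambda)
  show "continuous_on S (\<lambda>x. if i = k then if j = k then 1 else 0 else M x $ i $ j)" for i j k
    using assms by (cases "i = k") (auto intro!: continuous_intros)
qed

text \<open>Periodicity is assumed lemma by lemma, for the one value of \<open>\<lambda>\<close> that the lemma is about.\<close>

locale floquet_system =
  fixes A V :: "real \<Rightarrow> complex \<Rightarrow> complex^4^4"
  assumes regular: "regular_coefficient A"
    and traceless: "\<And>x l. trace (A x l) = 0"
    and fundamental: "fundamental_solution A V"
begin

lemma V_zero: "V 0 l = mat 1"
  and V_deriv: "((\<lambda>y. V y l) has_vector_derivative A x l ** V x l) (at x)"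
  using fundamental by (auto simp: fundamental_solution_def)

lemma det_V: "det (V x l) = 1"
  using liouville[of "\<lambda>x. V x l" "\<lambda>x. A x l", OF V_deriv traceless] by (simp add: V_zero)

lemma A_continuous_x: "continuous_on S (\<lambda>x. A x l)"
proof -
  have "continuous_on S ((\<lambda>(x, l). A x l) \<circ> (\<lambda>x. (x, l)))"
    using regular unfolding regular_coefficient_def
    by (intro continuous_on_compose continuous_intros) (auto intro: continuous_on_subset)
  then show ?thesis by (simp add: o_def)
qed

lemma V_unique:
  fixes U :: "real \<Rightarrow> complex^'m^4"
  assumes "\<And>x. (U has_vector_derivative A x l ** U x) (at x)"
  shows "U x = V x l ** U 0"
  using linear_ode_unique[of "\<lambda>x. V x l" "\<lambda>x. A x l", OF V_deriv det_V V_zero assms] .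

lemma V_cnj:
  assumes "A1_real A"
  shows "V x (cnj l) = cnj_matrix (V x l)"
proof -
  have "cnj_matrix (V x l) = V x (cnj l) ** cnj_matrix (V 0 l)"
    using has_vector_derivative_cnj_matrix[OF V_deriv[of l]]
    by (intro V_unique) (simp add: cnj_matrix_mult reflected_coefficient[OF regular assms])
  moreover have "cnj_matrix (V 0 l) = mat 1" by (simp add: V_zero cnj_matrix_def mat_def vec_eq_iff)
  ultimately show ?thesis by simp
qed

text \<open>By (A2) the derivative \<open>V\<^sup>T (A\<^sup>T B + B A(-\<lambda>)) V(-\<lambda>)\<close> of the left-hand side vanishes, and at \<open>x = 0\<close> the left-hand side equals \<open>B\<close>.\<close>

lemma V_symplectic:
  assumes B: "\<And>x. transpose (A x l) ** B = - (B ** A x (- l))"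
  shows "transpose (V x l) ** B ** V x (- l) = B"
proof -
  have "((\<lambda>x. transpose (V x l) ** B ** V x (- l)) has_vector_derivative 0) (at x)" for x
  proof -
    note has_vector_derivative_matrix_mult[OF has_vector_derivative_matrix_mult[OF
        has_vector_derivative_transpose[OF V_deriv[of l x]] has_vector_derivative_const[of B]] V_deriv[of "- l" x]]
    moreover have "transpose (V x l) ** B ** (A x (- l) ** V x (- l)) +
       (transpose (V x l) ** 0 + transpose (A x l ** V x l) ** B) ** V x (- l) = 0" (is "?L = 0")
    proof -
      have neg: "P ** - Q = - (P ** Q)" "- P ** Q = - (P ** Q)" for P Q :: "complex^4^4"
        by (simp_all add: vec_eq_iff matrix_matrix_mult_def sum_negf)
      have z: "P ** 0 = 0" for P :: "complex^4^4" by (simp add: vec_eq_iff matrix_matrix_mult_def)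
      have "?L = transpose (V x l) ** (B ** A x (- l)) ** V x (- l) +
         transpose (V x l) ** (transpose (A x l) ** B) ** V x (- l)"
        by (simp add: matrix_transpose_mul matrix_mul_assoc z)
      also have "\<dots> = 0" unfolding B neg by simp
      finally show ?thesis .
    qed
    ultimately show ?thesis by simp
  qed
  then obtain c where "\<And>x. transpose (V x l) ** B ** V x (- l) = c"
    using has_vector_derivative_zero_constant[of UNIV "\<lambda>x. transpose (V x l) ** B ** V x (- l)"] by auto
  from this[of 0] this[of x] show ?thesis by (simp add: V_zero transpose_mat)
qed

text \<open>Variation of constants without an integral inequality: for \<open>\<lambda>'\<close> near \<open>\<lambda>\<close> the matrix \<open>Y = V(x, \<lambda>)\<^sup>-\<^sup>1 V(x, \<lambda>')\<close> starts at the
  identity and satisfies \<open>Y' = V\<^sup>-\<^sup>1 (A(x, \<lambda>') - A(x, \<lambda>)) V Y\<close>. If the difference of the coefficients is at most \<open>e\<close>, then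
  \<open>|Y - 1| \<le> L e T s\<close> on \<open>[0, T]\<close>, where \<open>s\<close> is the maximum of \<open>|Y|\<close> itself. For small \<open>e\<close> this bounds \<open>s\<close> and then
  shows that \<open>Y - 1\<close> is of order \<open>e\<close>.\<close>

lemma continuous_V_parameter:
  assumes T: "T \<ge> 0"
  shows "continuous_on UNIV (\<lambda>l. V T l)"
proof -
  have "\<exists>C\<ge>0. \<forall>e>0. \<exists>d>0. \<forall>l'. dist l' l < d \<longrightarrow> norm (V T l' - V T l) \<le> C * e" for l
  proof -
    obtain W where W: "\<And>x. V x l ** W x = mat 1" "\<And>x. W x ** V x l = mat 1"
      "\<And>x. (W has_vector_derivative - (W x ** A x l)) (at x)"
      using inverse_fundamental_matrix[OF V_deriv det_V] by blast
    obtain K where K: "K > 0" "\<And>(P :: complex^4^4) (Q :: complex^4^4). norm (P ** Q) \<le> norm P * norm Q * K"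
      using bounded_bilinear.pos_bounded[OF bounded_bilinear_matrix_mult] by blast
    have normK: "norm (P ** Q) \<le> p * q * K" if "norm P \<le> p" "norm Q \<le> q" "p \<ge> 0"
      for P Q :: "complex^4^4" and p q
      using that K(1) by (intro order_trans[OF K(2)] mult_right_mono mult_mono) auto
    have contV: "continuous_on {0..T} (\<lambda>x. V x l')" for l'
      by (rule has_vector_derivative_continuous_on[OF V_deriv])
    have contW: "continuous_on {0..T} W"
      by (rule has_vector_derivative_continuous_on[OF W(3)])
    have bdd: "\<exists>c>0. \<forall>x\<in>{0..T}. norm (f x) \<le> c" if "continuous_on {0..T} f" for f :: "real \<Rightarrow> complex^4^4"
    proof -
      have "bounded (f ` {0..T})" using that compact_continuous_image compact_imp_bounded compact_Icc by blast
      then show ?thesis unfolding bounded_pos by auto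
    qed
    obtain v where v: "v > 0" "\<And>x. x \<in> {0..T} \<Longrightarrow> norm (V x l) \<le> v" using bdd[OF contV] by blast
    obtain w where w: "w > 0" "\<And>x. x \<in> {0..T} \<Longrightarrow> norm (W x) \<le> w" using bdd[OF contW] by blast
    define L where "L = w * v * K * K * K"
    define n1 where "n1 = norm (mat 1 :: complex^4^4)"
    have L: "L > 0" using w v K by (simp add: L_def)
    have n1: "n1 \<ge> 0" by (simp add: n1_def)
    show ?thesis
    proof (rule exI[of _ "v * (2 * L * T * n1) * K"], intro conjI allI impI)
      show "0 \<le> v * (2 * L * T * n1) * K" using v L T n1 K by simp
      fix e :: real assume e: "e > 0"
      \<comment> \<open>so small that \<open>s\<close> can be absorbed, that is \<open>L e' T \<le> 1/2\<close>\<close>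
      define e' where "e' = min e (1 / (2 * L * (T + 1)))"
      have e': "e' > 0" "e' \<le> e" "L * e' * T \<le> 1 / 2"
      proof -
        show "e' > 0" "e' \<le> e" using e L T by (auto simp: e'_def)
        have "L * e' * T \<le> L * (1 / (2 * L * (T + 1))) * T"
          using L T by (intro mult_right_mono mult_left_mono) (auto simp: e'_def)
        also have "L * (1 / (2 * L * (T + 1))) * T = (T / (T + 1)) / 2" using L T by simp
        also have "\<dots> \<le> 1 / 2" using T by simp
        finally show "L * e' * T \<le> 1 / 2" .
      qed
      have "uniformly_continuous_on ({0..T} \<times> cball l 1) (\<lambda>(x, l). A x l)"
        using regular unfolding regular_coefficient_def
        by (intro compact_uniformly_continuous compact_Times) (auto intro: continuous_on_subset)
      then obtain d where d: "d > 0" "\<And>p q. \<lbrakk>p \<in> {0..T} \<times> cball l 1; q \<in> {0..T} \<times> cball l 1; dist q p < d\<rbrakk>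
          \<Longrightarrow> dist ((\<lambda>(x, l). A x l) q) ((\<lambda>(x, l). A x l) p) < e'"
        unfolding uniformly_continuous_on_def using e'(1) by metis
      show "\<exists>d>0. \<forall>l'. dist l' l < d \<longrightarrow> norm (V T l' - V T l) \<le> v * (2 * L * T * n1) * K * e"
      proof (intro exI[of _ "min d 1"] conjI allI impI)
        show "min d 1 > 0" using d by simp
        fix l' assume l': "dist l' l < min d 1"
        have diffA: "norm (A x l' - A x l) \<le> e'" if "x \<in> {0..T}" for x
          using d(2)[of "(x, l)" "(x, l')"] that l' by (auto simp: dist_commute dist_Pair_Pair dist_norm)
        define Y where "Y x = W x ** V x l'" for x
        define D where "D x = W x ** ((A x l' - A x l) ** (V x l ** Y x))" for x
        have VY: "V x l ** Y x = V x l'" for x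
          unfolding Y_def using W(1)[of x] by (metis matrix_mul_assoc matrix_mul_lid)
        have Y: "(Y has_vector_derivative D x) (at x)" for x
        proof -
          have "W x ** (A x l' ** V x l') + - (W x ** A x l) ** V x l' = D x"
          proof -
            have alg: "- P ** Q = - (P ** Q)" "P ** (Q - R) = P ** Q - P ** R" "(Q - R) ** P = Q ** P - R ** P"
              for P Q R :: "complex^4^4"
              by (simp_all add: vec_eq_iff matrix_matrix_mult_def sum_negf sum_subtractf algebra_simps)
            show ?thesis unfolding D_def VY alg matrix_mul_assoc by simp
          qed
          then show ?thesis
            using has_vector_derivative_matrix_mult[OF W(3)[of x] V_deriv[of l' x]] unfolding Y_def by simp
        qed
        have contY: "continuous_on {0..T} Y"
          by (rule has_vector_derivative_continuous_on[OF Y])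
        have "\<exists>x\<in>{0..T}. \<forall>y\<in>{0..T}. norm (Y y) \<le> norm (Y x)"
          using T by (intro continuous_attains_sup continuous_on_norm contY) auto
        then obtain x0 where x0: "x0 \<in> {0..T}" "\<And>y. y \<in> {0..T} \<Longrightarrow> norm (Y y) \<le> norm (Y x0)" by blast
        define s where "s = norm (Y x0)"
        have s: "s \<ge> 0" by (simp add: s_def)
        have boundD: "norm (D x) \<le> L * e' * s" if x: "x \<in> {0..T}" for x
        proof -
          have "norm (V x l ** Y x) \<le> v * s * K"
            using v x0(2) x by - (rule normK, auto simp: s_def)
          then have "norm ((A x l' - A x l) ** (V x l ** Y x)) \<le> e' * (v * s * K) * K"
            using diffA[OF x] e'(1) by - (rule normK, auto)
          then have "norm (D x) \<le> w * (e' * (v * s * K) * K) * K"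
            unfolding D_def using w x by - (rule normK, auto)
          also have "\<dots> = L * e' * s" by (simp add: L_def mult_ac)
          finally show ?thesis .
        qed
        have Y0: "Y 0 = mat 1" using W(2)[of 0] by (simp add: Y_def V_zero)
        have dev: "norm (Y x - mat 1) \<le> L * e' * s * T" if x: "x \<in> {0..T}" for x
        proof -
          have "norm (Y x - Y 0) \<le> L * e' * s * norm (x - 0)"
          proof (rule differentiable_bound[of "{0..T}" Y "\<lambda>y h. h *\<^sub>R D y"])
            show "(Y has_derivative (\<lambda>h. h *\<^sub>R D y)) (at y within {0..T})" if "y \<in> {0..T}" for y
              using Y[of y] has_derivative_at_withinI unfolding has_vector_derivative_def by blast
            show "onorm (\<lambda>h. h *\<^sub>R D y) \<le> L * e' * s" if "y \<in> {0..T}" for y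
              using boundD[OF that] by (intro onorm_le) (simp add: mult.commute mult_left_mono)
          qed (use x T in auto)
          also have "\<dots> \<le> L * e' * s * T" using x L e' s by (intro mult_left_mono) auto
          finally show ?thesis unfolding Y0 .
        qed
        have "s \<le> n1 + L * e' * T * s"
        proof -
          have "s \<le> norm (Y x0 - mat 1) + n1"
            unfolding s_def n1_def using norm_triangle_ineq[of "Y x0 - mat 1" "mat 1"] by simp
          also have "\<dots> \<le> L * e' * s * T + n1" using dev[OF x0(1)] by simp
          finally show ?thesis by (simp add: mult_ac)
        qed
        also have "L * e' * T * s \<le> 1 / 2 * s" using e'(3) s by (intro mult_right_mono)
        finally have s2: "s \<le> 2 * n1" by simp
        have "norm (Y T - mat 1) \<le> L * e' * s * T" using dev[of T] T by simp
        also have "\<dots> \<le> L * e * (2 * n1) * T"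
          using L e' e s s2 T by (intro mult_right_mono mult_mono) auto
        finally have YT: "norm (Y T - mat 1) \<le> 2 * L * T * n1 * e" by (simp add: mult_ac)
        have "V T l' - V T l = V T l ** (Y T - mat 1)"
          by (simp add: bounded_bilinear.diff_right[OF bounded_bilinear_matrix_mult] VY)
        then have "norm (V T l' - V T l) \<le> norm (V T l) * norm (Y T - mat 1) * K" using K(2) by simp
        also have "\<dots> \<le> v * (2 * L * T * n1 * e) * K"
          using v(2)[of T] T YT K(1) v(1) by (intro mult_right_mono mult_mono) auto
        finally show "norm (V T l' - V T l) \<le> v * (2 * L * T * n1) * K * e" by (simp add: mult_ac)
      qed
    qed
  qed
  note est = this
  show ?thesis unfolding continuous_on_iff
  proof (intro ballI allI impI)
    fix l and e :: real assume e: "e > 0"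
    obtain C where C: "C \<ge> 0" "\<And>e. e > 0 \<Longrightarrow> \<exists>d>0. \<forall>l'. dist l' l < d \<longrightarrow> norm (V T l' - V T l) \<le> C * e"
      using est[of l] by blast
    have "e / (C + 1) > 0" using e C by simp
    then obtain d where d: "d > 0" "\<And>l'. dist l' l < d \<Longrightarrow> norm (V T l' - V T l) \<le> C * (e / (C + 1))"
      using C(2) by blast
    have "C * (e / (C + 1)) < e" using e C(1) by (simp add: divide_less_eq)
    show "\<exists>d>0. \<forall>l'\<in>UNIV. dist l' l < d \<longrightarrow> dist (V T l') (V T l) < e"
    proof (intro exI[of _ d] conjI ballI impI)
      fix l' assume "dist l' l < d"
      from d(2)[OF this] show "dist (V T l') (V T l) < e"
        using \<open>C * (e / (C + 1)) < e\<close> by (simp add: dist_norm)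
    qed (rule d(1))
  qed
qed

text \<open>The identities hold where \<open>B\<close> is invertible, which is a dense set of parameters, and both sides are continuous.\<close>

lemma monodromy_coefficients:
  assumes T: "T \<ge> 0" and A2: "A2_symmetric A"
  shows "minor_sum3 (V T l) = trace (V T (- l))" "f3_complex (V T l) = f3_complex (V T (- l))"
proof -
  obtain B where fin: "finite {l. \<not> invertible (B l)}"
    and B: "\<And>x l. transpose (A x l) ** B l = - (B l ** A x (- l))"
    using A2 unfolding A2_symmetric_def by blast
  define S where "S = {l. invertible (B l)}"
  have "interior (- S) = {}"
    using fin by (intro empty_interior_finite) (simp add: S_def Collect_neg_eq)
  then have S: "closure S = UNIV" unfolding interior_complement by blast
  have eq: "minor_sum3 (V T l) = trace (V T (- l)) \<and> f3_complex (V T l) = f3_complex (V T (- l))" if "l \<in> S" for l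
    using symmetric_coefficients[OF V_symplectic[OF B] _ det_V det_V] that by (simp add: S_def)
  have cV: "continuous_on (closure S) (\<lambda>l. V T l)" "continuous_on (closure S) (\<lambda>l. V T (- l))"
    using continuous_V_parameter[OF T]
    by (auto intro: continuous_on_subset continuous_on_compose2[OF continuous_V_parameter[OF T] continuous_on_minus[OF continuous_on_id]])
  have "minor_sum3 (V T l) - trace (V T (- l)) = 0"
    by (rule continuous_constant_on_closure[of S "\<lambda>l. minor_sum3 (V T l) - trace (V T (- l))"])
       (use cV eq S in \<open>auto intro!: continuous_intros continuous_on_minor_sum3 continuous_on_trace\<close>)
  then show "minor_sum3 (V T l) = trace (V T (- l))" by simp
  have "f3_complex (V T l) - f3_complex (V T (- l)) = 0"
    by (rule continuous_constant_on_closure[of S "\<lambda>l. f3_complex (V T l) - f3_complex (V T (- l))"])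
       (use cV eq S in \<open>auto intro!: continuous_intros continuous_on_f3_complex\<close>)
  then show "f3_complex (V T l) = f3_complex (V T (- l))" by simp
qed

lemma monodromy_imaginary_axis:
  assumes T: "T \<ge> 0" and A1: "A1_real A" and A2: "A2_symmetric A" and l: "Re l = 0"
  shows "minor_sum3 (V T l) = cnj (trace (V T l))" "f3_complex (V T l) \<in> \<real>"
proof -
  have "- l = cnj l" using l by (simp add: complex_eq_iff)
  then have "V T (- l) = cnj_matrix (V T l)" using V_cnj[OF A1] by simp
  then show "minor_sum3 (V T l) = cnj (trace (V T l))" "f3_complex (V T l) \<in> \<real>"
    using monodromy_coefficients[OF T A2, of l] by (simp_all add: trace_cnj f3_complex_cnj Reals_cnj_iff)
qed

lemma V_add_period:
  assumes "\<And>x. A (x + T) l = A x l"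
  shows "V (x + T) l = V x l ** V T l"
proof -
  have "((\<lambda>x. V (x + T) l) has_vector_derivative A x l ** V (x + T) l) (at x)" for x
  proof -
    have "((\<lambda>y. V y l) \<circ> (\<lambda>x. x + T) has_vector_derivative 1 *\<^sub>R (A (x + T) l ** V (x + T) l)) (at x)"
      by (rule vector_diff_chain_at[OF _ V_deriv]) (auto intro!: derivative_eq_intros simp: has_vector_derivative_def)
    then show ?thesis by (simp add: o_def assms)
  qed
  from V_unique[OF this, of x] show ?thesis by simp
qed

end

section \<open>Absolutely continuous functions\<close>

text \<open>\<open>f\<close> is locally absolutely continuous with derivative \<open>f'\<close> almost everywhere, in integrated form; the choice of \<open>f'\<close> on
  null sets is immaterial (\<open>ac_cong_AE\<close>).\<close>

definition has_ac_derivative :: "(real \<Rightarrow> 'a::euclidean_space) \<Rightarrow> (real \<Rightarrow> 'a) \<Rightarrow> bool" where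
  "has_ac_derivative f f' \<longleftrightarrow> f' \<in> borel_measurable borel \<and>
     (\<forall>a b. a \<le> b \<longrightarrow> set_integrable lborel {a..b} f' \<and> (LINT x:{a..b}|lborel. f' x) = f b - f a)"

lemma ac_C1:
  fixes f :: "real \<Rightarrow> 'a::euclidean_space"
  assumes "\<And>x. (f has_vector_derivative f' x) (at x)" "continuous_on UNIV f'"
  shows "has_ac_derivative f f'"
  unfolding has_ac_derivative_def
proof (intro conjI allI impI)
  show "f' \<in> borel_measurable borel" using assms(2) by (rule borel_measurable_continuous_onI)
  fix a b :: real assume ab: "a \<le> b"
  have c: "continuous_on {a..b} f'" using assms(2) continuous_on_subset by blast
  then show i: "set_integrable lborel {a..b} f'" by (intro borel_integrable_atLeastAtMost')
  show "(LINT x:{a..b}|lborel. f' x) = f b - f a"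
    using set_borel_integral_eq_integral(2)[OF i]
      integral_unique[OF fundamental_theorem_of_calculus[OF ab, of f f']] assms(1)
    by (simp add: has_vector_derivative_at_within)
qed

lemma ac_continuous:
  assumes "has_ac_derivative f f'"
  shows "continuous_on UNIV f"
proof -
  have "continuous_on {a..b} f" if "a \<le> b" for a b
  proof -
    have i: "set_integrable lborel {a..x} f'" "(LINT x:{a..x}|lborel. f' x) = f x - f a" if "a \<le> x" for x
      using assms that by (auto simp: has_ac_derivative_def)
    have "f x = f a + integral {a..x} f'" if "x \<in> {a..b}" for x
      using i[of x] that set_borel_integral_eq_integral(2)[OF i(1)[of x]] by auto
    moreover have "continuous_on {a..b} (\<lambda>x. f a + integral {a..x} f')"
      using set_borel_integral_eq_integral(1)[OF i(1)[OF that]]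
      by (intro continuous_intros indefinite_integral_continuous_1)
    ultimately show ?thesis
      using continuous_on_cong[of "{a..b}" "{a..b}" f "\<lambda>x. f a + integral {a..x} f'"] by blast
  qed
  then have "isCont f x" for x
    using continuous_on_interior[of "{x-1..x+1}" f x] by simp
  then show ?thesis by (simp add: continuous_at_imp_continuous_on)
qed

lemma set_integrable_continuous_mult:
  fixes f g :: "real \<Rightarrow> complex"
  assumes "continuous_on UNIV f" "set_integrable lborel {a..b} g"
  shows "set_integrable lborel {a..b} (\<lambda>x. f x * g x)"
proof -
  have "bounded (f ` {a..b})"
    using assms(1) by (intro compact_imp_bounded compact_continuous_image) (auto intro: continuous_on_subset)
  then obtain K where K: "\<forall>z\<in>f ` {a..b}. norm z \<le> K" unfolding bounded_iff by blast
  have f: "f \<in> borel_measurable borel" using assms(1) by (rule borel_measurable_continuous_onI)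
  have g: "integrable lborel (\<lambda>x. indicator {a..b} x *\<^sub>R g x)" using assms(2) by (simp add: set_integrable_def)
  show ?thesis unfolding set_integrable_def
  proof (rule Bochner_Integration.integrable_bound[OF integrable_mult_right[OF integrable_norm[OF g], of K]])
    have "(\<lambda>x. f x * (indicator {a..b} x *\<^sub>R g x)) \<in> borel_measurable lborel"
      using f g by (intro borel_measurable_times) (auto dest: borel_measurable_integrable)
    then show "(\<lambda>x. indicator {a..b} x *\<^sub>R (f x * g x)) \<in> borel_measurable lborel"
      by (simp add: mult_scaleR_right)
    show "AE x in lborel. norm (indicator {a..b} x *\<^sub>R (f x * g x)) \<le> norm (K * norm (indicator {a..b} x *\<^sub>R g x))"
    proof (rule AE_I2)
      fix x
      show "norm (indicator {a..b} x *\<^sub>R (f x * g x)) \<le> norm (K * norm (indicator {a..b} x *\<^sub>R g x))"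
      proof (cases "x \<in> {a..b}")
        case True
        then have "norm (f x) \<le> K" using K by blast
        then have "norm (f x) \<le> \<bar>K\<bar>" by linarith
        then show ?thesis using True by (simp add: norm_mult abs_mult mult_right_mono)
      qed simp
    qed
  qed
qed

text \<open>The product rule. By Fubini the increment product \<open>(f(b) - f(a)) (g(b) - g(a))\<close> is the integral of \<open>f'(x) g'(s)\<close> over the square
  \<open>[a, b]\<^sup>2\<close>. Below the diagonal the inner integral over \<open>s\<close> is \<open>g(x) - g(a)\<close>, above it the inner integral over \<open>x\<close> is
  \<open>f(s) - f(a)\<close>.\<close>

lemma ac_mult:
  fixes f g :: "real \<Rightarrow> complex"
  assumes f: "has_ac_derivative f f'" and g: "has_ac_derivative g g'"
  shows "has_ac_derivative (\<lambda>x. f x * g x) (\<lambda>x. f' x * g x + f x * g' x)"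
  unfolding has_ac_derivative_def
proof (intro conjI allI impI)
  have cf: "continuous_on UNIV f" and cg: "continuous_on UNIV g" using f g ac_continuous by auto
  have mf: "f \<in> borel_measurable borel" "g \<in> borel_measurable borel"
    using cf cg by (auto intro: borel_measurable_continuous_onI)
  have mf': "f' \<in> borel_measurable borel" "g' \<in> borel_measurable borel"
    using f g by (auto simp: has_ac_derivative_def)
  show "(\<lambda>x. f' x * g x + f x * g' x) \<in> borel_measurable borel" using mf mf' by simp
  fix a b :: real assume ab: "a \<le> b"
  have If: "set_integrable lborel {a..b} f'" and Ig: "set_integrable lborel {a..b} g'"
    using f g ab by (auto simp: has_ac_derivative_def)
  have I1: "set_integrable lborel {a..b} (\<lambda>x. g x * f' x)" and I2: "set_integrable lborel {a..b} (\<lambda>x. f x * g' x)"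
    by (intro set_integrable_continuous_mult cf cg If Ig)+
  then show "set_integrable lborel {a..b} (\<lambda>x. f' x * g x + f x * g' x)"
    using set_integral_add(1) by (simp add: mult.commute)
  define F where "F x = indicator {a..b} x *\<^sub>R f' x" for x
  define G where "G x = indicator {a..b} x *\<^sub>R g' x" for x
  have intF: "integrable lborel F" and intG: "integrable lborel G"
    using If Ig by (simp_all add: set_integrable_def F_def[abs_def] G_def[abs_def])
  have [measurable]: "F \<in> borel_measurable lborel" "G \<in> borel_measurable lborel"
    using intF intG by auto
  have prodint: "integrable (lborel \<Otimes>\<^sub>M lborel) (\<lambda>(x, s). F x * G s)"
  proof (rule lborel_pair.Fubini_integrable)
    show "(\<lambda>(x, s). F x * G s) \<in> borel_measurable (lborel \<Otimes>\<^sub>M lborel)" by measurable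
    show "integrable lborel (\<lambda>x. LBINT y. norm (case (x, y) of (x, s) \<Rightarrow> F x * G s))"
      using intF by (simp add: norm_mult)
    show "AE x in lborel. integrable lborel (\<lambda>y. case (x, y) of (x, s) \<Rightarrow> F x * G s)"
      using intG by simp
  qed
  have lower: "integrable (lborel \<Otimes>\<^sub>M lborel) (\<lambda>(x, s). F x * G s * indicator {..x} s)"
    by (rule Bochner_Integration.integrable_bound[OF prodint]) (auto simp: indicator_def norm_mult)
  have upper: "integrable (lborel \<Otimes>\<^sub>M lborel) (\<lambda>(x, s). F x * G s * indicator {x<..} s)"
    by (rule Bochner_Integration.integrable_bound[OF prodint]) (auto simp: indicator_def norm_mult)
  have intF': "integral\<^sup>L lborel F = f b - f a" and intG': "integral\<^sup>L lborel G = g b - g a"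
    using f g ab by (simp_all add: has_ac_derivative_def set_lebesgue_integral_def F_def[abs_def] G_def[abs_def])
  have low: "(LBINT s. F x * G s * indicator {..x} s) = F x * (g x - g a)" for x
  proof (cases "x \<in> {a..b}")
    case True
    have "(LBINT s. F x * G s * indicator {..x} s) = F x * (LBINT s. indicator {a..x} s *\<^sub>R g' s)"
      unfolding integral_mult_right_zero[symmetric]
      using True by (intro Bochner_Integration.integral_cong) (auto simp: G_def indicator_def)
    also have "(LBINT s. indicator {a..x} s *\<^sub>R g' s) = g x - g a"
      using g True by (simp add: has_ac_derivative_def set_lebesgue_integral_def)
    finally show ?thesis .
  qed (simp add: F_def)
  have up: "(LBINT x. F x * G s * indicator {x<..} s) = G s * (f s - f a)" for s
  proof (cases "s \<in> {a..b}")
    case True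
    have "(LBINT x. F x * G s * indicator {x<..} s) = (LBINT x. G s * (indicator {a..s} x *\<^sub>R f' x))"
    proof (rule integral_cong_AE)
      show "AE x in lborel. F x * G s * indicator {x<..} s = G s * (indicator {a..s} x *\<^sub>R f' x)"
        using AE_lborel_singleton[of s] by eventually_elim (use True in \<open>auto simp: F_def indicator_def\<close>)
      have "(\<lambda>x. F x * G s * indicator {x<..} s) = (\<lambda>x. F x * G s * indicator {..<s} x)"
        by (auto simp: indicator_def fun_eq_iff)
      then show "(\<lambda>x. F x * G s * indicator {x<..} s) \<in> borel_measurable lborel" by simp
      show "(\<lambda>x. G s * (indicator {a..s} x *\<^sub>R f' x)) \<in> borel_measurable lborel" using mf' by measurable
    qed
    also have "\<dots> = G s * (LBINT x. indicator {a..s} x *\<^sub>R f' x)" by (rule integral_mult_right_zero)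
    also have "(LBINT x. indicator {a..s} x *\<^sub>R f' x) = f s - f a"
      using f True by (simp add: has_ac_derivative_def set_lebesgue_integral_def)
    finally show ?thesis .
  qed (simp add: G_def)
  have "(f b - f a) * (g b - g a) = (LBINT x. LBINT s. F x * G s)"
    by (simp add: intF' intG')
  also have "\<dots> = integral\<^sup>L (lborel \<Otimes>\<^sub>M lborel) (\<lambda>(x, s). F x * G s)"
    using lborel_pair.integral_fst[OF prodint] by simp
  also have "\<dots> = integral\<^sup>L (lborel \<Otimes>\<^sub>M lborel) (\<lambda>p. (case p of (x, s) \<Rightarrow> F x * G s * indicator {..x} s) + (case p of (x, s) \<Rightarrow> F x * G s * indicator {x<..} s))"
    by (intro Bochner_Integration.integral_cong) (auto simp: indicator_def)
  also have "\<dots> = integral\<^sup>L (lborel \<Otimes>\<^sub>M lborel) (\<lambda>(x, s). F x * G s * indicator {..x} s)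
     + integral\<^sup>L (lborel \<Otimes>\<^sub>M lborel) (\<lambda>(x, s). F x * G s * indicator {x<..} s)"
    by (rule Bochner_Integration.integral_add[OF lower upper])
  also have "integral\<^sup>L (lborel \<Otimes>\<^sub>M lborel) (\<lambda>(x, s). F x * G s * indicator {..x} s) = (LBINT x. F x * (g x - g a))"
    using lborel_pair.integral_fst[OF lower] by (simp add: low)
  also have "integral\<^sup>L (lborel \<Otimes>\<^sub>M lborel) (\<lambda>(x, s). F x * G s * indicator {x<..} s) = (LBINT s. G s * (f s - f a))"
    using lborel_pair.integral_snd[of "\<lambda>x s. F x * G s * indicator {x<..} s"] upper by (simp add: up)
  also have "(LBINT x. F x * (g x - g a)) = (LINT x:{a..b}|lborel. g x * f' x) - (LBINT x. F x * g a)"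
  proof -
    have i: "integrable lborel (\<lambda>x. F x * g x)"
      using I1 by (simp add: set_integrable_def F_def mult.commute)
    have "(LBINT x. F x * (g x - g a)) = (LBINT x. F x * g x) - (LBINT x. F x * g a)"
      unfolding right_diff_distrib using i intF by (intro Bochner_Integration.integral_diff) auto
    then show ?thesis by (simp add: set_lebesgue_integral_def F_def mult.commute)
  qed
  also have "(LBINT x. G x * (f x - f a)) = (LINT x:{a..b}|lborel. f x * g' x) - (LBINT x. G x * f a)"
  proof -
    have i: "integrable lborel (\<lambda>x. G x * f x)"
      using I2 by (simp add: set_integrable_def G_def mult.commute)
    have "(LBINT x. G x * (f x - f a)) = (LBINT x. G x * f x) - (LBINT x. G x * f a)"
      unfolding right_diff_distrib using i intG by (intro Bochner_Integration.integral_diff) auto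
    then show ?thesis by (simp add: set_lebesgue_integral_def G_def mult.commute)
  qed
  finally have "(LINT x:{a..b}|lborel. g x * f' x) + (LINT x:{a..b}|lborel. f x * g' x) = f b * g b - f a * g a"
    by (simp add: intF' intG' algebra_simps)
  then show "(LINT x:{a..b}|lborel. f' x * g x + f x * g' x) = f b * g b - f a * g a"
    using set_integral_add(2)[OF I1 I2] by (simp add: mult.commute)
qed

lemma ac_add:
  assumes "has_ac_derivative f f'" "has_ac_derivative g g'"
  shows "has_ac_derivative (\<lambda>x. f x + g x) (\<lambda>x. f' x + g' x)"
  using assms unfolding has_ac_derivative_def by (auto simp: set_integral_add)

lemma ac_cmult:
  fixes f :: "real \<Rightarrow> complex"
  assumes "has_ac_derivative f f'"
  shows "has_ac_derivative (\<lambda>x. c * f x) (\<lambda>x. c * f' x)"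
  using assms unfolding has_ac_derivative_def by (auto simp: right_diff_distrib)

lemma ac_const: "has_ac_derivative (\<lambda>x. c) (\<lambda>x. 0)"
  unfolding has_ac_derivative_def by (auto simp: set_integrable_def set_lebesgue_integral_def)

lemma ac_sum:
  assumes "\<And>i. i \<in> I \<Longrightarrow> has_ac_derivative (f i) (f' i)"
  shows "has_ac_derivative (\<lambda>x. \<Sum>i\<in>I. f i x) (\<lambda>x. \<Sum>i\<in>I. f' i x)"
  using assms by (induction I rule: infinite_finite_induct) (auto intro: ac_const ac_add)

lemma ac_cong_AE:
  assumes f: "has_ac_derivative f f'" and g: "g \<in> borel_measurable borel" and ae: "AE x in lborel. f' x = g x"
  shows "has_ac_derivative f g"
  unfolding has_ac_derivative_def
proof (intro conjI allI impI)
  fix a b :: real assume "a \<le> b"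
  then have *: "set_integrable lborel {a..b} f'" "(LINT x:{a..b}|lborel. f' x) = f b - f a" "f' \<in> borel_measurable borel"
    using f by (auto simp: has_ac_derivative_def)
  have ae': "AE x\<in>{a..b} in lborel. f' x = g x" using ae by eventually_elim simp
  show "set_integrable lborel {a..b} g"
    using set_integrable_cong_AE[OF _ _ ae'] * g by simp
  have "(LINT x:{a..b}|lborel. f' x) = (LINT x:{a..b}|lborel. g x)"
    using * g ae by (intro set_lebesgue_integral_cong_AE) (auto simp: set_borel_measurable_def)
  then show "(LINT x:{a..b}|lborel. g x) = f b - f a" using * by simp
qed (rule g)

lemma ac_same_derivative:
  assumes "has_ac_derivative f h" "has_ac_derivative g h"
  shows "f x - f 0 = g x - g 0"
proof (cases "x \<ge> 0")
  case True
  then show ?thesis using assms unfolding has_ac_derivative_def by metis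
next
  case False
  then have "f 0 - f x = g 0 - g x" using assms unfolding has_ac_derivative_def by (metis linear)
  then show ?thesis by (simp add: algebra_simps)
qed

section \<open>Square integrable functions and the pairing with adjoint solutions\<close>

lemma L2_fun_measurable: "f \<in> L2_fun \<Longrightarrow> f \<in> borel_measurable borel"
  by (simp add: L2_fun_def)

lemma L2_fun_dominated:
  assumes f: "f \<in> borel_measurable borel" and g: "g \<in> L2_fun" and le: "\<And>x. norm (f x) \<le> C * norm (g x)"
  shows "f \<in> L2_fun"
  unfolding L2_fun_def
proof (intro CollectI conjI)
  show "integrable lborel (\<lambda>x. (norm (f x))\<^sup>2)"
  proof (rule Bochner_Integration.integrable_bound)
    show "integrable lborel (\<lambda>x. C\<^sup>2 * (norm (g x))\<^sup>2)" using g by (simp add: L2_fun_def)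
    have "(norm (f x))\<^sup>2 \<le> C\<^sup>2 * (norm (g x))\<^sup>2" for x
      using power_mono[OF le[of x], of 2] by (simp add: power_mult_distrib)
    then show "AE x in lborel. norm ((norm (f x))\<^sup>2) \<le> norm (C\<^sup>2 * (norm (g x))\<^sup>2)" by simp
  qed (use f in simp)
qed (use f in simp)

lemma L2_fun_add:
  assumes "f \<in> L2_fun" "g \<in> L2_fun"
  shows "(\<lambda>x. f x + g x) \<in> L2_fun"
  unfolding L2_fun_def
proof (intro CollectI conjI)
  have m: "f \<in> borel_measurable borel" "g \<in> borel_measurable borel" using assms by (auto simp: L2_fun_def)
  then show "(\<lambda>x. f x + g x) \<in> borel_measurable lborel" by simp
  show "integrable lborel (\<lambda>x. (norm (f x + g x))\<^sup>2)"
  proof (rule Bochner_Integration.integrable_bound)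
    show "integrable lborel (\<lambda>x. 2 * (norm (f x))\<^sup>2 + 2 * (norm (g x))\<^sup>2)" using assms by (simp add: L2_fun_def)
    have "(norm (f x + g x))\<^sup>2 \<le> 2 * (norm (f x))\<^sup>2 + 2 * (norm (g x))\<^sup>2" for x
    proof -
      have "(norm (f x + g x))\<^sup>2 \<le> (norm (f x) + norm (g x))\<^sup>2" by (intro power_mono norm_triangle_ineq) simp
      also have "\<dots> \<le> 2 * (norm (f x))\<^sup>2 + 2 * (norm (g x))\<^sup>2"
        using zero_le_power2[of "norm (f x) - norm (g x)"] by (simp add: power2_sum power2_diff)
      finally show ?thesis .
    qed
    then show "AE x in lborel. norm ((norm (f x + g x))\<^sup>2) \<le> norm (2 * (norm (f x))\<^sup>2 + 2 * (norm (g x))\<^sup>2)" by simp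
  qed (use m in simp)
qed

lemma norm_vector_scalar_mult: "norm (c *s v) = cmod c * norm (v :: complex^'n)"
  unfolding norm_vec_def L2_set_def
  by (simp add: norm_mult power_mult_distrib sum_distrib_left[symmetric] real_sqrt_mult)

lemma vec_nth_measurable [measurable (raw)]:
  fixes f :: "'a \<Rightarrow> complex^'n"
  assumes "f \<in> borel_measurable M"
  shows "(\<lambda>x. f x $ i) \<in> borel_measurable M"
proof -
  have "(\<lambda>v :: complex^'n. v $ i) \<in> borel_measurable borel"
    by (intro borel_measurable_continuous_onI continuous_intros)
  from measurable_compose[OF assms this] show ?thesis .
qed

lemma vector_scalar_mult_measurable [measurable (raw)]:
  fixes f :: "'a \<Rightarrow> complex^'n"
  assumes "c \<in> borel_measurable M" "f \<in> borel_measurable M"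
  shows "(\<lambda>x. c x *s f x) \<in> borel_measurable M"
proof -
  have b: "bounded_bilinear ((*s) :: complex \<Rightarrow> complex^'n \<Rightarrow> complex^'n)"
    by (rule iffD1[OF bilinear_conv_bounded_bilinear])
       (auto simp: bilinear_def vec_eq_iff algebra_simps intro!: linearI)
  have "continuous_on UNIV (\<lambda>p. fst p *s snd p :: complex^'n)"
    by (intro bounded_bilinear.continuous_on[OF b] continuous_intros)
  from borel_measurable_continuous_Pair[OF assms this] show ?thesis by simp
qed

lemma L2_fun_scale:
  assumes "f \<in> L2_fun"
  shows "(\<lambda>x. c *s f x) \<in> L2_fun"
  using L2_fun_measurable[OF assms] by (intro L2_fun_dominated[OF _ assms, of _ "cmod c"]) (auto simp: norm_vector_scalar_mult)

lemma L2_fun_zero: "(\<lambda>x. 0) \<in> L2_fun"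
  by (simp add: L2_fun_def)

lemma L2_fun_sum:
  assumes "\<And>i. i \<in> I \<Longrightarrow> f i \<in> L2_fun"
  shows "(\<lambda>x. \<Sum>i\<in>I. f i x) \<in> L2_fun"
  using assms by (induction I rule: infinite_finite_induct) (auto intro: L2_fun_zero L2_fun_add)

lemma L2_fun_diff:
  assumes "f \<in> L2_fun" "g \<in> L2_fun"
  shows "(\<lambda>x. f x - g x) \<in> L2_fun"
  using L2_fun_add[OF assms(1) L2_fun_scale[OF assms(2), of "-1"]] by simp

lemma L2_fun_set_integrable:
  assumes "f \<in> L2_fun"
  shows "set_integrable lborel {a..b} f"
  unfolding set_integrable_def
proof (rule Bochner_Integration.integrable_bound)
  have "integrable lborel (\<lambda>x. indicator {a..b} x :: real)"
    by (intro integrable_real_indicator) (auto simp: emeasure_lborel_Icc_eq)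
  then show "integrable lborel (\<lambda>x. indicator {a..b} x + (norm (f x))\<^sup>2)"
    using assms by (intro Bochner_Integration.integrable_add) (auto simp: L2_fun_def)
  have "norm (indicator {a..b} x *\<^sub>R f x) \<le> indicator {a..b} x + (norm (f x))\<^sup>2" for x
  proof (cases "x \<in> {a..b}")
    case True
    have "2 * norm (f x) \<le> 1 + (norm (f x))\<^sup>2" using zero_le_power2[of "norm (f x) - 1"] by (simp add: power2_diff)
    then have "norm (f x) \<le> 1 + (norm (f x))\<^sup>2" by (smt (verit) norm_ge_zero)
    then show ?thesis using True by simp
  qed simp
  then show "AE x in lborel. norm (indicator {a..b} x *\<^sub>R f x) \<le> norm (indicator {a..b} x + (norm (f x))\<^sup>2)"
    by (simp add: indicator_def)
qed (use L2_fun_measurable[OF assms] in simp)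

text \<open>The set \<open>S\<close> contains arbitrarily long intervals, so it has infinite measure. It is a half-line in all applications.\<close>

lemma L2_fun_not_bounded_below:
  assumes f: "f \<in> L2_fun" and e: "e > 0" and S: "S \<in> sets borel" "\<And>x. x \<in> S \<Longrightarrow> e \<le> norm (f x)"
    and long: "\<And>n::nat. \<exists>a. {a..a + real n} \<subseteq> S"
  shows False
proof -
  have int: "integrable lborel (\<lambda>x. (norm (f x))\<^sup>2 / e\<^sup>2)" using f by (simp add: L2_fun_def)
  have "integrable lborel (indicat_real S)"
  proof (rule Bochner_Integration.integrable_bound[OF int])
    have "indicat_real S x \<le> (norm (f x))\<^sup>2 / e\<^sup>2" for x
      using S(2)[of x] e by (auto simp: indicator_def le_divide_eq intro!: power_mono)
    then show "AE x in lborel. norm (indicat_real S x) \<le> norm ((norm (f x))\<^sup>2 / e\<^sup>2)" by simp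
  qed (use S in simp)
  then have fin: "emeasure lborel S < \<infinity>" using S(1) by (simp add: integrable_indicator_iff)
  have "of_nat n \<le> emeasure lborel S" for n
  proof -
    obtain a where "{a..a + real n} \<subseteq> S" using long by blast
    then have "emeasure lborel {a..a + real n} \<le> emeasure lborel S" using S(1) by (intro emeasure_mono) auto
    then show ?thesis by (simp add: ennreal_of_nat_eq_real_of_nat)
  qed
  then have "emeasure lborel S = \<infinity>" using ennreal_Ex_less_of_nat[of "emeasure lborel S"] by (metis infinity_ennreal_def less_top not_le)
  then show False using fin by simp
qed

lemma ac_component:
  fixes v w :: "real \<Rightarrow> complex^'n"
  assumes "has_ac_derivative v w"
  shows "has_ac_derivative (\<lambda>x. v x $ i) (\<lambda>x. w x $ i)"
  unfolding has_ac_derivative_def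
proof (intro conjI allI impI)
  show "(\<lambda>x. w x $ i) \<in> borel_measurable borel"
    using assms by (auto simp: has_ac_derivative_def intro: vec_nth_measurable)
  fix a b :: real assume "a \<le> b"
  then have *: "integrable lborel (\<lambda>x. indicator {a..b} x *\<^sub>R w x)" "integral\<^sup>L lborel (\<lambda>x. indicator {a..b} x *\<^sub>R w x) = v b - v a"
    using assms by (auto simp: has_ac_derivative_def set_integrable_def set_lebesgue_integral_def)
  show "set_integrable lborel {a..b} (\<lambda>x. w x $ i)"
    using integrable_bounded_linear[OF bounded_linear_vec_nth *(1), of i] by (simp add: set_integrable_def)
  show "(LINT x:{a..b}|lborel. w x $ i) = v b $ i - v a $ i"
    using integral_bounded_linear[OF bounded_linear_vec_nth *(1), of i] *(2) by (simp add: set_lebesgue_integral_def)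
qed

lemma ac_componentwise:
  fixes v w :: "real \<Rightarrow> complex^'n"
  assumes c: "\<And>i. has_ac_derivative (\<lambda>x. v x $ i) (\<lambda>x. w x $ i)" and i: "\<And>a b. set_integrable lborel {a..b} w"
    and m: "w \<in> borel_measurable borel"
  shows "has_ac_derivative v w"
  unfolding has_ac_derivative_def
proof (intro conjI allI impI i m)
  fix a b :: real assume "a \<le> b"
  have "(LINT x:{a..b}|lborel. w x) $ i = (v b - v a) $ i" for i
    using integral_bounded_linear[OF bounded_linear_vec_nth i[of a b, unfolded set_integrable_def], of i] c[of i] \<open>a \<le> b\<close>
    by (simp add: set_lebesgue_integral_def has_ac_derivative_def)
  then show "(LINT x:{a..b}|lborel. w x) = v b - v a" by (simp add: vec_eq_iff)
qed

lemma H1_deriv_ac: "H1_deriv v w \<longleftrightarrow> v \<in> L2_fun \<and> w \<in> L2_fun \<and> has_ac_derivative v w"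
  unfolding H1_deriv_def has_ac_derivative_def by (auto simp: L2_fun_set_integrable L2_fun_measurable)

text \<open>The bilinear pairing, without conjugation: it is the one compatible with the non-conjugated transpose.\<close>

definition pairing :: "complex^'n \<Rightarrow> complex^'n \<Rightarrow> complex" where
  "pairing z v = (\<Sum>i\<in>UNIV. z $ i * v $ i)"

lemma pairing_linear:
  "pairing z (u + v) = pairing z u + pairing z v"
  "pairing z (u - v) = pairing z u - pairing z v"
  "pairing z (c *s v) = c * pairing z v"
  "pairing z (\<Sum>i\<in>I. f i) = (\<Sum>i\<in>I. pairing z (f i))"
  by (simp_all add: pairing_def sum.distrib sum_subtractf sum_distrib_left algebra_simps)
     (subst sum.swap, simp)

lemma norm_pairing: "cmod (pairing z v) \<le> real CARD('n) * (norm z * norm (v :: complex^'n))"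
proof -
  have "cmod (pairing z v) \<le> (\<Sum>i\<in>(UNIV :: 'n set). norm z * norm v)"
    unfolding pairing_def
    by (intro order_trans[OF norm_sum] sum_mono) (auto simp: norm_mult intro!: mult_mono Finite_Cartesian_Product.norm_nth_le)
  then show ?thesis by simp
qed

lemma pairing_measurable [measurable (raw)]:
  fixes z v :: "'a \<Rightarrow> complex^'n"
  assumes "z \<in> borel_measurable M" "v \<in> borel_measurable M"
  shows "(\<lambda>x. pairing (z x) (v x)) \<in> borel_measurable M"
  unfolding pairing_def using assms by (intro borel_measurable_sum borel_measurable_times) (auto intro: vec_nth_measurable)

lemma pairing_transpose: "pairing (transpose A *v z) v = pairing z (A *v v)"
  unfolding pairing_def matrix_vector_mult_def transpose_def
  by (simp add: sum_distrib_left sum_distrib_right mult_ac) (subst sum.swap, simp)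

text \<open>Along a solution \<open>z\<close> of the adjoint equation, the pairing with \<open>v\<close> satisfies \<open>(z \<sqdot> v)' = -(A\<^sup>T z) \<sqdot> v + z \<sqdot> (A v + g) = z \<sqdot> g\<close>. Both the
  obstruction to solvability and the uniqueness of solutions rest on this.\<close>

lemma (in floquet_system) pairing_ac:
  assumes z: "\<And>x. (z has_vector_derivative - (transpose (A x l) *v z x)) (at x)" and v: "first_order_op A l v g"
  shows "has_ac_derivative (\<lambda>x. pairing (z x) (v x)) (\<lambda>x. pairing (z x) (g x))"
proof -
  obtain w where g: "g \<in> L2_fun" and H: "H1_deriv v w" and ae: "AE x in lborel. g x = w x - A x l *v v x"
    using v by (auto simp: first_order_op_def)
  have ac: "has_ac_derivative v w" using H by (simp add: H1_deriv_ac)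
  let ?z' = "\<lambda>x. - (transpose (A x l) *v z x)"
  have cz: "continuous_on UNIV z" by (rule has_vector_derivative_continuous_on[OF z])
  have "continuous_on UNIV (\<lambda>x. transpose (A x l))"
    unfolding transpose_def using A_continuous_x[of UNIV l] by (intro continuous_intros)
  then have cz': "continuous_on UNIV ?z'"
    by (intro continuous_on_minus continuous_on_matrix_vector_mult cz)
  have "has_ac_derivative (\<lambda>x. z x $ i) (\<lambda>x. ?z' x $ i)" for i
    by (intro ac_C1 has_vector_derivative_nth z continuous_on_component cz')
  then have "has_ac_derivative (\<lambda>x. \<Sum>i\<in>UNIV. z x $ i * v x $ i) (\<lambda>x. \<Sum>i\<in>UNIV. ?z' x $ i * v x $ i + z x $ i * w x $ i)"
    by (intro ac_sum ac_mult ac_component[OF ac])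
  then have "has_ac_derivative (\<lambda>x. pairing (z x) (v x)) (\<lambda>x. \<Sum>i\<in>UNIV. ?z' x $ i * v x $ i + z x $ i * w x $ i)"
    by (simp only: pairing_def)
  moreover have "(\<lambda>x. pairing (z x) (g x)) \<in> borel_measurable borel"
    using L2_fun_measurable[OF g] borel_measurable_continuous_onI[OF cz] by simp
  moreover have "AE x in lborel. (\<Sum>i\<in>UNIV. ?z' x $ i * v x $ i + z x $ i * w x $ i) = pairing (z x) (g x)"
    using ae
  proof eventually_elim
    case (elim x)
    have "(\<Sum>i\<in>UNIV. ?z' x $ i * v x $ i + z x $ i * w x $ i) = pairing (z x) (w x) - pairing (transpose (A x l) *v z x) (v x)"
      by (simp add: pairing_def sum.distrib sum_subtractf sum_negf)
    then show ?case unfolding pairing_transpose elim pairing_linear .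
  qed
  ultimately show ?thesis by (rule ac_cong_AE)
qed

section \<open>Eigenvalues on the unit circle: the range has infinite codimension\<close>

lemma periodic_bounded:
  fixes f :: "real \<Rightarrow> 'a::real_normed_vector"
  assumes T: "T > 0" and per: "\<And>x. f (x + T) = f x" and cont: "continuous_on UNIV f"
  shows "\<exists>C. \<forall>x. norm (f x) \<le> C"
proof -
  have nat: "f (x + real n * T) = f x" for x n
  proof (induction n)
    case (Suc n)
    then show ?case using per[of "x + real n * T"] by (simp add: algebra_simps)
  qed simp
  have int: "f (x + of_int k * T) = f x" for x k
  proof (cases "k \<ge> 0")
    case True
    then show ?thesis using nat[of x "nat k"] by simp
  next
    case False
    then show ?thesis using nat[of "x + of_int k * T" "nat (- k)"] by (simp add: algebra_simps)
  qed
  have "bounded (f ` {0..T})"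
    using cont by (intro compact_imp_bounded compact_continuous_image) (auto intro: continuous_on_subset)
  then obtain C where C: "\<And>x. x \<in> {0..T} \<Longrightarrow> norm (f x) \<le> C" unfolding bounded_iff by blast
  have "norm (f x) \<le> C" for x
  proof -
    let ?y = "x + of_int (- \<lfloor>x / T\<rfloor>) * T"
    have "of_int \<lfloor>x / T\<rfloor> * T \<le> x" "x \<le> (of_int \<lfloor>x / T\<rfloor> + 1) * T"
      using T floor_divide_lower[OF T, of x] floor_divide_upper[OF T, of x] by auto
    then have "?y \<in> {0..T}" by (simp add: algebra_simps)
    from C[OF this] show ?thesis unfolding int .
  qed
  then show ?thesis by blast
qed

text \<open>Gaussian elimination: an equation with a nonzero coefficient is used to eliminate one unknown.\<close>

lemma homogeneous_system_nontrivial: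
  fixes c :: "'j \<Rightarrow> 'f \<Rightarrow> 'a::field"
  assumes "finite F" "finite J" "card F < card J"
  shows "\<exists>\<alpha>. (\<exists>j\<in>J. \<alpha> j \<noteq> 0) \<and> (\<forall>f\<in>F. (\<Sum>j\<in>J. \<alpha> j * c j f) = 0)"
  using assms
proof (induction F arbitrary: J c rule: finite_induct)
  case empty
  then obtain j where "j \<in> J" by (metis card.empty ex_in_conv not_less_zero)
  then show ?case by (intro exI[of _ "\<lambda>_. 1"]) auto
next
  case (insert g F)
  show ?case
  proof (cases "\<forall>j\<in>J. c j g = 0")
    case True
    have "card F < card J" using insert by simp
    from insert.IH[OF insert.prems(1) this, of c] show ?thesis using True by auto
  next
    case False
    then obtain k where k: "k \<in> J" "c k g \<noteq> 0" by blast
    define d where "d j f = c j f - c j g / c k g * c k f" for j f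
    have "card F < card (J - {k})" using insert k by simp
    from insert.IH[OF _ this, of d] insert.prems(1) obtain \<beta> where \<beta>: "\<exists>j\<in>J - {k}. \<beta> j \<noteq> 0"
      "\<And>f. f \<in> F \<Longrightarrow> (\<Sum>j\<in>J - {k}. \<beta> j * d j f) = 0" by auto
    define s where "s = (\<Sum>j\<in>J - {k}. \<beta> j * c j g) / c k g"
    define \<alpha> where "\<alpha> j = (if j = k then - s else \<beta> j)" for j
    have split: "(\<Sum>j\<in>J. \<alpha> j * c j f) = - s * c k f + (\<Sum>j\<in>J - {k}. \<beta> j * c j f)" for f
    proof -
      have "(\<Sum>j\<in>J. \<alpha> j * c j f) = \<alpha> k * c k f + (\<Sum>j\<in>J - {k}. \<alpha> j * c j f)"
        using insert.prems(1) k(1) by (rule sum.remove)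
      also have "(\<Sum>j\<in>J - {k}. \<alpha> j * c j f) = (\<Sum>j\<in>J - {k}. \<beta> j * c j f)"
        by (intro sum.cong) (auto simp: \<alpha>_def)
      finally show ?thesis by (simp add: \<alpha>_def)
    qed
    have "(\<Sum>j\<in>J. \<alpha> j * c j f) = 0" if "f \<in> F" for f
    proof -
      have "0 = (\<Sum>j\<in>J - {k}. \<beta> j * c j f - \<beta> j * c j g * (c k f / c k g))"
        using \<beta>(2)[OF that] by (simp add: d_def algebra_simps)
      also have "\<dots> = (\<Sum>j\<in>J - {k}. \<beta> j * c j f) - s * c k f"
        by (simp add: sum_subtractf sum_distrib_right sum_divide_distrib s_def)
      finally show ?thesis unfolding split by simp
    qed
    moreover have "(\<Sum>j\<in>J. \<alpha> j * c j g) = 0" unfolding split using k by (simp add: s_def)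
    moreover have "\<exists>j\<in>J. \<alpha> j \<noteq> 0" using \<beta>(1) by (auto simp: \<alpha>_def)
    ultimately show ?thesis by blast
  qed
qed

lemma nn_integral_even_le:
  fixes f :: "real \<Rightarrow> ennreal"
  assumes m: "f \<in> borel_measurable borel" and even: "\<And>x. f (- x) = f x"
  shows "(\<integral>\<^sup>+ x. f x \<partial>lborel) \<le> 2 * (\<integral>\<^sup>+ x\<in>{0..}. f x \<partial>lborel)"
proof -
  have "(\<integral>\<^sup>+ x. f x \<partial>lborel) \<le> (\<integral>\<^sup>+ x. f x * indicator {0..} x + f (- x) * indicator {0..} (- x) \<partial>lborel)"
    by (intro nn_integral_mono) (auto simp: even indicator_def)
  also have "\<dots> = (\<integral>\<^sup>+ x. f x * indicator {0..} x \<partial>lborel) + (\<integral>\<^sup>+ x. f (- x) * indicator {0..} (- x) \<partial>lborel)"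
    using m by (intro nn_integral_add) auto
  also have "(\<integral>\<^sup>+ x. f (- x) * indicator {0..} (- x) \<partial>lborel) = (\<integral>\<^sup>+ x. f x * indicator {0..} x \<partial>lborel)"
    using nn_integral_real_affine[of "\<lambda>x. f x * indicator {0..} x" "-1" 0] m by simp
  finally show ?thesis by (simp add: mult_2)
qed

lemma integrable_inverse_one_plus_square: "integrable lborel (\<lambda>x::real. 1 / (1 + x\<^sup>2))"
proof (rule integrableI_nonneg)
  have "(\<integral>\<^sup>+ x. ennreal (1 / (1 + x\<^sup>2)) \<partial>lborel) \<le> 2 * (\<integral>\<^sup>+ x\<in>{0..}. ennreal (1 / (1 + x\<^sup>2)) \<partial>lborel)"
    by (rule nn_integral_even_le) auto
  also have "(\<integral>\<^sup>+ x\<in>{0..}. ennreal (1 / (1 + x\<^sup>2)) \<partial>lborel) = ennreal (pi / 2 - arctan 0)"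
    by (rule nn_integral_FTC_atLeast)
       (auto intro!: derivative_eq_intros tendsto_arctan_at_top simp: field_simps add_nonneg_eq_0_iff)
  also have "2 * \<dots> < \<infinity>" by (simp add: ennreal_mult_less_top)
  finally show "(\<integral>\<^sup>+ x. ennreal (1 / (1 + x\<^sup>2)) \<partial>lborel) < \<infinity>" .
qed auto

text \<open>Slowly growing functions with square integrable derivative: for \<open>0 \<le> p \<le> 1\<close> the derivative is bounded by \<open>2 |x| / (1 + x\<^sup>2)\<close>, while the function is unbounded unless \<open>p = 0\<close>.\<close>

definition slow :: "real \<Rightarrow> real \<Rightarrow> real" where
  "slow p x = (1 + ln (1 + x\<^sup>2)) powr p"

definition slow_deriv :: "real \<Rightarrow> real \<Rightarrow> real" where
  "slow_deriv p x = p * (1 + ln (1 + x\<^sup>2)) powr (p - 1) * (2 * x / (1 + x\<^sup>2))"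

lemma slow_base: "1 + ln (1 + x\<^sup>2) \<ge> (1::real)"
  by simp

lemma slow_has_derivative: "(slow p has_real_derivative slow_deriv p x) (at x)"
proof -
  have 1: "1 + x\<^sup>2 > 0" by (smt (verit) zero_le_power2)
  have 2: "1 + ln (1 + x\<^sup>2) > 0" using slow_base[of x] by linarith
  have "((\<lambda>x. 1 + ln (1 + x\<^sup>2)) has_real_derivative 2 * x / (1 + x\<^sup>2)) (at x)"
    using 1 by (auto intro!: derivative_eq_intros simp: field_simps)
  from DERIV_powr[OF this 2 DERIV_const[of p]] 2 show ?thesis
    unfolding slow_def[abs_def] slow_deriv_def by (simp add: powr_diff field_simps)
qed

lemma slow_deriv_continuous: "continuous_on UNIV (slow_deriv p)"
proof -
  have 1: "1 + x\<^sup>2 \<noteq> 0" "1 + ln (1 + x\<^sup>2) \<noteq> 0" for x :: real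
    using slow_base[of x] zero_le_power2[of x] by linarith+
  show ?thesis unfolding slow_deriv_def[abs_def] using 1 by (intro continuous_intros) auto
qed

lemma slow_deriv_square_integrable:
  assumes "0 \<le> p" "p \<le> 1"
  shows "integrable lborel (\<lambda>x. (slow_deriv p x)\<^sup>2)"
proof (rule Bochner_Integration.integrable_bound)
  show "integrable lborel (\<lambda>x::real. 4 * (1 / (1 + x\<^sup>2)))"
    using integrable_inverse_one_plus_square by (rule integrable_mult_right)
  have "(slow_deriv p x)\<^sup>2 \<le> 4 * (1 / (1 + x\<^sup>2))" for x
  proof -
    have "(1 + ln (1 + x\<^sup>2)) powr (p - 1) \<le> (1 + ln (1 + x\<^sup>2)) powr 0"
      using assms slow_base[of x] by (intro powr_mono) auto
    then have "(1 + ln (1 + x\<^sup>2)) powr (p - 1) \<le> 1" using slow_base[of x] by simp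
    then have le1: "p * (1 + ln (1 + x\<^sup>2)) powr (p - 1) \<le> 1" using assms by (intro mult_le_one) auto
    have pos: "1 + x\<^sup>2 > 0" by (smt (verit) zero_le_power2)
    have "(slow_deriv p x)\<^sup>2 = (p * (1 + ln (1 + x\<^sup>2)) powr (p - 1))\<^sup>2 * (2 * x / (1 + x\<^sup>2))\<^sup>2"
      by (simp only: slow_deriv_def power_mult_distrib)
    also have "\<dots> \<le> 1 * (2 * x / (1 + x\<^sup>2))\<^sup>2"
      using le1 assms by (intro mult_right_mono power_le_one) auto
    also have "\<dots> = 4 * (x\<^sup>2 / (1 + x\<^sup>2)) * (1 / (1 + x\<^sup>2))"
      by (simp add: power_divide power_mult_distrib) (simp add: power2_eq_square)
    also have "\<dots> \<le> 4 * 1 * (1 / (1 + x\<^sup>2))"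
      using pos by (intro mult_right_mono mult_left_mono) auto
    finally show ?thesis by simp
  qed
  then show "AE x in lborel. norm ((slow_deriv p x)\<^sup>2) \<le> norm (4 * (1 / (1 + x\<^sup>2)))"
    by (intro AE_I2) (simp add: abs_of_nonneg)
  show "(\<lambda>x. (slow_deriv p x)\<^sup>2) \<in> borel_measurable lborel"
    using borel_measurable_continuous_onI[OF slow_deriv_continuous] by simp
qed

text \<open>The sum is a nonconstant polynomial in \<open>slow p x\<close>, which tends to infinity.\<close>

lemma slow_powers_unbounded:
  fixes \<alpha> :: "nat \<Rightarrow> complex"
  assumes p: "p > 0" and \<alpha>: "j \<le> N" "\<alpha> j \<noteq> 0"
  shows "\<exists>X. \<forall>x\<ge>X. 1 \<le> cmod (k + (\<Sum>j\<le>N. \<alpha> j * complex_of_real (slow (p * real (Suc j)) x)))"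
proof -
  define q where "q = (\<Sum>j\<le>N. monom (\<alpha> j) j)"
  have "coeff q j = \<alpha> j" using \<alpha>(1) by (simp add: q_def coeff_sum)
  then have "q \<noteq> 0" using \<alpha>(2) by auto
  then obtain r where r: "\<And>z. r \<le> cmod z \<Longrightarrow> 1 \<le> cmod (poly (pCons k q) z)"
    using poly_infinity[of q 1 k] by auto
  have "filterlim (slow p) at_top at_top" unfolding slow_def[abs_def] using p by real_asymp
  then obtain X where X: "\<And>x. x \<ge> X \<Longrightarrow> r \<le> slow p x"
    by (auto simp: filterlim_at_top eventually_at_top_linorder)
  have "1 \<le> cmod (k + (\<Sum>j\<le>N. \<alpha> j * complex_of_real (slow (p * real (Suc j)) x)))" if "x \<ge> X" for x
  proof -
    have "slow (p * real (Suc j)) x = slow p x ^ Suc j" for j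
    proof -
      have "1 + ln (1 + x\<^sup>2) \<noteq> 0" using slow_base[of x] by linarith
      then have "slow p x > 0" unfolding slow_def powr_gt_zero .
      then have "slow p x ^ Suc j = slow p x powr real (Suc j)" by (simp only: powr_realpow)
      then show ?thesis by (simp only: slow_def powr_powr)
    qed
    then have "poly (pCons k q) (complex_of_real (slow p x)) = k + (\<Sum>j\<le>N. \<alpha> j * complex_of_real (slow (p * real (Suc j)) x))"
      by (simp add: q_def poly_sum poly_monom sum_distrib_left mult_ac)
    moreover have "r \<le> cmod (complex_of_real (slow p x))" using X[OF that] by simp
    ultimately show ?thesis using r by metis
  qed
  then show ?thesis by blast
qed

context floquet_system
begin

text \<open>The rows of the inverse fundamental matrix solve the adjoint equation.\<close>

lemma adjoint_solution:
  obtains W where "\<And>x. V x l ** W x = mat 1" "\<And>x. W x ** V x l = mat 1"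
    "continuous_on UNIV W"
    "\<And>n x. ((\<lambda>x. transpose (W x) *v n) has_vector_derivative - (transpose (A x l) *v (transpose (W x) *v n))) (at x)"
proof -
  obtain W where W: "\<And>x. V x l ** W x = mat 1" "\<And>x. W x ** V x l = mat 1"
    "\<And>x. (W has_vector_derivative - (W x ** A x l)) (at x)"
    using inverse_fundamental_matrix[OF V_deriv det_V] by blast
  have "((\<lambda>x. transpose (W x) *v n) has_vector_derivative - (transpose (A x l) *v (transpose (W x) *v n))) (at x)" for n x
  proof -
    have "((\<lambda>x. transpose (W x) *v n) has_vector_derivative transpose (- (W x ** A x l)) *v n) (at x)"
      by (rule bounded_linear.has_vector_derivative[OF
            bounded_bilinear.bounded_linear_left[OF bounded_bilinear_matrix_vector_mult] has_vector_derivative_transpose[OF W(3)]])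
    also have "transpose (- (W x ** A x l)) *v n = - (transpose (W x ** A x l) *v n)"
      by (simp add: vec_eq_iff matrix_vector_mult_def transpose_def sum_negf)
    finally show ?thesis unfolding matrix_transpose_mul matrix_vector_mul_assoc .
  qed
  then show ?thesis using that W has_vector_derivative_continuous_on[OF W(3)] by blast
qed

text \<open>A left eigenvector of the monodromy matrix yields an adjoint solution with multiplier \<open>1/\<mu>\<close>.\<close>

lemma adjoint_floquet:
  assumes per: "\<And>x. A (x + T) l = A x l"
    and W: "\<And>x. V x l ** W x = mat 1" "\<And>x. W x ** V x l = mat 1"
    and n: "transpose (V T l) *v n = \<mu> *s n"
  shows "transpose (W x) *v n = \<mu> *s (transpose (W (x + T)) *v n)"
proof -
  have "V x l ** (V T l ** W (x + T)) = mat 1"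
    using W(1)[of "x + T"] V_add_period[OF per, of x] by (simp add: matrix_mul_assoc)
  then have "W x ** (V x l ** (V T l ** W (x + T))) = W x" by simp
  then have "V T l ** W (x + T) = W x" unfolding matrix_mul_assoc W(2) by simp
  then have "transpose (W x) *v n = transpose (W (x + T)) *v (transpose (V T l) *v n)"
    unfolding matrix_vector_mul_assoc matrix_transpose_mul[symmetric] by simp
  then show ?thesis unfolding n by (simp add: vector_scalar_commute)
qed

text \<open>For \<open>|\<mu>| = 1\<close> the adjoint Floquet solution \<open>z\<close> has periodic norm, so it is bounded above and below. The functions
  \<open>g\<^sub>j = h\<^sub>j z\<^sup>* / |z|\<^sup>2\<close> are square integrable and \<open>z \<sqdot> g\<^sub>j = h\<^sub>j\<close> is the derivative of a slowly growing function. If the range together with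
  \<open>N\<close> functions spanned \<open>L\<^sup>2\<close>, a nontrivial combination of \<open>g\<^sub>0, \<dots>, g\<^sub>N\<close> would lie in the range; the corresponding combination of
  slowly growing functions, up to a constant, would be \<open>z \<sqdot> u\<close> with \<open>u\<close> square integrable, although it is bounded away from zero near infinity.\<close>

lemma not_fredholm:
  assumes T: "T > 0" and per: "\<And>x. A (x + T) l = A x l"
    and \<mu>: "eigenvalue_of (V T l) \<mu>" "cmod \<mu> = 1"
  shows "\<not> fredholm_at A l"
proof
  assume "fredholm_at A l"
  then obtain F where F: "finite F" "F \<subseteq> L2_fun"
    and surj: "\<And>g. g \<in> L2_fun \<Longrightarrow> \<exists>c v. first_order_op A l v (\<lambda>x. g x - (\<Sum>f\<in>F. c f *s f x))"
    unfolding fredholm_at_def by blast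
  have "eigenvalue_of (transpose (V T l)) \<mu>" using \<mu>(1) by (simp add: eigenvalue_iff_root charpoly_transpose)
  then obtain n where n: "n \<noteq> 0" "transpose (V T l) *v n = \<mu> *s n" by (auto simp: eigenvalue_of_def)
  obtain W where W: "\<And>x. V x l ** W x = mat 1" "\<And>x. W x ** V x l = mat 1" "continuous_on UNIV W"
    "\<And>n x. ((\<lambda>x. transpose (W x) *v n) has_vector_derivative - (transpose (A x l) *v (transpose (W x) *v n))) (at x)"
    using adjoint_solution by blast
  define z where "z x = transpose (W x) *v n" for x
  have z: "(z has_vector_derivative - (transpose (A x l) *v z x)) (at x)" for x
    using W(4)[of n x] by (simp add: z_def[abs_def])
  have cz: "continuous_on UNIV z" by (rule has_vector_derivative_continuous_on[OF z])
  have "z x = \<mu> *s z (x + T)" for x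
    unfolding z_def by (rule adjoint_floquet[OF per W(1,2) n(2)])
  then have normz: "norm (z (x + T)) = norm (z x)" for x
    by (metis norm_vector_scalar_mult \<mu>(2) mult_1)
  have znz: "z x \<noteq> 0" for x
  proof
    assume "z x = 0"
    have "transpose (W x ** V x l) *v n = transpose (V x l) *v z x"
      unfolding z_def matrix_transpose_mul matrix_vector_mul_assoc ..
    also have "\<dots> = 0" unfolding \<open>z x = 0\<close> by (rule matrix_vector_mult_0_right)
    finally show False using n(1) W(2)[of x] by (simp add: transpose_mat)
  qed
  obtain C where C: "\<And>x. norm (z x) \<le> C"
    using periodic_bounded[of T "\<lambda>x. norm (z x)"] T normz cz by (auto intro: continuous_intros)
  have cinv: "continuous_on UNIV (\<lambda>x. 1 / norm (z x))"
    using cz znz by (intro continuous_on_divide continuous_on_const continuous_on_norm) auto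
  obtain C' where C': "\<And>x. 1 / norm (z x) \<le> C'"
    using periodic_bounded[of T "\<lambda>x. 1 / norm (z x)", OF T _ cinv] normz by auto
  define N where "N = card F"
  \<comment> \<open>The exponents \<open>p (j + 1)\<close> with \<open>j \<le> N\<close> do not exceed \<open>1\<close>, as square integrability of \<open>h\<^sub>j\<close> requires.\<close>
  define p where "p = 1 / real (Suc N)"
  have p: "p > 0" by (simp add: p_def)
  define h where "h j = slow_deriv (p * real (Suc j))" for j
  define g where "g j x = complex_of_real (h j x / (norm (z x))\<^sup>2) *s (\<chi> i. cnj (z x $ i))" for j x
  have pair_g: "pairing (z x) (g j x) = complex_of_real (h j x)" for j x
  proof -
    have "pairing (z x) (\<chi> i. cnj (z x $ i)) = complex_of_real ((norm (z x))\<^sup>2)"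
      by (simp add: pairing_def norm_vec_def L2_set_def sum_nonneg complex_norm_square[symmetric] del: of_real_power)
    then show ?thesis unfolding g_def pairing_linear using znz[of x] by simp
  qed
  have hm: "h j \<in> borel_measurable borel" for j
    unfolding h_def by (rule borel_measurable_continuous_onI[OF slow_deriv_continuous])
  have zm: "z \<in> borel_measurable borel" by (rule borel_measurable_continuous_onI[OF cz])
  have gL2: "g j \<in> L2_fun" if j: "j \<le> N" for j
  proof (rule L2_fun_dominated[of _ "\<lambda>x. complex_of_real (h j x) *s (axis 1 1 :: complex^4)" C'])
    have "continuous_on UNIV (\<lambda>x. (\<chi> i. cnj (z x $ i)) :: complex^4)" using cz by (intro continuous_intros)
    then have [measurable]: "(\<lambda>x. (\<chi> i. cnj (z x $ i)) :: complex^4) \<in> borel_measurable borel"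
      by (rule borel_measurable_continuous_onI)
    show "g j \<in> borel_measurable borel" unfolding g_def[abs_def] using hm zm by measurable
    have "real (Suc j) \<le> real (Suc N)" using j by simp
    then have "integrable lborel (\<lambda>x. (h j x)\<^sup>2)"
      unfolding h_def p_def by (intro slow_deriv_square_integrable) (auto simp: field_simps)
    then show "(\<lambda>x. complex_of_real (h j x) *s (axis 1 1 :: complex^4)) \<in> L2_fun"
      using hm by (simp add: L2_fun_def norm_vector_scalar_mult norm_axis_1)
    show "norm (g j x) \<le> C' * norm (complex_of_real (h j x) *s (axis 1 1 :: complex^4))" for x
    proof -
      have nz: "norm ((\<chi> i. cnj (z x $ i)) :: complex^4) = norm (z x)" by (simp add: norm_vec_def)
      have "norm (g j x) = \<bar>h j x / (norm (z x))\<^sup>2\<bar> * norm (z x)"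
        unfolding g_def norm_vector_scalar_mult norm_of_real nz ..
      also have "\<dots> = 1 / norm (z x) * \<bar>h j x\<bar>"
        using znz[of x] by (simp add: power2_eq_square abs_mult)
      also have "\<dots> \<le> C' * \<bar>h j x\<bar>" by (intro mult_right_mono C') simp
      finally show ?thesis by (simp add: norm_vector_scalar_mult norm_axis_1)
    qed
  qed
  define cv where "cv j = (SOME q. first_order_op A l (snd q) (\<lambda>x. g j x - (\<Sum>f\<in>F. fst q f *s f x)))" for j
  define c where "c j = fst (cv j)" for j
  define v where "v j = snd (cv j)" for j
  have cv: "first_order_op A l (v j) (\<lambda>x. g j x - (\<Sum>f\<in>F. c j f *s f x))" if j: "j \<le> N" for j
  proof -
    obtain c' v' where "first_order_op A l v' (\<lambda>x. g j x - (\<Sum>f\<in>F. c' f *s f x))"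
      using surj[OF gL2[OF j]] by blast
    then have "\<exists>q. first_order_op A l (snd q) (\<lambda>x. g j x - (\<Sum>f\<in>F. fst q f *s f x))"
      by (intro exI[of _ "(c', v')"]) simp
    from someI_ex[OF this] show ?thesis by (simp add: c_def v_def cv_def)
  qed
  obtain \<alpha> j0 where \<alpha>: "j0 \<le> N" "\<alpha> j0 \<noteq> 0" "\<And>f. f \<in> F \<Longrightarrow> (\<Sum>j\<le>N. \<alpha> j * c j f) = 0"
    using homogeneous_system_nontrivial[OF F(1), of "{..N}" c] by (auto simp: N_def)
  define u where "u x = (\<Sum>j\<le>N. \<alpha> j *s v j x)" for x
  have vL2: "v j \<in> L2_fun" if "j \<le> N" for j
    using cv[OF that] by (auto simp: first_order_op_def H1_deriv_def)
  have uL2: "u \<in> L2_fun" unfolding u_def[abs_def] using vL2 by (intro L2_fun_sum L2_fun_scale) auto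
  have "has_ac_derivative (\<lambda>x. \<Sum>j\<le>N. \<alpha> j * pairing (z x) (v j x))
      (\<lambda>x. \<Sum>j\<le>N. \<alpha> j * pairing (z x) (g j x - (\<Sum>f\<in>F. c j f *s f x)))"
    by (intro ac_sum ac_cmult pairing_ac[OF z cv]) simp
  also have "(\<lambda>x. \<Sum>j\<le>N. \<alpha> j * pairing (z x) (v j x)) = (\<lambda>x. pairing (z x) (u x))"
    by (simp add: u_def pairing_linear)
  also have "(\<lambda>x. \<Sum>j\<le>N. \<alpha> j * pairing (z x) (g j x - (\<Sum>f\<in>F. c j f *s f x)))
      = (\<lambda>x. \<Sum>j\<le>N. \<alpha> j * complex_of_real (h j x))"
  proof
    fix x
    have "(\<Sum>j\<le>N. \<alpha> j * (\<Sum>f\<in>F. c j f * pairing (z x) (f x)))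
       = (\<Sum>f\<in>F. (\<Sum>j\<le>N. \<alpha> j * c j f) * pairing (z x) (f x))"
      by (simp add: sum_distrib_left sum_distrib_right mult_ac) (subst sum.swap, simp)
    also have "\<dots> = 0" using \<alpha>(3) by simp
    finally show "(\<Sum>j\<le>N. \<alpha> j * pairing (z x) (g j x - (\<Sum>f\<in>F. c j f *s f x))) = (\<Sum>j\<le>N. \<alpha> j * complex_of_real (h j x))"
      by (simp add: pairing_linear pair_g right_diff_distrib sum_subtractf)
  qed
  finally have ac1: "has_ac_derivative (\<lambda>x. pairing (z x) (u x)) (\<lambda>x. \<Sum>j\<le>N. \<alpha> j * complex_of_real (h j x))" .
  have "has_ac_derivative (\<lambda>x. complex_of_real (slow (p * real (Suc j)) x)) (\<lambda>x. complex_of_real (h j x))" for j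
    unfolding h_def
    by (intro ac_C1 has_vector_derivative_of_real has_real_derivative_iff_has_vector_derivative[THEN iffD1]
        slow_has_derivative continuous_on_of_real slow_deriv_continuous)
  then have ac2: "has_ac_derivative (\<lambda>x. \<Sum>j\<le>N. \<alpha> j * complex_of_real (slow (p * real (Suc j)) x))
      (\<lambda>x. \<Sum>j\<le>N. \<alpha> j * complex_of_real (h j x))"
    by (intro ac_sum ac_cmult)
  define k where "k = pairing (z 0) (u 0) - (\<Sum>j\<le>N. \<alpha> j * complex_of_real (slow (p * real (Suc j)) 0))"
  have eq: "pairing (z x) (u x) = k + (\<Sum>j\<le>N. \<alpha> j * complex_of_real (slow (p * real (Suc j)) x))" for x
    using ac_same_derivative[OF ac1 ac2, of x] by (simp add: k_def algebra_simps)
  obtain X where X: "\<And>x. x \<ge> X \<Longrightarrow> 1 \<le> cmod (pairing (z x) (u x))"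
    using slow_powers_unbounded[of p j0 N \<alpha> k] p \<alpha>(1,2) unfolding eq by blast
  have C0: "C > 0" using C[of 0] znz[of 0] by (smt (verit) zero_less_norm_iff)
  show False
  proof (rule L2_fun_not_bounded_below[OF uL2, of "1 / (4 * C)" "{X..}"])
    show "1 / (4 * C) \<le> norm (u x)" if "x \<in> {X..}" for x
    proof -
      have "1 \<le> 4 * (norm (z x) * norm (u x))" using X[of x] norm_pairing[of "z x" "u x"] that by simp
      also have "\<dots> \<le> 4 * (C * norm (u x))" by (intro mult_left_mono mult_right_mono C) auto
      finally show ?thesis using C0 by (simp add: field_simps)
    qed
    show "\<exists>a. {a..a + real n} \<subseteq> {X..}" for n by (intro exI[of _ X]) auto
  qed (use C0 in auto)
qed

end

section \<open>No eigenvalue on the unit circle: the bounded inverse\<close>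

definition exp_average :: "real \<Rightarrow> (real \<Rightarrow> real) \<Rightarrow> real \<Rightarrow> ennreal" where
  "exp_average \<delta> f x = (\<integral>\<^sup>+ s. ennreal (exp (- \<delta> * \<bar>x - s\<bar>)) * ennreal (f s) \<partial>lborel)"

lemma nn_integral_exp_abs:
  assumes "\<delta> > 0"
  shows "(\<integral>\<^sup>+ t. ennreal (exp (- \<delta> * \<bar>t\<bar>)) \<partial>lborel) \<le> ennreal (2 / \<delta>)"
proof -
  have "(\<integral>\<^sup>+ t. ennreal (exp (- \<delta> * \<bar>t\<bar>)) \<partial>lborel) \<le> 2 * (\<integral>\<^sup>+ t\<in>{0..}. ennreal (exp (- \<delta> * \<bar>t\<bar>)) \<partial>lborel)"
    by (rule nn_integral_even_le) auto
  also have "(\<integral>\<^sup>+ t\<in>{0..}. ennreal (exp (- \<delta> * \<bar>t\<bar>)) \<partial>lborel) = (\<integral>\<^sup>+ t\<in>{0..}. ennreal (exp (- \<delta> * t)) \<partial>lborel)"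
    by (intro nn_integral_cong) (auto simp: indicator_def)
  also have "\<dots> = ennreal (0 - - exp (- \<delta> * 0) / \<delta>)"
  proof (rule nn_integral_FTC_atLeast)
    show "((\<lambda>t. - exp (- \<delta> * t) / \<delta>) has_real_derivative exp (- \<delta> * t)) (at t)" for t
      using assms by (auto intro!: derivative_eq_intros)
    show "((\<lambda>t. - exp (- \<delta> * t) / \<delta>) \<longlongrightarrow> 0) at_top" using assms by real_asymp
  qed auto
  also have "2 * ennreal (0 - - exp (- \<delta> * 0) / \<delta>) = ennreal (2 / \<delta>)"
    using assms by (simp add: ennreal_mult'[symmetric] flip: ennreal_numeral)
  finally show ?thesis .
qed

lemma nn_integral_exp_abs_shift:
  assumes "\<delta> > 0"
  shows "(\<integral>\<^sup>+ s. ennreal (exp (- \<delta> * \<bar>x - s\<bar>)) \<partial>lborel) \<le> ennreal (2 / \<delta>)"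
    and "(\<integral>\<^sup>+ s. ennreal (exp (- \<delta> * \<bar>s - x\<bar>)) \<partial>lborel) \<le> ennreal (2 / \<delta>)"
proof -
  have "(\<integral>\<^sup>+ t. ennreal (exp (- \<delta> * \<bar>t\<bar>)) \<partial>lborel) = (\<integral>\<^sup>+ s. ennreal (exp (- \<delta> * \<bar>x - s\<bar>)) \<partial>lborel)"
    using nn_integral_real_affine[of "\<lambda>t. ennreal (exp (- \<delta> * \<bar>t\<bar>))" "-1" x] by simp
  then show 1: "(\<integral>\<^sup>+ s. ennreal (exp (- \<delta> * \<bar>x - s\<bar>)) \<partial>lborel) \<le> ennreal (2 / \<delta>)"
    using nn_integral_exp_abs[OF assms] by simp
  then show "(\<integral>\<^sup>+ s. ennreal (exp (- \<delta> * \<bar>s - x\<bar>)) \<partial>lborel) \<le> ennreal (2 / \<delta>)"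
    by (simp add: abs_minus_commute)
qed

text \<open>Cauchy-Schwarz after splitting the kernel into two equal factors.\<close>

lemma exp_average_square_le:
  assumes \<delta>: "\<delta> > 0" and [measurable]: "f \<in> borel_measurable borel"
  shows "(exp_average \<delta> f x)\<^sup>2 \<le> ennreal (2 / \<delta>) * (\<integral>\<^sup>+ s. ennreal (exp (- \<delta> * \<bar>x - s\<bar>)) * (ennreal (f s))\<^sup>2 \<partial>lborel)"
proof -
  define \<kappa> where "\<kappa> s = ennreal (exp (- \<delta> / 2 * \<bar>x - s\<bar>))" for s
  have k2: "\<kappa> s * \<kappa> s = ennreal (exp (- \<delta> * \<bar>x - s\<bar>))" for s
    by (simp add: \<kappa>_def ennreal_mult'[symmetric] exp_add[symmetric])
  have [measurable]: "\<kappa> \<in> borel_measurable borel" unfolding \<kappa>_def[abs_def] by measurable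
  have "exp_average \<delta> f x = (\<integral>\<^sup>+ s. \<kappa> s * (\<kappa> s * ennreal (f s)) \<partial>lborel)"
    unfolding exp_average_def k2[symmetric] by (simp add: mult.assoc)
  then have "(exp_average \<delta> f x)\<^sup>2 \<le> (\<integral>\<^sup>+ s. (\<kappa> s)\<^sup>2 \<partial>lborel) * (\<integral>\<^sup>+ s. (\<kappa> s * ennreal (f s))\<^sup>2 \<partial>lborel)"
    using Cauchy_Schwarz_nn_integral[of \<kappa> lborel "\<lambda>s. \<kappa> s * ennreal (f s)"] by simp
  also have "(\<integral>\<^sup>+ s. (\<kappa> s)\<^sup>2 \<partial>lborel) \<le> ennreal (2 / \<delta>)"
    unfolding power2_eq_square k2 by (rule nn_integral_exp_abs_shift[OF \<delta>])
  also have "(\<integral>\<^sup>+ s. (\<kappa> s * ennreal (f s))\<^sup>2 \<partial>lborel) = (\<integral>\<^sup>+ s. ennreal (exp (- \<delta> * \<bar>x - s\<bar>)) * (ennreal (f s))\<^sup>2 \<partial>lborel)"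
  proof -
    have "(\<kappa> s * ennreal (f s))\<^sup>2 = (\<kappa> s * \<kappa> s) * (ennreal (f s))\<^sup>2" for s
      by (simp add: power2_eq_square mult_ac)
    then show ?thesis unfolding k2 by simp
  qed
  finally show ?thesis by (simp add: mult_right_mono)
qed

lemma exp_average_finite:
  assumes \<delta>: "\<delta> > 0" and f: "f \<in> borel_measurable borel" "(\<integral>\<^sup>+ s. (ennreal (f s))\<^sup>2 \<partial>lborel) < \<infinity>"
  shows "exp_average \<delta> f x < \<infinity>"
proof -
  have "(\<integral>\<^sup>+ s. ennreal (exp (- \<delta> * \<bar>x - s\<bar>)) * (ennreal (f s))\<^sup>2 \<partial>lborel) \<le> (\<integral>\<^sup>+ s. 1 * (ennreal (f s))\<^sup>2 \<partial>lborel)"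
    using \<delta> by (intro nn_integral_mono mult_right_mono) (auto simp: ennreal_le_1)
  then have le: "(\<integral>\<^sup>+ s. ennreal (exp (- \<delta> * \<bar>x - s\<bar>)) * (ennreal (f s))\<^sup>2 \<partial>lborel) \<le> (\<integral>\<^sup>+ s. (ennreal (f s))\<^sup>2 \<partial>lborel)"
    by simp
  have "(exp_average \<delta> f x)\<^sup>2 \<le> ennreal (2 / \<delta>) * (\<integral>\<^sup>+ s. (ennreal (f s))\<^sup>2 \<partial>lborel)"
    by (rule order_trans[OF exp_average_square_le[OF \<delta> f(1)] mult_left_mono[OF le]]) simp
  also have "\<dots> < \<infinity>" using f(2) by (simp add: ennreal_mult_less_top)
  finally show ?thesis by (auto simp: power2_eq_square ennreal_mult_less_top)
qed

lemma exp_average_measurable [measurable]: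
  assumes [measurable]: "f \<in> borel_measurable borel"
  shows "exp_average \<delta> f \<in> borel_measurable borel"
  unfolding exp_average_def[abs_def] by measurable

text \<open>Young's inequality for the convolution with an integrable kernel: integrate the pointwise estimate and exchange the integrals.\<close>

lemma exp_average_L2:
  assumes \<delta>: "\<delta> > 0" and [measurable]: "f \<in> borel_measurable borel"
  shows "(\<integral>\<^sup>+ x. (exp_average \<delta> f x)\<^sup>2 \<partial>lborel) \<le> (ennreal (2 / \<delta>))\<^sup>2 * (\<integral>\<^sup>+ s. (ennreal (f s))\<^sup>2 \<partial>lborel)"
proof -
  have "(\<integral>\<^sup>+ x. (exp_average \<delta> f x)\<^sup>2 \<partial>lborel)
      \<le> (\<integral>\<^sup>+ x. ennreal (2 / \<delta>) * (\<integral>\<^sup>+ s. ennreal (exp (- \<delta> * \<bar>x - s\<bar>)) * (ennreal (f s))\<^sup>2 \<partial>lborel) \<partial>lborel)"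
    by (intro nn_integral_mono exp_average_square_le \<delta>) auto
  also have "\<dots> = ennreal (2 / \<delta>) * (\<integral>\<^sup>+ x. (\<integral>\<^sup>+ s. ennreal (exp (- \<delta> * \<bar>x - s\<bar>)) * (ennreal (f s))\<^sup>2 \<partial>lborel) \<partial>lborel)"
    by (intro nn_integral_cmult) measurable
  also have "(\<integral>\<^sup>+ x. (\<integral>\<^sup>+ s. ennreal (exp (- \<delta> * \<bar>x - s\<bar>)) * (ennreal (f s))\<^sup>2 \<partial>lborel) \<partial>lborel)
      = (\<integral>\<^sup>+ s. (\<integral>\<^sup>+ x. ennreal (exp (- \<delta> * \<bar>x - s\<bar>)) * (ennreal (f s))\<^sup>2 \<partial>lborel) \<partial>lborel)"
    by (rule lborel_pair.Fubini'[symmetric]) measurable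
  also have "\<dots> = (\<integral>\<^sup>+ s. (\<integral>\<^sup>+ x. ennreal (exp (- \<delta> * \<bar>x - s\<bar>)) \<partial>lborel) * (ennreal (f s))\<^sup>2 \<partial>lborel)"
    by (intro nn_integral_cong nn_integral_multc) measurable
  also have "\<dots> \<le> (\<integral>\<^sup>+ s. ennreal (2 / \<delta>) * (ennreal (f s))\<^sup>2 \<partial>lborel)"
    by (intro nn_integral_mono mult_right_mono nn_integral_exp_abs_shift \<delta>) auto
  also have "\<dots> = ennreal (2 / \<delta>) * (\<integral>\<^sup>+ s. (ennreal (f s))\<^sup>2 \<partial>lborel)"
    by (intro nn_integral_cmult) measurable
  finally show ?thesis by (simp add: power2_eq_square mult.assoc mult_left_mono)
qed

lemma exp_average_antimono:
  assumes "\<delta> \<le> \<epsilon>"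
  shows "exp_average \<epsilon> f x \<le> exp_average \<delta> f x"
  unfolding exp_average_def using assms
  by (intro nn_integral_mono mult_right_mono) (auto intro!: ennreal_leI mult_right_mono)

text \<open>The constant of integration is fixed at \<open>-\<infinity>\<close> for \<open>\<rho> < 0\<close> and at \<open>+\<infinity>\<close> for \<open>\<rho> > 0\<close>. For \<open>s\<close> on the side of \<open>x\<close> over which one integrates,
  \<open>exp(-\<rho> s)\<close> equals \<open>exp(-\<rho> x)\<close> times the decaying kernel \<open>exp(-|\<rho>| |x - s|)\<close>.\<close>

lemma decaying_primitive:
  fixes h :: "real \<Rightarrow> complex"
  assumes [measurable]: "h \<in> borel_measurable borel" "f \<in> borel_measurable borel"
    and f: "\<And>s. f s \<ge> 0" "(\<integral>\<^sup>+ s. (ennreal (f s))\<^sup>2 \<partial>lborel) < \<infinity>"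
    and h: "\<And>s. cmod (h s) \<le> K * exp (- \<rho> * s) * f s" and K: "K \<ge> 0" and \<rho>: "\<rho> \<noteq> 0"
  obtains c where "has_ac_derivative c h"
    "\<And>x. ennreal (cmod (c x)) \<le> ennreal (K * exp (- \<rho> * x)) * exp_average \<bar>\<rho>\<bar> f x"
proof -
  define S where "S x = (if \<rho> < 0 then {..x} else {x<..})" for x :: real
  define \<sigma> :: complex where "\<sigma> = (if \<rho> < 0 then 1 else - 1)"
  define c where "c x = \<sigma> * (LBINT s. indicator (S x) s *\<^sub>R h s)" for x
  have [measurable]: "S x \<in> sets borel" for x by (simp add: S_def)
  have bound: "(\<integral>\<^sup>+ s. ennreal (cmod (indicator (S x) s *\<^sub>R h s)) \<partial>lborel) \<le> ennreal (K * exp (- \<rho> * x)) * exp_average \<bar>\<rho>\<bar> f x" for x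
  proof -
    have "ennreal (cmod (indicator (S x) s *\<^sub>R h s))
        \<le> ennreal (K * exp (- \<rho> * x)) * (ennreal (exp (- \<bar>\<rho>\<bar> * \<bar>x - s\<bar>)) * ennreal (f s))" for s
    proof (cases "s \<in> S x")
      case True
      then have "- \<rho> * s = - \<rho> * x + - \<bar>\<rho>\<bar> * \<bar>x - s\<bar>"
        by (auto simp: S_def algebra_simps split: if_splits)
      then have "exp (- \<rho> * s) = exp (- \<rho> * x) * exp (- \<bar>\<rho>\<bar> * \<bar>x - s\<bar>)" by (simp only: exp_add)
      then have "cmod (h s) \<le> K * exp (- \<rho> * x) * (exp (- \<bar>\<rho>\<bar> * \<bar>x - s\<bar>) * f s)"
        using h[of s] by (simp only: mult.assoc)
      then show ?thesis using True f(1)[of s] K by (simp add: ennreal_mult'[symmetric] ennreal_leI)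
    qed simp
    then have "(\<integral>\<^sup>+ s. ennreal (cmod (indicator (S x) s *\<^sub>R h s)) \<partial>lborel)
        \<le> (\<integral>\<^sup>+ s. ennreal (K * exp (- \<rho> * x)) * (ennreal (exp (- \<bar>\<rho>\<bar> * \<bar>x - s\<bar>)) * ennreal (f s)) \<partial>lborel)"
      by (intro nn_integral_mono)
    also have "\<dots> = ennreal (K * exp (- \<rho> * x)) * exp_average \<bar>\<rho>\<bar> f x"
      unfolding exp_average_def by (intro nn_integral_cmult) measurable
    finally show ?thesis .
  qed
  have int: "integrable lborel (\<lambda>s. indicator (S x) s *\<^sub>R h s)" for x
  proof (rule integrableI_bounded)
    have "ennreal (K * exp (- \<rho> * x)) * exp_average \<bar>\<rho>\<bar> f x < \<infinity>"
      using exp_average_finite[of "\<bar>\<rho>\<bar>" f x] \<rho> f(2) by (simp add: ennreal_mult_less_top)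
    then show "(\<integral>\<^sup>+ s. ennreal (cmod (indicator (S x) s *\<^sub>R h s)) \<partial>lborel) < \<infinity>"
      using bound[of x] by (rule le_less_trans[rotated])
  qed measurable
  have "ennreal (cmod (c x)) \<le> ennreal (K * exp (- \<rho> * x)) * exp_average \<bar>\<rho>\<bar> f x" for x
  proof -
    have "cmod (c x) = cmod (LBINT s. indicator (S x) s *\<^sub>R h s)" by (simp add: c_def norm_mult \<sigma>_def)
    then show ?thesis using order_trans[OF integral_norm_bound_ennreal[OF int[of x]] bound[of x]] by simp
  qed
  moreover have "has_ac_derivative c h"
    unfolding has_ac_derivative_def
  proof (intro conjI allI impI)
    fix a b :: real assume ab: "a \<le> b"
    have eq: "AE s in lborel. \<sigma> * (indicator (S b) s *\<^sub>R h s - indicator (S a) s *\<^sub>R h s) = indicator {a..b} s *\<^sub>R h s"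
      using AE_lborel_singleton[of a] by eventually_elim (use ab in \<open>auto simp: S_def \<sigma>_def indicator_def\<close>)
    have i: "integrable lborel (\<lambda>s. \<sigma> * (indicator (S b) s *\<^sub>R h s - indicator (S a) s *\<^sub>R h s))"
      by (intro integrable_mult_right Bochner_Integration.integrable_diff int)
    show "set_integrable lborel {a..b} h"
      unfolding set_integrable_def by (rule integrable_cong_AE_imp[OF i _ eq]) measurable
    have "c b - c a = \<sigma> * ((LBINT s. indicator (S b) s *\<^sub>R h s) - (LBINT s. indicator (S a) s *\<^sub>R h s))"
      by (simp only: c_def right_diff_distrib)
    also have "\<dots> = (LBINT s. \<sigma> * (indicator (S b) s *\<^sub>R h s - indicator (S a) s *\<^sub>R h s))"
      by (simp only: integral_mult_right_zero Bochner_Integration.integral_diff[OF int int])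
    also have "\<dots> = (LBINT s. indicator {a..b} s *\<^sub>R h s)"
      by (rule integral_cong_AE[OF _ _ eq]) measurable
    finally show "(LINT x:{a..b}|lborel. h x) = c b - c a" by (simp add: set_lebesgue_integral_def)
  qed simp
  ultimately show ?thesis using that by blast
qed

text \<open>Divided by the exponential, the norm of a Floquet solution is periodic.\<close>

lemma floquet_exponential_bound:
  fixes \<phi> :: "real \<Rightarrow> complex^'n"
  assumes T: "T > 0" and \<mu>: "\<mu> \<noteq> 0" and per: "\<And>x. \<phi> (x + T) = \<mu> *s \<phi> x" and cont: "continuous_on UNIV \<phi>"
  shows "\<exists>K\<ge>0. \<forall>x. norm (\<phi> x) \<le> K * exp (ln (cmod \<mu>) / T * x)"
proof -
  let ?r = "ln (cmod \<mu>) / T"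
  have "norm (\<phi> (x + T)) * exp (- ?r * (x + T)) = norm (\<phi> x) * exp (- ?r * x)" for x
  proof -
    have "- ?r * (x + T) = - ?r * x + - ln (cmod \<mu>)" using T by (simp add: field_simps)
    then have "exp (- ?r * (x + T)) = exp (- ?r * x) * exp (- ln (cmod \<mu>))" by (simp only: exp_add)
    also have "exp (- ln (cmod \<mu>)) = 1 / cmod \<mu>" using \<mu> by (simp add: exp_minus inverse_eq_divide)
    finally show ?thesis using \<mu> by (simp add: per norm_vector_scalar_mult)
  qed
  moreover have "continuous_on UNIV (\<lambda>x. norm (\<phi> x) * exp (- ?r * x))"
    using cont by (intro continuous_intros)
  ultimately obtain K where K: "\<And>x. norm (norm (\<phi> x) * exp (- ?r * x)) \<le> K"
    using periodic_bounded[OF T, of "\<lambda>x. norm (\<phi> x) * exp (- ?r * x)"] by blast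
  have "norm (\<phi> x) \<le> \<bar>K\<bar> * exp (?r * x)" for x
  proof -
    have "norm (\<phi> x) * exp (- ?r * x) \<le> \<bar>K\<bar>" using K[of x] by simp
    then have "norm (\<phi> x) * exp (- ?r * x) * exp (?r * x) \<le> \<bar>K\<bar> * exp (?r * x)" by (intro mult_right_mono) auto
    then show ?thesis by (simp add: mult.assoc exp_add[symmetric])
  qed
  then show ?thesis by (intro exI[of _ "\<bar>K\<bar>"]) auto
qed

lemma L2_norm_nn_integral:
  assumes "f \<in> L2_fun"
  shows "(\<integral>\<^sup>+ x. (ennreal (norm (f x)))\<^sup>2 \<partial>lborel) = ennreal ((L2_norm f)\<^sup>2)"
proof -
  have "(\<integral>\<^sup>+ x. (ennreal (norm (f x)))\<^sup>2 \<partial>lborel) = (\<integral>\<^sup>+ x. ennreal ((norm (f x))\<^sup>2) \<partial>lborel)"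
    by (simp add: ennreal_power)
  also have "\<dots> = ennreal (LINT x|lborel. (norm (f x))\<^sup>2)"
    using assms by (intro nn_integral_eq_integral) (auto simp: L2_fun_def)
  also have "(LINT x|lborel. (norm (f x))\<^sup>2) = (L2_norm f)\<^sup>2"
    unfolding L2_norm_def by (simp add: integral_nonneg_AE)
  finally show ?thesis .
qed

lemma L2_norm_nonneg: "L2_norm f \<ge> 0"
  unfolding L2_norm_def by (simp add: integral_nonneg_AE)

lemma L2_fun_exp_average_dominated:
  assumes g: "g \<in> L2_fun" and \<delta>: "\<delta> > 0" and K: "K \<ge> 0"
    and v: "v \<in> borel_measurable borel" "\<And>x. ennreal (norm (v x)) \<le> ennreal K * exp_average \<delta> (\<lambda>s. norm (g s)) x"
  shows "v \<in> L2_fun" "L2_norm v \<le> K * (2 / \<delta>) * L2_norm g"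
proof -
  have gm: "(\<lambda>s. norm (g s)) \<in> borel_measurable borel" using L2_fun_measurable[OF g] by simp
  have "(\<integral>\<^sup>+ x. (ennreal (norm (v x)))\<^sup>2 \<partial>lborel) \<le> (\<integral>\<^sup>+ x. (ennreal K)\<^sup>2 * (exp_average \<delta> (\<lambda>s. norm (g s)) x)\<^sup>2 \<partial>lborel)"
    unfolding power_mult_distrib[symmetric] by (intro nn_integral_mono power_mono v(2)) auto
  also have "\<dots> = (ennreal K)\<^sup>2 * (\<integral>\<^sup>+ x. (exp_average \<delta> (\<lambda>s. norm (g s)) x)\<^sup>2 \<partial>lborel)"
    using exp_average_measurable[OF gm] by (intro nn_integral_cmult) simp
  also have "\<dots> \<le> (ennreal K)\<^sup>2 * ((ennreal (2 / \<delta>))\<^sup>2 * (\<integral>\<^sup>+ s. (ennreal (norm (g s)))\<^sup>2 \<partial>lborel))"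
    by (intro mult_left_mono exp_average_L2 \<delta> gm) simp
  also have "\<dots> = ennreal ((K * (2 / \<delta>) * L2_norm g)\<^sup>2)"
  proof -
    have "(ennreal K)\<^sup>2 = ennreal (K\<^sup>2)" "(ennreal (2 / \<delta>))\<^sup>2 = ennreal ((2 / \<delta>)\<^sup>2)"
      using K \<delta> by (simp_all add: ennreal_power)
    then show ?thesis
      unfolding L2_norm_nn_integral[OF g]
      by (simp only: ennreal_mult'[OF zero_le_power2, symmetric] power_mult_distrib mult.assoc)
  qed
  finally have le: "(\<integral>\<^sup>+ x. (ennreal (norm (v x)))\<^sup>2 \<partial>lborel) \<le> ennreal ((K * (2 / \<delta>) * L2_norm g)\<^sup>2)" .
  show vL2: "v \<in> L2_fun"
    unfolding L2_fun_def
  proof (intro CollectI conjI)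
    show "integrable lborel (\<lambda>x. (norm (v x))\<^sup>2)"
    proof (rule integrableI_nonneg)
      have "(\<integral>\<^sup>+ x. ennreal ((norm (v x))\<^sup>2) \<partial>lborel) = (\<integral>\<^sup>+ x. (ennreal (norm (v x)))\<^sup>2 \<partial>lborel)"
        by (simp add: ennreal_power)
      also have "\<dots> < \<infinity>" using le by (rule le_less_trans) simp
      finally show "(\<integral>\<^sup>+ x. ennreal ((norm (v x))\<^sup>2) \<partial>lborel) < \<infinity>" .
    qed (use v(1) in auto)
  qed (use v(1) in simp)
  have "(L2_norm v)\<^sup>2 \<le> (K * (2 / \<delta>) * L2_norm g)\<^sup>2"
    using le unfolding L2_norm_nn_integral[OF vL2] by (subst (asm) ennreal_le_iff) auto
  then show "L2_norm v \<le> K * (2 / \<delta>) * L2_norm g"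
    by (rule power2_le_imp_le) (use K \<delta> L2_norm_nonneg[of g] in simp)
qed

context floquet_system
begin

lemma A_bounded:
  assumes T: "T > 0" and per: "\<And>x. A (x + T) l = A x l"
  obtains C where "C \<ge> 0" "\<And>x v. norm (A x l *v v) \<le> C * norm v"
proof -
  obtain a where a: "\<And>x. norm (A x l) \<le> a"
    using periodic_bounded[OF T, of "\<lambda>x. A x l"] per A_continuous_x by blast
  obtain K where K: "K > 0" "\<And>(P :: complex^4^4) (v :: complex^4). norm (P *v v) \<le> norm P * norm v * K"
    using bounded_bilinear.pos_bounded[OF bounded_bilinear_matrix_vector_mult] by blast
  have a0: "a \<ge> 0" using a[of 0] norm_ge_zero order_trans by blast
  have "norm (A x l *v v) \<le> (a * K) * norm v" for x v
  proof -
    have "norm (A x l) * norm v * K \<le> a * norm v * K"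
      using K(1) by (intro mult_right_mono a) auto
    then show ?thesis using K(2)[of "A x l" v] by (simp add: mult_ac)
  qed
  then show ?thesis using that[of "a * K"] a0 K(1) by simp
qed

text \<open>Let \<open>\<phi>\<^sub>j\<close> be the Floquet solutions with multipliers \<open>m\<^sub>j\<close> and \<open>z\<^sub>j\<close> the dual adjoint solutions, so that \<open>\<Sum>\<^sub>j (z\<^sub>j \<sqdot> u) \<phi>\<^sub>j = u\<close> at
  every point. The solution is \<open>v = \<Sum>\<^sub>j c\<^sub>j \<phi>\<^sub>j\<close>, where \<open>c\<^sub>j\<close> is the primitive of \<open>z\<^sub>j \<sqdot> g\<close> that is taken from the decaying side: the growth of \<open>\<phi>\<^sub>j\<close>
  and the factor \<open>exp(-\<rho>\<^sub>j x)\<close> in the bound for \<open>c\<^sub>j\<close> cancel. If \<open>d\<close> is the difference of two solutions, then each \<open>z\<^sub>j \<sqdot> d\<close> is constant; it vanishes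
  because \<open>z\<^sub>j\<close> is bounded on a half-line and \<open>d\<close> is square integrable.\<close>

lemma bounded_inverse:
  assumes T: "T > 0" and per: "\<And>x. A (x + T) l = A x l"
    and distinct: "card {\<mu>. eigenvalue_of (V T l) \<mu>} = 4"
    and hyperbolic: "\<And>\<mu>. eigenvalue_of (V T l) \<mu> \<Longrightarrow> cmod \<mu> \<noteq> 1"
  shows "l \<notin> L2_spectrum A"
proof -
  obtain m Q R where m: "\<And>j::4. eigenvalue_of (V T l) (m j)" and QR: "Q ** R = mat 1"
    and Q: "\<And>j. V T l *v column j Q = m j *s column j Q"
    and R: "\<And>j. transpose (V T l) *v row j R = m j *s row j R"
    using diagonalization[OF distinct] by metis
  obtain W where W: "\<And>x. V x l ** W x = mat 1" "\<And>x. W x ** V x l = mat 1" "continuous_on UNIV W"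
    "\<And>n x. ((\<lambda>x. transpose (W x) *v n) has_vector_derivative - (transpose (A x l) *v (transpose (W x) *v n))) (at x)"
    using adjoint_solution by blast
  have m0: "m j \<noteq> 0" for j
  proof
    assume "m j = 0"
    then have "poly (charpoly (V T l)) 0 = 0" using m[of j] by (simp add: eigenvalue_iff_root)
    then show False by (simp add: charpoly_eq det_V)
  qed
  define \<phi> where "\<phi> j x = V x l *v column j Q" for j x
  define z where "z j x = transpose (W x) *v row j R" for j x
  define \<rho> where "\<rho> j = ln (cmod (m j)) / T" for j
  have \<rho>: "\<rho> j \<noteq> 0" for j using hyperbolic[OF m[of j]] m0[of j] T by (simp add: \<rho>_def)
  have \<phi>': "(\<phi> j has_vector_derivative A x l *v \<phi> j x) (at x)" for j x
  proof -
    have "(\<phi> j has_vector_derivative (A x l ** V x l) *v column j Q) (at x)"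
      unfolding \<phi>_def[abs_def]
      by (rule bounded_linear.has_vector_derivative[OF
            bounded_bilinear.bounded_linear_left[OF bounded_bilinear_matrix_vector_mult] V_deriv])
    then show ?thesis unfolding \<phi>_def matrix_vector_mul_assoc .
  qed
  have c\<phi>: "continuous_on UNIV (\<phi> j)" for j by (rule has_vector_derivative_continuous_on[OF \<phi>'])
  have z': "(z j has_vector_derivative - (transpose (A x l) *v z j x)) (at x)" for j x
    using W(4)[of "row j R" x] unfolding z_def[abs_def] .
  have cz: "continuous_on UNIV (z j)" for j by (rule has_vector_derivative_continuous_on[OF z'])
  have "\<phi> j (x + T) = m j *s \<phi> j x" for j x
    unfolding \<phi>_def V_add_period[OF per] matrix_vector_mul_assoc[symmetric] Q by (simp add: vector_scalar_commute)
  then have "\<exists>K\<ge>0. \<forall>x. norm (\<phi> j x) \<le> K * exp (\<rho> j * x)" for j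
    unfolding \<rho>_def by (intro floquet_exponential_bound[OF T m0 _ c\<phi>])
  then obtain K1 where K1: "\<And>j. K1 j \<ge> 0" "\<And>j x. norm (\<phi> j x) \<le> K1 j * exp (\<rho> j * x)" by metis
  have zper: "z j (x + T) = (1 / m j) *s z j x" for j x
  proof -
    have "z j x = m j *s z j (x + T)" unfolding z_def by (rule adjoint_floquet[OF per W(1,2) R])
    then show ?thesis using m0[of j] by simp
  qed
  have "\<exists>K\<ge>0. \<forall>x. norm (z j x) \<le> K * exp (- \<rho> j * x)" for j
  proof -
    have "ln (cmod (1 / m j)) / T = - \<rho> j" using m0[of j] by (simp add: \<rho>_def norm_divide ln_div)
    then show ?thesis using floquet_exponential_bound[OF T _ zper cz, of j] m0[of j] by simp
  qed
  then obtain K2 where K2: "\<And>j. K2 j \<ge> 0" "\<And>j x. norm (z j x) \<le> K2 j * exp (- \<rho> j * x)" by metis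
  have resolution: "(\<Sum>j\<in>UNIV. pairing (z j x) u *s \<phi> j x) = u" for x u
  proof -
    have "pairing (z j x) u = (R *v (W x *v u)) $ j" for j
      unfolding z_def pairing_transpose by (simp add: pairing_def row_def matrix_vector_mult_def)
    then have "(\<Sum>j\<in>UNIV. pairing (z j x) u *s \<phi> j x) = (\<Sum>j\<in>UNIV. (R *v (W x *v u)) $ j *s (V x l *v column j Q))"
      by (simp add: \<phi>_def)
    also have "\<dots> = V x l *v (\<Sum>j\<in>UNIV. (R *v (W x *v u)) $ j *s column j Q)"
      by (simp only: matrix_vector_mult_lincomb)
    also have "(\<Sum>j\<in>UNIV. (R *v (W x *v u)) $ j *s column j Q) = Q *v (R *v (W x *v u))"
      by (simp add: matrix_mult_sum)
    also have "V x l *v (Q *v (R *v (W x *v u))) = (V x l ** (Q ** R) ** W x) *v u"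
      by (simp only: matrix_vector_mul_assoc matrix_mul_assoc)
    also have "\<dots> = u" unfolding QR by (simp add: W(1))
    finally show ?thesis .
  qed
  \<comment> \<open>the slowest of the four decay rates\<close>
  define \<delta> where "\<delta> = Min (range (\<lambda>j. \<bar>\<rho> j\<bar>))"
  have \<delta>: "\<delta> > 0" "\<And>j. \<delta> \<le> \<bar>\<rho> j\<bar>" using \<rho> by (auto simp: \<delta>_def)
  define Kt where "Kt = (\<Sum>j\<in>UNIV. 4 * K2 j * K1 j)"
  have Kt: "Kt \<ge> 0" unfolding Kt_def using K1(1) K2(1) by (intro sum_nonneg) simp
  obtain CA where CA: "CA \<ge> 0" "\<And>x v. norm (A x l *v v) \<le> CA * norm v" using A_bounded[OF T per] by blast
  have solve: "\<exists>v. first_order_op A l v g \<and> L2_norm v \<le> Kt * (2 / \<delta>) * L2_norm g" if g: "g \<in> L2_fun" for g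
  proof -
    have gm: "g \<in> borel_measurable borel" by (rule L2_fun_measurable[OF g])
    have fin: "(\<integral>\<^sup>+ s. (ennreal (norm (g s)))\<^sup>2 \<partial>lborel) < \<infinity>" unfolding L2_norm_nn_integral[OF g] by simp
    define h where "h j x = pairing (z j x) (g x)" for j x
    have hm: "h j \<in> borel_measurable borel" for j
      unfolding h_def[abs_def] using borel_measurable_continuous_onI[OF cz] gm by simp
    have hb: "cmod (h j s) \<le> (4 * K2 j) * exp (- \<rho> j * s) * norm (g s)" for j s
    proof -
      have "cmod (h j s) \<le> 4 * (norm (z j s) * norm (g s))" using norm_pairing[of "z j s" "g s"] by (simp add: h_def)
      also have "\<dots> \<le> 4 * ((K2 j * exp (- \<rho> j * s)) * norm (g s))" by (intro mult_left_mono mult_right_mono K2) auto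
      finally show ?thesis by (simp add: mult_ac)
    qed
    have "\<exists>c. has_ac_derivative c (h j) \<and>
        (\<forall>x. ennreal (cmod (c x)) \<le> ennreal (4 * K2 j * exp (- \<rho> j * x)) * exp_average \<bar>\<rho> j\<bar> (\<lambda>s. norm (g s)) x)" for j
    proof -
      have "4 * K2 j \<ge> 0" using K2(1)[of j] by simp
      moreover have "(\<lambda>s. norm (g s)) \<in> borel_measurable borel" using gm by simp
      ultimately obtain c where "has_ac_derivative c (h j)"
        "\<And>x. ennreal (cmod (c x)) \<le> ennreal (4 * K2 j * exp (- \<rho> j * x)) * exp_average \<bar>\<rho> j\<bar> (\<lambda>s. norm (g s)) x"
        using decaying_primitive[OF hm[of j] _ norm_ge_zero fin hb[of j] _ \<rho>[of j]] by blast
      then show ?thesis by blast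
    qed
    then have "\<exists>c. \<forall>j. has_ac_derivative (c j) (h j) \<and>
        (\<forall>x. ennreal (cmod (c j x)) \<le> ennreal (4 * K2 j * exp (- \<rho> j * x)) * exp_average \<bar>\<rho> j\<bar> (\<lambda>s. norm (g s)) x)"
      by (intro choice allI)
    then obtain c where c: "\<And>j. has_ac_derivative (c j) (h j)"
      and cb: "\<And>j x. ennreal (cmod (c j x)) \<le> ennreal (4 * K2 j * exp (- \<rho> j * x)) * exp_average \<bar>\<rho> j\<bar> (\<lambda>s. norm (g s)) x"
      by blast
    define v where "v x = (\<Sum>j\<in>UNIV. c j x *s \<phi> j x)" for x
    have vm: "v \<in> borel_measurable borel"
      unfolding v_def[abs_def]
      using borel_measurable_continuous_onI[OF ac_continuous[OF c]] borel_measurable_continuous_onI[OF c\<phi>]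
      by (intro borel_measurable_sum vector_scalar_mult_measurable)
    have vb: "ennreal (norm (v x)) \<le> ennreal Kt * exp_average \<delta> (\<lambda>s. norm (g s)) x" for x
    proof -
      have one: "ennreal (norm (c j x *s \<phi> j x)) \<le> ennreal (4 * K2 j * K1 j) * exp_average \<delta> (\<lambda>s. norm (g s)) x" for j
      proof -
        have "ennreal (norm (c j x *s \<phi> j x)) = ennreal (cmod (c j x)) * ennreal (norm (\<phi> j x))"
          by (simp add: norm_vector_scalar_mult ennreal_mult')
        also have "\<dots> \<le> (ennreal (4 * K2 j * exp (- \<rho> j * x)) * exp_average \<bar>\<rho> j\<bar> (\<lambda>s. norm (g s)) x) * ennreal (K1 j * exp (\<rho> j * x))"
          using K1(2)[of j x] by (intro mult_mono cb ennreal_leI) auto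
        also have "\<dots> = (ennreal (4 * K2 j * exp (- \<rho> j * x)) * ennreal (K1 j * exp (\<rho> j * x))) * exp_average \<bar>\<rho> j\<bar> (\<lambda>s. norm (g s)) x"
          by (simp only: mult_ac)
        also have "ennreal (4 * K2 j * exp (- \<rho> j * x)) * ennreal (K1 j * exp (\<rho> j * x)) = ennreal (4 * K2 j * K1 j)"
        proof -
          have "(4 * K2 j * exp (- \<rho> j * x)) * (K1 j * exp (\<rho> j * x)) = 4 * K2 j * K1 j * (exp (- \<rho> j * x) * exp (\<rho> j * x))"
            by (simp only: mult_ac)
          also have "exp (- \<rho> j * x) * exp (\<rho> j * x) = 1" by (simp add: exp_add[symmetric])
          finally show ?thesis using K1(1)[of j] K2(1)[of j] by (simp add: ennreal_mult'[symmetric])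
        qed
        also have "ennreal (4 * K2 j * K1 j) * exp_average \<bar>\<rho> j\<bar> (\<lambda>s. norm (g s)) x
            \<le> ennreal (4 * K2 j * K1 j) * exp_average \<delta> (\<lambda>s. norm (g s)) x"
          by (intro mult_left_mono exp_average_antimono \<delta>(2)) simp
        finally show ?thesis .
      qed
      have "ennreal (norm (v x)) \<le> ennreal (\<Sum>j\<in>UNIV. norm (c j x *s \<phi> j x))"
        unfolding v_def by (intro ennreal_leI norm_sum)
      also have "\<dots> = (\<Sum>j\<in>UNIV. ennreal (norm (c j x *s \<phi> j x)))" by (simp add: sum_ennreal)
      also have "\<dots> \<le> (\<Sum>j\<in>UNIV. ennreal (4 * K2 j * K1 j) * exp_average \<delta> (\<lambda>s. norm (g s)) x)"
        by (intro sum_mono one)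
      also have "\<dots> = (\<Sum>j\<in>UNIV. ennreal (4 * K2 j * K1 j)) * exp_average \<delta> (\<lambda>s. norm (g s)) x"
        by (simp only: sum_distrib_right)
      also have "(\<Sum>j\<in>UNIV. ennreal (4 * K2 j * K1 j)) = ennreal Kt"
        unfolding Kt_def using K1(1) K2(1) by (intro sum_ennreal) simp
      finally show ?thesis .
    qed
    have vL2: "v \<in> L2_fun" and vnorm: "L2_norm v \<le> Kt * (2 / \<delta>) * L2_norm g"
      using L2_fun_exp_average_dominated[OF g \<delta>(1) Kt vm vb] by auto
    define w where "w x = A x l *v v x + g x" for x
    have Am: "(\<lambda>x. A x l *v v x) \<in> borel_measurable borel"
    proof -
      have "(\<lambda>x. A x l *v v x) = (\<lambda>x. \<Sum>j\<in>UNIV. c j x *s (A x l *v \<phi> j x))"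
        unfolding v_def matrix_vector_mult_lincomb ..
      moreover have "continuous_on UNIV (\<lambda>x. A x l *v \<phi> j x)" for j
        by (intro continuous_on_matrix_vector_mult A_continuous_x c\<phi>)
      ultimately show ?thesis
        using borel_measurable_continuous_onI[OF ac_continuous[OF c]] borel_measurable_continuous_onI
        by (auto intro!: borel_measurable_sum vector_scalar_mult_measurable)
    qed
    have wL2: "w \<in> L2_fun"
      unfolding w_def[abs_def] by (intro L2_fun_add g L2_fun_dominated[OF Am vL2 CA(2)])
    have "has_ac_derivative (\<lambda>x. v x $ i) (\<lambda>x. w x $ i)" for i
    proof -
      have "has_ac_derivative (\<lambda>x. \<phi> j x $ i) (\<lambda>x. (A x l *v \<phi> j x) $ i)" for j
        by (intro ac_C1 has_vector_derivative_nth \<phi>' continuous_on_component continuous_on_matrix_vector_mult A_continuous_x c\<phi>)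
      then have "has_ac_derivative (\<lambda>x. \<Sum>j\<in>UNIV. c j x * \<phi> j x $ i) (\<lambda>x. \<Sum>j\<in>UNIV. h j x * \<phi> j x $ i + c j x * (A x l *v \<phi> j x) $ i)"
        by (intro ac_sum ac_mult c)
      moreover have "(\<Sum>j\<in>UNIV. h j x * \<phi> j x $ i + c j x * (A x l *v \<phi> j x) $ i) = w x $ i" for x
      proof -
        have "(\<Sum>j\<in>UNIV. h j x * \<phi> j x $ i) = g x $ i"
          using arg_cong[OF resolution[of x "g x"], of "\<lambda>u. u $ i"] by (simp add: h_def)
        moreover have "(\<Sum>j\<in>UNIV. c j x * (A x l *v \<phi> j x) $ i) = (A x l *v v x) $ i"
          unfolding v_def matrix_vector_mult_lincomb by simp
        ultimately show ?thesis by (simp add: w_def sum.distrib)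
      qed
      ultimately show ?thesis by (simp add: v_def)
    qed
    then have "has_ac_derivative v w"
      using L2_fun_set_integrable[OF wL2] L2_fun_measurable[OF wL2] by (intro ac_componentwise)
    then have "first_order_op A l v g"
      unfolding first_order_op_def H1_deriv_ac using g vL2 wL2 by (intro conjI exI[of _ w]) (auto simp: w_def)
    then show ?thesis using vnorm by blast
  qed
  have unique: "u = v" if u: "first_order_op A l u g" and v: "first_order_op A l v g" for u v g
  proof -
    have uv: "u \<in> L2_fun" "v \<in> L2_fun" using u v by (auto simp: first_order_op_def H1_deriv_def)
    define d where "d x = u x - v x" for x
    have dL2: "d \<in> L2_fun" unfolding d_def[abs_def] by (rule L2_fun_diff[OF uv])
    have const: "pairing (z j x) (d x) = pairing (z j 0) (d 0)" for j x
      using ac_same_derivative[OF pairing_ac[OF z' u] pairing_ac[OF z' v], of j x]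
      by (simp add: d_def pairing_linear algebra_simps)
    have zero: "pairing (z j 0) (d 0) = 0" for j
    proof (rule ccontr)
      assume nz: "pairing (z j 0) (d 0) \<noteq> 0"
      \<comment> \<open>\<open>K2 j\<close> may be zero, whence the added \<open>1\<close>\<close>
      define e where "e = cmod (pairing (z j 0) (d 0)) / (4 * K2 j + 1)"
      have e: "e > 0" using nz K2(1)[of j] by (simp add: e_def)
      define S where "S = (if \<rho> j < 0 then {..0::real} else {0..})"
      have low: "e \<le> norm (d x)" if "x \<in> S" for x
      proof -
        have "- \<rho> j * x \<le> 0" using that by (auto simp: S_def mult_nonpos_nonneg mult_nonpos_nonpos mult_nonneg_nonneg split: if_splits)
        then have "exp (- \<rho> j * x) \<le> 1" by simp
        then have "K2 j * exp (- \<rho> j * x) \<le> K2 j" using K2(1)[of j] by (simp add: mult_left_le)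
        then have zb: "norm (z j x) \<le> K2 j" using K2(2)[of j x] by simp
        have "cmod (pairing (z j 0) (d 0)) \<le> 4 * (norm (z j x) * norm (d x))"
          using norm_pairing[of "z j x" "d x"] const[of j x] by simp
        also have "\<dots> \<le> 4 * (K2 j * norm (d x))" by (intro mult_left_mono mult_right_mono zb) auto
        also have "\<dots> \<le> (4 * K2 j + 1) * norm (d x)" by (simp add: algebra_simps)
        finally show ?thesis using K2(1)[of j] by (simp add: e_def divide_le_eq mult.commute)
      qed
      have long: "\<exists>a. {a..a + real n} \<subseteq> S" for n
        by (intro exI[of _ "if \<rho> j < 0 then - real n else 0"]) (auto simp: S_def)
      have "S \<in> sets borel" by (simp add: S_def)
      from L2_fun_not_bounded_below[OF dL2 e this low long] show False .
    qed
    have "pairing (z j x) (d x) = 0" for j x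
      by (rule trans[OF const zero])
    then have "d x = 0" for x
      using resolution[of x "d x"] by simp
    then show ?thesis by (auto simp: d_def fun_eq_iff)
  qed
  have "\<exists>v. first_order_op A l v g \<and> (\<forall>u. first_order_op A l u g \<longrightarrow> u = v) \<and> L2_norm v \<le> Kt * (2 / \<delta>) * L2_norm g"
    if "g \<in> L2_fun" for g
    using solve[OF that] unique by blast
  then show ?thesis unfolding L2_spectrum_def by blast
qed

end

section \<open>Location and multiplicity of the spectrum on the imaginary axis\<close>

theorem theorem3:
  fixes A V :: "real \<Rightarrow> complex \<Rightarrow> complex^4^4" and T :: real
  assumes "T > 0"
    and "\<And>x l. A (x + T) l = A x l"
    and "regular_coefficient A"
    and "A1_real A"
    and "A2_symmetric A"
    and "\<And>x l. trace (A x l) = 0"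
    and "fundamental_solution A V"
  shows "\<forall>l. Re l = 0 \<longrightarrow>
    circle_count (V T l) \<in> {0, 2, 4} \<and>
    f3_complex (V T l) \<in> \<real> \<and>
    (Delta4 (V T l) \<noteq> 0 \<and> P4 (V T l) \<noteq> 0 \<and> D4 (V T l) \<noteq> 0 \<longrightarrow>
      (Delta4 (V T l) > 0 \<and> P4 (V T l) < 0 \<and> D4 (V T l) < 0 \<longrightarrow>
         ess_spectrum_with_mult A (V T l) l 4) \<and>
      (Delta4 (V T l) < 0 \<longrightarrow> ess_spectrum_with_mult A (V T l) l 2) \<and>
      (Delta4 (V T l) > 0 \<and> (P4 (V T l) > 0 \<or> D4 (V T l) > 0) \<longrightarrow>
         ess_spectrum_with_mult A (V T l) l 0))"
proof (intro allI impI)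
  fix l :: complex assume l: "Re l = 0"
  interpret floquet_system A V using assms by unfold_locales auto
  let ?M = "V T l"
  have per: "\<And>x. A (x + T) l = A x l" using assms(2) by simp
  have minor: "minor_sum3 ?M = cnj (trace ?M)" and real: "f3_complex ?M \<in> \<real>"
    using monodromy_imaginary_axis[OF _ assms(4,5) l, of T] assms(1) by auto
  note crit = circle_count_criterion[OF det_V minor real]
  have mult: "ess_spectrum_with_mult A ?M l m" if D: "Delta4 ?M \<noteq> 0" and m: "circle_count ?M = m" for m
  proof -
    have card4: "card {\<mu>. eigenvalue_of ?M \<mu>} = 4" and simple: "\<And>\<mu>. eigenvalue_of ?M \<mu> \<Longrightarrow> alg_mult ?M \<mu> = 1"
      using crit(2)[OF D] by auto
    have fin: "finite (circle_eigenvalues ?M)"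
      by (rule finite_subset[of _ "{\<mu>. eigenvalue_of ?M \<mu>}"])
         (use card4 in \<open>auto simp: circle_eigenvalues_def intro: card_ge_0_finite\<close>)
    have simple': "\<forall>\<mu>\<in>circle_eigenvalues ?M. alg_mult ?M \<mu> = 1"
      using simple by (auto simp: circle_eigenvalues_def)
    then have card: "card (circle_eigenvalues ?M) = m"
      using m by (simp add: circle_count_def)
    have "l \<notin> L2_spectrum A" if "m = 0"
    proof (rule bounded_inverse[OF assms(1) per card4])
      fix \<mu> assume "eigenvalue_of ?M \<mu>"
      moreover have "circle_eigenvalues ?M = {}" using card that fin by simp
      ultimately show "cmod \<mu> \<noteq> 1" by (auto simp: circle_eigenvalues_def)
    qed
    moreover have "l \<in> L2_ess_spectrum A" if "m \<noteq> 0"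
    proof -
      have "circle_eigenvalues ?M \<noteq> {}" using card that by auto
      then obtain \<mu> where "eigenvalue_of ?M \<mu>" "cmod \<mu> = 1" by (auto simp: circle_eigenvalues_def)
      from not_fredholm[OF assms(1) per this] show ?thesis by (simp add: L2_ess_spectrum_def)
    qed
    ultimately show ?thesis using card simple' by (simp add: ess_spectrum_with_mult_def)
  qed
  show "circle_count ?M \<in> {0, 2, 4} \<and> f3_complex ?M \<in> \<real> \<and>
    (Delta4 ?M \<noteq> 0 \<and> P4 ?M \<noteq> 0 \<and> D4 ?M \<noteq> 0 \<longrightarrow>
      (Delta4 ?M > 0 \<and> P4 ?M < 0 \<and> D4 ?M < 0 \<longrightarrow> ess_spectrum_with_mult A ?M l 4) \<and>
      (Delta4 ?M < 0 \<longrightarrow> ess_spectrum_with_mult A ?M l 2) \<and>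
      (Delta4 ?M > 0 \<and> (P4 ?M > 0 \<or> D4 ?M > 0) \<longrightarrow> ess_spectrum_with_mult A ?M l 0))"
  proof (intro conjI impI)
    show count: "circle_count ?M \<in> {0, 2, 4}" by (rule crit(1))
    show "f3_complex ?M \<in> \<real>" by (rule real)
    show "ess_spectrum_with_mult A ?M l 4" if "Delta4 ?M > 0 \<and> P4 ?M < 0 \<and> D4 ?M < 0"
    proof (rule mult)
      show "circle_count ?M = 4" using count crit(3,5) that by force
    qed (use that in simp)
    show "ess_spectrum_with_mult A ?M l 2" if "Delta4 ?M < 0"
    proof (rule mult)
      show "circle_count ?M = 2" using count crit(4,6) that by force
    qed (use that in simp)
    show "ess_spectrum_with_mult A ?M l 0" if "Delta4 ?M > 0 \<and> (P4 ?M > 0 \<or> D4 ?M > 0)"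
    proof (rule mult)
      show "circle_count ?M = 0" using count crit(5,6) that by force
    qed (use that in simp)
  qed
qed

end
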